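(* Let $\Gamma$ be the plane branch with Puiseux parametrization $(t^6,\ t^7+t^{10}+t^{11})$. Then the class $\mathcal{C}$ of analytic conjugacy of $\Gamma$ is non-complete; that is, there exist two branches in $\mathcal{C}$ that are not connected by a geodesic.
   Context: A plane branch is a reduced irreducible germ of analytic curve at $(0,0)\in\mathbb{C}^2$. Two branches $\Gamma_1,\Gamma_2$ are analytically conjugated if there is a germ of biholomorphism $\varphi\in\mathrm{Diff}(\mathbb{C}^2,0)$ (fixing the origin) with $\varphi(\Gamma_1)=\Gamma_2$; the class of analytic conjugacy of $\Gamma$ is the set of branches analytically conjugated to $\Gamma$. A singular holomorphic vector field is a germ of holomorphic vector field at $(0,0)$ vanishing at $(0,0)$; $\exp(X)$ denotes its time $1$ flow. Two branches $\Gamma_1,\Gamma_2$ in the same class are connected by a geodesic if there is a singular holomorphic vector field $X$ with $\exp(X)(\Gamma_1)=\Gamma_2$. A class is complete if any two of its elements are connected by a geodesic, and non-complete otherwise. *)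

theory Defs
  imports "HOL-Analysis.Analysis"
begin

type_synonym c2 = "complex \<times> complex"

text \<open>Complex differentiability: the real Frechet derivative exists and is complex linear.\<close>

definition holomorphic2_on :: "(c2 \<Rightarrow> complex) \<Rightarrow> c2 set \<Rightarrow> bool" where
  "holomorphic2_on f U \<longleftrightarrow>
     open U \<and> (\<forall>p\<in>U. \<exists>a b. (f has_derivative (\<lambda>(h, k). a * h + b * k)) (at p))"

definition holomorphic_map2_on :: "(c2 \<Rightarrow> c2) \<Rightarrow> c2 set \<Rightarrow> bool" where
  "holomorphic_map2_on F U \<longleftrightarrow>
     holomorphic2_on (\<lambda>p. fst (F p)) U \<and> holomorphic2_on (\<lambda>p. snd (F p)) U"

definition holomorphic_germ :: "(c2 \<Rightarrow> complex) \<Rightarrow> bool" where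
  "holomorphic_germ f \<longleftrightarrow> (\<exists>U. 0 \<in> U \<and> holomorphic2_on f U)"

definition biholomorphic_germ :: "(c2 \<Rightarrow> c2) \<Rightarrow> bool" where
  "biholomorphic_germ \<phi> \<longleftrightarrow> \<phi> 0 = 0 \<and>
     (\<exists>U V \<psi>. 0 \<in> U \<and> holomorphic_map2_on \<phi> U \<and> holomorphic_map2_on \<psi> V \<and>
        \<phi> ` U = V \<and> (\<forall>p\<in>U. \<psi> (\<phi> p) = p))"

text \<open>A germ of a set at the origin is given by any representative; every notion below depends on
  the representatives only up to \<open>same_germ\<close>.\<close>

definition same_germ :: "c2 set \<Rightarrow> c2 set \<Rightarrow> bool" where
  "same_germ A B \<longleftrightarrow> (\<forall>\<^sub>F p in nhds 0. p \<in> A \<longleftrightarrow> p \<in> B)"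

text \<open>\<open>f\<close> is an irreducible element of the local ring of holomorphic germs at the origin, whose
  units are the germs that do not vanish at the origin.\<close>

definition irreducible_germ :: "(c2 \<Rightarrow> complex) \<Rightarrow> bool" where
  "irreducible_germ f \<longleftrightarrow>
     holomorphic_germ f \<and> \<not> (\<forall>\<^sub>F p in nhds 0. f p = 0) \<and> f 0 = 0 \<and>
     (\<forall>g h. holomorphic_germ g \<and> holomorphic_germ h \<and> (\<forall>\<^sub>F p in nhds 0. f p = g p * h p)
        \<longrightarrow> g 0 \<noteq> 0 \<or> h 0 \<noteq> 0)"

text \<open>A reduced curve germ is determined by its zero set, so a branch is recorded as the set germ
  cut out by an irreducible equation.\<close>

definition plane_branch :: "c2 set \<Rightarrow> bool" where
  "plane_branch \<Gamma> \<longleftrightarrow> (\<exists>f. irreducible_germ f \<and> same_germ \<Gamma> {p. f p = 0})"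

text \<open>The germ of \<open>\<Gamma>\<close> is the image of the germ at \<open>0\<close> of the parametrization \<open>\<gamma>\<close>.\<close>

definition parametrized_by :: "c2 set \<Rightarrow> (complex \<Rightarrow> c2) \<Rightarrow> bool" where
  "parametrized_by \<Gamma> \<gamma> \<longleftrightarrow>
     (\<exists>r>0. \<forall>s. 0 < s \<and> s \<le> r \<longrightarrow> same_germ \<Gamma> (\<gamma> ` ball 0 s))"

text \<open>\<open>\<phi>(A) = B\<close> as germs. The image is taken on all sufficiently small neighbourhoods, so that
  values of \<open>\<phi>\<close> away from the origin are irrelevant; for the germ of a homeomorphism the germ of the
  image does not depend on the neighbourhood.\<close>

definition germ_image :: "(c2 \<Rightarrow> c2) \<Rightarrow> c2 set \<Rightarrow> c2 set \<Rightarrow> bool" where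
  "germ_image \<phi> A B \<longleftrightarrow>
     (\<exists>U. open U \<and> 0 \<in> U \<and>
        (\<forall>W. open W \<and> 0 \<in> W \<and> W \<subseteq> U \<longrightarrow> same_germ (\<phi> ` (A \<inter> W)) B))"

definition analytically_conjugated :: "c2 set \<Rightarrow> c2 set \<Rightarrow> bool" where
  "analytically_conjugated \<Gamma>\<^sub>1 \<Gamma>\<^sub>2 \<longleftrightarrow> (\<exists>\<phi>. biholomorphic_germ \<phi> \<and> germ_image \<phi> \<Gamma>\<^sub>1 \<Gamma>\<^sub>2)"

definition analytic_class :: "c2 set \<Rightarrow> c2 set set" where
  "analytic_class \<Gamma> = {\<Gamma>'. plane_branch \<Gamma>' \<and> analytically_conjugated \<Gamma> \<Gamma>'}"

definition singular_vector_field :: "(c2 \<Rightarrow> c2) \<Rightarrow> bool" where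
  "singular_vector_field X \<longleftrightarrow> X 0 = 0 \<and> (\<exists>U. 0 \<in> U \<and> holomorphic_map2_on X U)"

text \<open>\<open>\<phi>\<close> represents the germ \<open>exp(X)\<close>: for \<open>p\<close> near the origin, \<open>\<phi> p\<close> is the value at time \<open>1\<close> of
  the integral curve starting at \<open>p\<close>, which stays in a domain where \<open>X\<close> is holomorphic. For singular
  \<open>X\<close> such a \<open>\<phi>\<close> exists and its germ is unique.\<close>

definition time_one_flow :: "(c2 \<Rightarrow> c2) \<Rightarrow> (c2 \<Rightarrow> c2) \<Rightarrow> bool" where
  "time_one_flow X \<phi> \<longleftrightarrow>
     (\<exists>U. holomorphic_map2_on X U \<and>
        (\<forall>\<^sub>F p in nhds 0. \<exists>c :: real \<Rightarrow> c2.
           c 0 = p \<and> c 1 = \<phi> p \<and>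
           (\<forall>t\<in>{0..1}. c t \<in> U \<and> (c has_vector_derivative X (c t)) (at t within {0..1}))))"

definition connected_by_geodesic :: "c2 set \<Rightarrow> c2 set \<Rightarrow> bool" where
  "connected_by_geodesic \<Gamma>\<^sub>1 \<Gamma>\<^sub>2 \<longleftrightarrow>
     (\<exists>X \<phi>. singular_vector_field X \<and> time_one_flow X \<phi> \<and> germ_image \<phi> \<Gamma>\<^sub>1 \<Gamma>\<^sub>2)"

definition complete_class :: "c2 set set \<Rightarrow> bool" where
  "complete_class \<C> \<longleftrightarrow> (\<forall>\<Gamma>\<^sub>1\<in>\<C>. \<forall>\<Gamma>\<^sub>2\<in>\<C>. connected_by_geodesic \<Gamma>\<^sub>1 \<Gamma>\<^sub>2)"

end

theory Submission
  imports Defs "HOL-Complex_Analysis.Complex_Analysis"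
begin

text \<open>Let \<open>\<omega>\<close> be a primitive cube root of unity and \<open>\<phi>(x, y) = (\<omega> x + y\<^sup>2, \<omega>\<^sup>2 y + \<omega>\<^sup>2 x\<^sup>2) + O(3)\<close> a
  polynomial automorphism of the plane. The branches \<open>\<Gamma>\<close> and \<open>\<phi>(\<Gamma>)\<close> are not connected by a geodesic.

  If \<open>exp(X)(\<Gamma>) = \<phi>(\<Gamma>)\<close>, then \<open>\<phi>\<^sup>-\<^sup>1 \<circ> exp(X)\<close> preserves \<open>\<Gamma>\<close>. The branch is so rigid that such a map
  agrees with the identity up to order two, hence \<open>exp(X)\<close> and \<open>\<phi>\<close> have the same quadratic Taylor
  polynomial. The linear part of \<open>X\<close> commutes with \<open>diag(\<omega>, \<omega>\<^sup>2)\<close>, so it is \<open>diag(\<alpha>, \<beta>)\<close> with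
  \<open>exp \<alpha> = \<omega>\<close> and \<open>exp \<beta> = \<omega>\<^sup>2\<close>. The coefficient of \<open>y\<^sup>2\<close> in the first component of \<open>exp(X)\<close> is a multiple
  of the integral of \<open>exp((2\<beta> - \<alpha>) s)\<close> over the unit interval, which vanishes unless \<open>2\<beta> = \<alpha>\<close>; likewise
  the coefficient of \<open>x\<^sup>2\<close> in the second component gives \<open>2\<alpha> = \<beta>\<close>. So \<open>\<alpha> = 0\<close>, contradicting
  \<open>exp \<alpha> = \<omega>\<close>.

  That \<open>\<Gamma>\<close> is a branch is seen on an explicit equation: if it factors into two nonunits, each factor
  has zeros accumulating at the origin, hence vanishes along \<open>\<Gamma>\<close>, and so the \<open>y\<close>-derivative of the
  equation would vanish along \<open>\<Gamma>\<close>.\<close>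

section \<open>Rigidity of the branch\<close>

text \<open>The map exploits a gap between multiplicative and additive resonances. The monomials y^2
  in the first component and x^2 in the second are both resonant when the eigenvalues satisfy
  \<lambda> = \<mu>^2 and \<mu> = \<lambda>^2, that is, when \<lambda>^3 = 1 and \<mu> =
  \<lambda>^2; for logarithms of the eigenvalues the same two relations leave only 0. Each monomial
  alone could be reached by a suitable choice of logarithms, so both are present.

  Quadratic precision suffices because cubic terms have order at least 18 in t along the branch.
  After division by t^6 and t^7 the two coordinates are compared modulo t^11, and the last
  coefficient equation used sits at t^10.

  The parameter \<tau> of the image of the point with parameter t is only known to exist; nothing
  says that it depends continuously on t. The comparison therefore runs along sequences with big-O
  bounds instead of power series in t. A time one map is likewise just a function near 0, so Taylor
  polynomials are expressed by error bounds, and those of the flow come from variation of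
  constants.\<close>

lemma bigo_bounded_mult:
  fixes f g h :: "'a \<Rightarrow> complex"
  assumes "h \<in> O[F](\<lambda>_. 1)" "f \<in> O[F](g)"
  shows "(\<lambda>n. h n * f n) \<in> O[F](g)"
  using landau_o.big.mult[OF assms] by simp

lemma tendsto_imp_bigo_1:
  fixes f :: "'a \<Rightarrow> complex"
  assumes "(f \<longlongrightarrow> l) F"
  shows "f \<in> O[F](\<lambda>_. 1)"
  by (rule bigoI_tendsto[where c = l]) (use assms in auto)

lemma bigo_tendsto_0:
  fixes f g :: "'a \<Rightarrow> complex"
  assumes "f \<in> O[F](g)" "(g \<longlongrightarrow> 0) F"
  shows "(f \<longlongrightarrow> 0) F"
proof -
  obtain c where "eventually (\<lambda>n. norm (f n) \<le> c * norm (g n)) F"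
    using assms(1) by (rule landau_o.bigE)
  moreover have "((\<lambda>n. c * norm (g n)) \<longlongrightarrow> 0) F"
    using tendsto_mult_right_zero[OF tendsto_norm_zero[OF assms(2)]] .
  ultimately show ?thesis by (rule Lim_null_comparison)
qed

lemma bigo_power_le:
  fixes t :: "'a \<Rightarrow> complex"
  assumes "(t \<longlongrightarrow> 0) F" "j \<le> k"
  shows "(\<lambda>n. t n ^ k) \<in> O[F](\<lambda>n. t n ^ j)"
proof -
  have "(\<lambda>n. t n ^ (k - j) * t n ^ j) \<in> O[F](\<lambda>n. t n ^ j)"
    by (intro bigo_bounded_mult tendsto_imp_bigo_1[where l = "0 ^ (k - j)"] tendsto_power assms) simp
  then show ?thesis using assms(2) by (simp flip: power_add)
qed

text \<open>The limit along F kills the constant coefficient; dividing by t then lowers the order by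
  one, which is where t must be nonzero. This replaces comparison of power series when only a
  sequence of parameters is available.\<close>

lemma poly_bigo_imp_coeff_zero:
  fixes t :: "'a \<Rightarrow> complex"
  assumes "F \<noteq> bot" "(t \<longlongrightarrow> 0) F" "eventually (\<lambda>n. t n \<noteq> 0) F"
    "(\<lambda>n. poly p (t n)) \<in> O[F](\<lambda>n. t n ^ k)"
  shows "\<forall>i<k. coeff p i = 0"
  using assms(4)
proof (induction k arbitrary: p)
  case (Suc k)
  obtain a q where p: "p = pCons a q" by (cases p)
  have "((\<lambda>n. t n ^ Suc k) \<longlongrightarrow> 0 ^ Suc k) F" by (intro tendsto_power assms)
  then have "((\<lambda>n. poly p (t n)) \<longlongrightarrow> 0) F"
    by (intro bigo_tendsto_0[OF Suc.prems]) simp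
  moreover have "((\<lambda>n. poly p (t n)) \<longlongrightarrow> poly p 0) F"
    by (intro tendsto_intros assms)
  ultimately have a: "a = 0"
    using tendsto_unique[OF assms(1)] p by fastforce
  have "(\<lambda>n. t n * poly q (t n)) \<in> O[F](\<lambda>n. t n * t n ^ k)"
    using Suc.prems p a by simp
  then have "(\<lambda>n. poly q (t n)) \<in> O[F](\<lambda>n. t n ^ k)"
    by (rule landau_o.big.mult_cancel_left[THEN iffD1, rotated 2]) (use assms(3) in auto)
  then have "\<forall>i<k. coeff q i = 0" by (rule Suc.IH)
  then show ?case using p a by (auto simp: coeff_pCons split: nat.splits)
qed simp

lemma bigo_power_diff:
  fixes \<rho> :: "'a \<Rightarrow> complex"
  assumes "(\<rho> \<longlongrightarrow> l) F" "(\<lambda>n. \<rho> n - l) \<in> O[F](g)"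
  shows "(\<lambda>n. \<rho> n ^ m - l ^ m) \<in> O[F](g)"
proof -
  have eq: "\<rho> n ^ m - l ^ m = (\<Sum>i<m. l ^ (m - Suc i) * \<rho> n ^ i) * (\<rho> n - l)" for n
    by (simp add: power_diff_sumr2 mult.commute)
  show ?thesis unfolding eq
    by (intro bigo_bounded_mult assms(2)
        tendsto_imp_bigo_1[where l = "\<Sum>i<m. l ^ (m - Suc i) * l ^ i"] tendsto_intros assms(1))
qed

text \<open>The cofactor of \<rho> - l in \<rho>^m - l^m tends to m l^(m-1), which is nonzero, so
  its inverse is bounded.\<close>

lemma bigo_diff_of_power_diff:
  fixes \<rho> :: "'a \<Rightarrow> complex"
  assumes "(\<rho> \<longlongrightarrow> l) F" "l \<noteq> 0" "m > 0" "(\<lambda>n. \<rho> n ^ m - l ^ m) \<in> O[F](g)"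
  shows "(\<lambda>n. \<rho> n - l) \<in> O[F](g)"
proof -
  let ?s = "\<lambda>n. \<Sum>i<m. l ^ (m - Suc i) * \<rho> n ^ i"
  have "(?s \<longlongrightarrow> (\<Sum>i<m. l ^ (m - Suc i) * l ^ i)) F"
    by (intro tendsto_intros assms(1))
  also have "(\<Sum>i<m. l ^ (m - Suc i) * l ^ i) = of_nat m * l ^ (m - 1)"
    by (simp flip: power_add)
  finally have s: "(?s \<longlongrightarrow> of_nat m * l ^ (m - 1)) F" .
  have s0: "of_nat m * l ^ (m - 1) \<noteq> 0" using assms by simp
  have ev: "eventually (\<lambda>n. ?s n \<noteq> 0) F" using tendsto_imp_eventually_ne[OF s s0] .
  have "(\<lambda>n. inverse (?s n) * (\<rho> n ^ m - l ^ m)) \<in> O[F](g)"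
    by (intro bigo_bounded_mult assms(4) tendsto_imp_bigo_1[OF tendsto_inverse[OF s s0]])
  also have "?this \<longleftrightarrow> ?thesis"
  proof (rule landau_o.big.in_cong, use ev in eventually_elim)
    case (elim n)
    have "\<rho> n ^ m - l ^ m = ?s n * (\<rho> n - l)"
      by (simp add: power_diff_sumr2 mult.commute)
    then show ?case using elim by (simp add: field_simps)
  qed
  finally show ?thesis .
qed

text \<open>After \<rho> - 1 is factored out, the remaining factor is a sum of terms \<rho>^i - 1,
  each again of order g.\<close>

lemma bigo_power_diff_linear:
  fixes \<rho> :: "'a \<Rightarrow> complex"
  assumes "(\<rho> \<longlongrightarrow> 1) F" "(\<lambda>n. \<rho> n - 1) \<in> O[F](g)"
  shows "(\<lambda>n. \<rho> n ^ m - (1 + of_nat m * (\<rho> n - 1))) \<in> O[F](\<lambda>n. g n * g n)"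
proof -
  have eq: "\<rho> n ^ m - (1 + of_nat m * (\<rho> n - 1)) = (\<Sum>i<m. \<rho> n ^ i - 1 ^ i) * (\<rho> n - 1)" for n
  proof -
    have "\<rho> n ^ m - 1 = (\<Sum>i<m. \<rho> n ^ i) * (\<rho> n - 1)"
      using power_diff_1_eq[of "\<rho> n" m] by (simp add: mult.commute)
    then show ?thesis by (simp add: sum_subtractf algebra_simps)
  qed
  show ?thesis unfolding eq
    by (intro landau_o.big.mult assms big_sum_in_bigo bigo_power_diff)
qed

text \<open>With \<open>\<rho> = \<tau> / t\<close>, the hypotheses say that the image of \<open>(t\<^sup>6, t\<^sup>7 + t\<^sup>1\<^sup>0 + t\<^sup>1\<^sup>1)\<close> under a map
  with quadratic Taylor coefficients \<open>a, \<dots>, e\<close> and \<open>a', \<dots>, e'\<close> (for \<open>x, y, x\<^sup>2, x y, y\<^sup>2\<close>) is the point of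
  parameter \<open>\<tau>\<close>; the two coordinates have been divided by \<open>t\<^sup>6\<close> and \<open>t\<^sup>7\<close>. The orders 3 and 4 force
  \<open>l\<^sup>3 = l\<^sup>4 = 1\<close>, after which the equations can be linearized in \<open>\<rho> - 1\<close>.\<close>

lemma branch_rigid_tendsto:
  fixes t \<rho> :: "nat \<Rightarrow> complex"
  assumes t: "t \<longlonglongrightarrow> 0" and t0: "\<And>n. t n \<noteq> 0"
    and rho: "\<rho> \<longlonglongrightarrow> l" and l0: "l \<noteq> 0"
    and X: "(\<lambda>n. \<rho> n ^ 6 - (a + b * (t n + t n ^ 4 + t n ^ 5) + c * t n ^ 6 + d * (t n ^ 7 + t n ^ 10)
        + e * t n ^ 8)) \<in> O(\<lambda>n. t n ^ 11)"
    and Y: "(\<lambda>n. \<rho> n ^ 7 + t n ^ 3 * \<rho> n ^ 10 + t n ^ 4 * \<rho> n ^ 11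
        - (b' * (1 + t n ^ 3 + t n ^ 4) + c' * t n ^ 5 + d' * (t n ^ 6 + t n ^ 9 + t n ^ 10)
          + e' * (t n ^ 7 + 2 * t n ^ 10))) \<in> O(\<lambda>n. t n ^ 11)"
  shows "a = 1 \<and> b = 0 \<and> c = 0 \<and> d = 0 \<and> e = 0 \<and> b' = 1 \<and> c' = 0 \<and> d' = 0 \<and> e' = 0"
proof -
  note P = poly_bigo_imp_coeff_zero[OF sequentially_bot t always_eventually[OF allI[OF t0]]]
  have pw: "(\<lambda>n. t n ^ k) \<in> O(\<lambda>n. t n ^ j)" if "j \<le> k" for j k
    by (rule bigo_power_le[OF t that])
  have lift: "f \<in> O(\<lambda>n. t n ^ j)" if "f \<in> O(\<lambda>n. t n ^ k)" "j \<le> k" for f j k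
    using landau_o.big_trans[OF that(1) pw[OF that(2)]] .
  have tpw: "(\<lambda>n. f n * t n ^ k) \<in> O(\<lambda>n. t n ^ j)" if "f \<longlonglongrightarrow> l" "j \<le> k" for j k l f
    by (intro bigo_bounded_mult[OF tendsto_imp_bigo_1[OF that(1)]] pw that)
  have tr: "(\<lambda>n. t n ^ k) \<longlonglongrightarrow> 0" if "k > 0" for k
    using tendsto_power[OF t, of k] that by (simp add: power_0_left)
  have la: "l ^ 6 = a"
  proof -
    have "(\<lambda>n. \<rho> n ^ 6 - (a + b * (t n + t n ^ 4 + t n ^ 5) + c * t n ^ 6 + d * (t n ^ 7 + t n ^ 10)
        + e * t n ^ 8)) \<longlonglongrightarrow> l ^ 6 - (a + b * (0 + 0 ^ 4 + 0 ^ 5) + c * 0 ^ 6 + d * (0 ^ 7 + 0 ^ 10) + e * 0 ^ 8)"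
      by (intro tendsto_intros t rho)
    with bigo_tendsto_0[OF X tr] show ?thesis
      using LIMSEQ_unique by fastforce
  qed
  have lb: "l ^ 7 = b'"
  proof -
    have "(\<lambda>n. \<rho> n ^ 7 + t n ^ 3 * \<rho> n ^ 10 + t n ^ 4 * \<rho> n ^ 11
        - (b' * (1 + t n ^ 3 + t n ^ 4) + c' * t n ^ 5 + d' * (t n ^ 6 + t n ^ 9 + t n ^ 10)
          + e' * (t n ^ 7 + 2 * t n ^ 10))) \<longlonglongrightarrow> l ^ 7 + 0 ^ 3 * l ^ 10 + 0 ^ 4 * l ^ 11
        - (b' * (1 + 0 ^ 3 + 0 ^ 4) + c' * 0 ^ 5 + d' * (0 ^ 6 + 0 ^ 9 + 0 ^ 10)
          + e' * (0 ^ 7 + 2 * 0 ^ 10))"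
      by (intro tendsto_intros t rho)
    with bigo_tendsto_0[OF Y tr] show ?thesis
      using LIMSEQ_unique by fastforce
  qed
  \<comment> \<open>Apart from \<rho>^7 and the constant b' = l^7, every term of the second equation
    carries a factor t^3.\<close>
  have "(\<lambda>n. \<rho> n ^ 7 - l ^ 7) \<in> O(\<lambda>n. t n ^ 3)"
  proof -
    have "(\<lambda>n. (\<rho> n ^ 7 + t n ^ 3 * \<rho> n ^ 10 + t n ^ 4 * \<rho> n ^ 11
        - (b' * (1 + t n ^ 3 + t n ^ 4) + c' * t n ^ 5 + d' * (t n ^ 6 + t n ^ 9 + t n ^ 10)
          + e' * (t n ^ 7 + 2 * t n ^ 10))) +
        (b' + b' * t n + c' * t n ^ 2 + d' * (t n ^ 3 + t n ^ 6 + t n ^ 7) + e' * (t n ^ 4 + 2 * t n ^ 7)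
          - \<rho> n ^ 10 - t n * \<rho> n ^ 11) * t n ^ 3) \<in> O(\<lambda>n. t n ^ 3)"
      by (intro sum_in_bigo(1) lift[OF Y] tpw[where l = "b' + b' * 0 + c' * 0 ^ 2 + d' * (0 ^ 3 + 0 ^ 6 + 0 ^ 7) + e' * (0 ^ 4 + 2 * 0 ^ 7)
          - l ^ 10 - 0 * l ^ 11"] tendsto_intros t rho) simp_all
    also have "(\<lambda>n. (\<rho> n ^ 7 + t n ^ 3 * \<rho> n ^ 10 + t n ^ 4 * \<rho> n ^ 11
        - (b' * (1 + t n ^ 3 + t n ^ 4) + c' * t n ^ 5 + d' * (t n ^ 6 + t n ^ 9 + t n ^ 10)
          + e' * (t n ^ 7 + 2 * t n ^ 10))) +
        (b' + b' * t n + c' * t n ^ 2 + d' * (t n ^ 3 + t n ^ 6 + t n ^ 7) + e' * (t n ^ 4 + 2 * t n ^ 7)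
          - \<rho> n ^ 10 - t n * \<rho> n ^ 11) * t n ^ 3) = (\<lambda>n. \<rho> n ^ 7 - l ^ 7)"
      by (rule ext) (simp add: lb; algebra)
    finally show ?thesis .
  qed
  then have r3: "(\<lambda>n. \<rho> n - l) \<in> O(\<lambda>n. t n ^ 3)"
    by (rule bigo_diff_of_power_diff[OF rho l0, rotated]) simp
  \<comment> \<open>With \<rho> constant up to t^3, the term b t of the first equation has nothing
    to cancel against.\<close>
  have b0: "b = 0"
  proof -
    have "(\<lambda>n. (\<rho> n ^ 6 - l ^ 6) - (\<rho> n ^ 6 - (a + b * (t n + t n ^ 4 + t n ^ 5) + c * t n ^ 6 + d * (t n ^ 7 + t n ^ 10)
        + e * t n ^ 8)) - (b * (t n + t n ^ 2) + c * t n ^ 3 + d * (t n ^ 4 + t n ^ 7)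
        + e * t n ^ 5) * t n ^ 3) \<in> O(\<lambda>n. t n ^ 3)"
      by (intro sum_in_bigo(2) lift[OF X] bigo_power_diff[OF rho r3]
         tpw[where l = "b * (0 + 0 ^ 2) + c * 0 ^ 3 + d * (0 ^ 4 + 0 ^ 7) + e * 0 ^ 5"] tendsto_intros t) simp_all
    also have "(\<lambda>n. (\<rho> n ^ 6 - l ^ 6) - (\<rho> n ^ 6 - (a + b * (t n + t n ^ 4 + t n ^ 5) + c * t n ^ 6 + d * (t n ^ 7 + t n ^ 10)
        + e * t n ^ 8)) - (b * (t n + t n ^ 2) + c * t n ^ 3 + d * (t n ^ 4 + t n ^ 7)
        + e * t n ^ 5) * t n ^ 3) = (\<lambda>n. poly [:0, b:] (t n))"
      by (rule ext) (simp add: la; algebra)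
    finally have "\<forall>i<3. coeff [:0, b:] i = 0" by (rule P)
    then have "coeff [:0, b:] 1 = 0" by (metis one_less_numeral_iff semiring_norm(77))
    then show ?thesis by simp
  qed
  \<comment> \<open>Once b = 0, the first nonconstant term of the first equation is c t^6, so the
    estimate improves from order 3 to order 6.\<close>
  have r6: "(\<lambda>n. \<rho> n - l) \<in> O(\<lambda>n. t n ^ 6)"
  proof (rule bigo_diff_of_power_diff[OF rho l0])
    have "(\<lambda>n. (\<rho> n ^ 6 - (a + b * (t n + t n ^ 4 + t n ^ 5) + c * t n ^ 6 + d * (t n ^ 7 + t n ^ 10)
        + e * t n ^ 8)) + (c + d * (t n + t n ^ 4) + e * t n ^ 2) * t n ^ 6) \<in> O(\<lambda>n. t n ^ 6)"
      by (intro sum_in_bigo(1) lift[OF X]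
         tpw[where l = "c + d * (0 + 0 ^ 4) + e * 0 ^ 2"] tendsto_intros t) simp_all
    also have "(\<lambda>n. (\<rho> n ^ 6 - (a + b * (t n + t n ^ 4 + t n ^ 5) + c * t n ^ 6 + d * (t n ^ 7 + t n ^ 10)
        + e * t n ^ 8)) + (c + d * (t n + t n ^ 4) + e * t n ^ 2) * t n ^ 6) = (\<lambda>n. \<rho> n ^ 6 - l ^ 6)"
      by (rule ext) (simp add: la b0; algebra)
    finally show "(\<lambda>n. \<rho> n ^ 6 - l ^ 6) \<in> O(\<lambda>n. t n ^ 6)" .
  qed simp
  \<comment> \<open>Modulo t^5 every \<rho> in the second equation may now be replaced by l. The
    coefficients of t^3 and t^4 read l^10 = b' and l^11 = b', while b' = l^7.\<close>
  have "l = 1"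
  proof -
    have "(\<lambda>n. (\<rho> n ^ 7 + t n ^ 3 * \<rho> n ^ 10 + t n ^ 4 * \<rho> n ^ 11
        - (b' * (1 + t n ^ 3 + t n ^ 4) + c' * t n ^ 5 + d' * (t n ^ 6 + t n ^ 9 + t n ^ 10)
          + e' * (t n ^ 7 + 2 * t n ^ 10))) - (\<rho> n ^ 7 - l ^ 7) - t n ^ 3 * (\<rho> n ^ 10 - l ^ 10)
          - t n ^ 4 * (\<rho> n ^ 11 - l ^ 11)
          + (c' + d' * (t n + t n ^ 4 + t n ^ 5) + e' * (t n ^ 2 + 2 * t n ^ 5)) * t n ^ 5) \<in> O(\<lambda>n. t n ^ 5)"
      by (intro sum_in_bigo(1) sum_in_bigo(2) lift[OF Y] lift[OF bigo_power_diff[OF rho r6]]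
          bigo_bounded_mult tendsto_imp_bigo_1[OF tr]
          tpw[where l = "c' + d' * (0 + 0 ^ 4 + 0 ^ 5) + e' * (0 ^ 2 + 2 * 0 ^ 5)"] tendsto_intros t) simp_all
    also have "(\<lambda>n. (\<rho> n ^ 7 + t n ^ 3 * \<rho> n ^ 10 + t n ^ 4 * \<rho> n ^ 11
        - (b' * (1 + t n ^ 3 + t n ^ 4) + c' * t n ^ 5 + d' * (t n ^ 6 + t n ^ 9 + t n ^ 10)
          + e' * (t n ^ 7 + 2 * t n ^ 10))) - (\<rho> n ^ 7 - l ^ 7) - t n ^ 3 * (\<rho> n ^ 10 - l ^ 10)
          - t n ^ 4 * (\<rho> n ^ 11 - l ^ 11)
          + (c' + d' * (t n + t n ^ 4 + t n ^ 5) + e' * (t n ^ 2 + 2 * t n ^ 5)) * t n ^ 5)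
        = (\<lambda>n. poly [:0, 0, 0, l ^ 10 - l ^ 7, l ^ 11 - l ^ 7:] (t n))"
      by (rule ext) (simp flip: lb; algebra)
    finally have co: "\<forall>i<5. coeff [:0, 0, 0, l ^ 10 - l ^ 7, l ^ 11 - l ^ 7:] i = 0" by (rule P)
    have "l ^ 10 = l ^ 7" "l ^ 11 = l ^ 7"
      using spec[OF co, of 3] spec[OF co, of 4] by (simp_all add: eval_nat_numeral)
    then have "l ^ 7 * (l ^ 3 - 1) = 0" "l ^ 7 * (l ^ 4 - 1) = 0" by algebra+
    then have "l ^ 3 = 1" "l ^ 4 = 1" using l0 by simp_all
    then show ?thesis by algebra
  qed
  then have rho1: "\<rho> \<longlonglongrightarrow> 1" and r6: "(\<lambda>n. \<rho> n - 1) \<in> O(\<lambda>n. t n ^ 6)"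
    and ab: "a = 1" "b' = 1"
    using rho r6 la lb by simp_all
  \<comment> \<open>The quadratic error of the linearization has order 12, just beyond the working
    precision 11.\<close>
  have lin: "(\<lambda>n. \<rho> n ^ m - (1 + of_nat m * (\<rho> n - 1))) \<in> O(\<lambda>n. t n ^ 11)" for m
  proof -
    have "(\<lambda>n. t n ^ 6 * t n ^ 6) = (\<lambda>n. t n ^ 12)" by (rule ext) algebra
    then have "(\<lambda>n. \<rho> n ^ m - (1 + of_nat m * (\<rho> n - 1))) \<in> O(\<lambda>n. t n ^ 12)"
      using bigo_power_diff_linear[OF rho1 r6, of m] by simp
    then show ?thesis by (rule lift) simp
  qed
  \<comment> \<open>After linearization \<rho> - 1 has factor 6 in the first equation X and factor 7
    + 10 t^3 + 11 t^4 in the second equation Y. The combination 6 Y - (7 + 10 t^3 + 11 t^4) X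
    eliminates it; \<open>p\<close> is what remains below order 11.\<close>
  define p where "p = [:0, 0, 0, 0, 0, -6 * c', 7*c - 6*d', 7*d - 6*e', 7*e, 10*c - 6*d',
      17*d + 11*c - 6*d' - 12*e':]"
  have "(\<lambda>n. poly p (t n)) \<in> O(\<lambda>n. t n ^ 11)"
  proof -
    let ?X = "\<lambda>n. \<rho> n ^ 6 - (a + b * (t n + t n ^ 4 + t n ^ 5) + c * t n ^ 6 + d * (t n ^ 7 + t n ^ 10)
        + e * t n ^ 8)"
    let ?Y = "\<lambda>n. \<rho> n ^ 7 + t n ^ 3 * \<rho> n ^ 10 + t n ^ 4 * \<rho> n ^ 11
        - (b' * (1 + t n ^ 3 + t n ^ 4) + c' * t n ^ 5 + d' * (t n ^ 6 + t n ^ 9 + t n ^ 10)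
          + e' * (t n ^ 7 + 2 * t n ^ 10))"
    let ?L = "\<lambda>m n. \<rho> n ^ m - (1 + of_nat m * (\<rho> n - 1))"
    \<comment> \<open>The part of (7 + 10 t^3 + 11 t^4) (d (t^7 + t^10) + e t^8) of order at least
      11, divided by t^11.\<close>
    let ?R = "\<lambda>n. 10 * (d * (t n ^ 2) + e) + 11 * (d * (1 + t n ^ 3) + e * t n)"
    have bd: "(\<lambda>n. h n * f n) \<in> O(\<lambda>n. t n ^ 11)"
      if "h \<longlonglongrightarrow> k" "f \<in> O(\<lambda>n. t n ^ 11)" for f h k
      by (rule bigo_bounded_mult[OF tendsto_imp_bigo_1[OF that(1)] that(2)])
    have k: "(\<lambda>n. 6 * t n ^ 3) \<longlonglongrightarrow> 6 * 0 ^ 3" "(\<lambda>n. 6 * t n ^ 4) \<longlonglongrightarrow> 6 * 0 ^ 4"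
      "(\<lambda>n. 7 + 10 * t n ^ 3 + 11 * t n ^ 4) \<longlonglongrightarrow> 7 + 10 * 0 ^ 3 + 11 * 0 ^ 4"
      "?R \<longlonglongrightarrow> 10 * (d * (0 ^ 2) + e) + 11 * (d * (1 + 0 ^ 3) + e * 0)"
      by (intro tendsto_intros t)+
    have "(\<lambda>n. 6 * ?Y n - 6 * ?L 7 n - 6 * t n ^ 3 * ?L 10 n - 6 * t n ^ 4 * ?L 11 n
        + (7 + 10 * t n ^ 3 + 11 * t n ^ 4) * ?L 6 n - (7 + 10 * t n ^ 3 + 11 * t n ^ 4) * ?X n
        - ?R n * t n ^ 11) \<in> O(\<lambda>n. t n ^ 11)"
      by (rule sum_in_bigo(1) sum_in_bigo(2) bd[OF tendsto_const Y] bd[OF tendsto_const lin]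
          bd[OF k(1) lin] bd[OF k(2) lin] bd[OF k(3) lin] bd[OF k(3) X] bd[OF k(4) pw[OF order_refl]])+
    also have "(\<lambda>n. 6 * ?Y n - 6 * ?L 7 n - 6 * t n ^ 3 * ?L 10 n - 6 * t n ^ 4 * ?L 11 n
        + (7 + 10 * t n ^ 3 + 11 * t n ^ 4) * ?L 6 n - (7 + 10 * t n ^ 3 + 11 * t n ^ 4) * ?X n
        - ?R n * t n ^ 11) = (\<lambda>n. poly p (t n))" (is "?Z = _")
    proof
      fix n
      \<comment> \<open>The powers of \<rho> and the difference \<rho> - 1 become independent
        variables: the identity is linear in them and must not be normalized by expanding powers of
        \<rho>.\<close>
      have eq: "6 * (A7 + u ^ 3 * A10 + u ^ 4 * A11
        - ((1 + u ^ 3 + u ^ 4) + c' * u ^ 5 + d' * (u ^ 6 + u ^ 9 + u ^ 10)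
          + e' * (u ^ 7 + 2 * u ^ 10))) - 6 * (A7 - (1 + 7 * D)) - 6 * u ^ 3 * (A10 - (1 + 10 * D))
          - 6 * u ^ 4 * (A11 - (1 + 11 * D)) + (7 + 10 * u ^ 3 + 11 * u ^ 4) * (A6 - (1 + 6 * D))
          - (7 + 10 * u ^ 3 + 11 * u ^ 4) * (A6 - (1 + c * u ^ 6 + d * (u ^ 7 + u ^ 10) + e * u ^ 8))
          - (10 * (d * (u ^ 2) + e) + 11 * (d * (1 + u ^ 3) + e * u)) * u ^ 11 = poly p u"
        for A6 A7 A10 A11 D u :: complex
        unfolding p_def by (simp add: algebra_simps power_numeral_reduce)
      show "?Z n = poly p (t n)"
        using eq[of "\<rho> n ^ 7" "t n" "\<rho> n ^ 10" "\<rho> n ^ 11" "\<rho> n - 1" "\<rho> n ^ 6"] ab b0 by simp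
    qed
    finally show ?thesis .
  qed
  then have co: "\<forall>i<11. coeff p i = 0" by (rule P)
  \<comment> \<open>Orders 6 and 9 both relate c to d' but with factors 7 and 10, so both vanish;
    then orders 7 and 10 give 14 d = 12 e' = 17 d. The terms t^10 and t^11 of the branch supply the
    second relation of each pair.\<close>
  have "c' = 0" "7*c = 6*d'" "7*d = 6*e'" "e = 0" "10*c = 6*d'" "17*d + 11*c - 6*d' - 12*e' = 0"
    using spec[OF co, of 5] spec[OF co, of 6] spec[OF co, of 7] spec[OF co, of 8] spec[OF co, of 9]
      spec[OF co, of 10] unfolding p_def by (simp_all add: eval_nat_numeral)
  moreover from this have c: "c = 0" by algebra
  moreover have "d = 0" using calculation by algebra
  ultimately show ?thesis using ab b0 by simp
qed

text \<open>Here \<tau> is an arbitrary sequence. Since (\<tau> / t)^6 converges, \<tau> / t is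
  bounded, and a convergent subsequence is enough because the conclusion concerns constants
  only.\<close>

lemma branch_rigid_seq:
  fixes t \<tau> :: "nat \<Rightarrow> complex"
  assumes t: "t \<longlonglongrightarrow> 0" and t0: "\<And>n. t n \<noteq> 0"
    and X: "(\<lambda>n. \<tau> n ^ 6 - (a * t n ^ 6 + b * (t n ^ 7 + t n ^ 10 + t n ^ 11) + c * t n ^ 12
        + d * (t n ^ 13 + t n ^ 16) + e * t n ^ 14)) \<in> O(\<lambda>n. t n ^ 17)"
    and Y: "(\<lambda>n. \<tau> n ^ 7 + \<tau> n ^ 10 + \<tau> n ^ 11 - (a' * t n ^ 6 + b' * (t n ^ 7 + t n ^ 10 + t n ^ 11)
        + c' * t n ^ 12 + d' * (t n ^ 13 + t n ^ 16 + t n ^ 17) + e' * (t n ^ 14 + 2 * t n ^ 17)))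
        \<in> O(\<lambda>n. t n ^ 18)"
    and det: "a * b' \<noteq> a' * b"
  shows "a = 1 \<and> b = 0 \<and> c = 0 \<and> d = 0 \<and> e = 0
    \<and> a' = 0 \<and> b' = 1 \<and> c' = 0 \<and> d' = 0 \<and> e' = 0"
proof -
  define \<rho> where "\<rho> = (\<lambda>n. \<tau> n / t n)"
  have \<tau>: "\<tau> n = \<rho> n * t n" for n using t0[of n] by (simp add: \<rho>_def)
  have tr: "(\<lambda>n. t n ^ k) \<longlonglongrightarrow> 0" if "k > 0" for k
    using tendsto_power[OF t, of k] that by (simp add: power_0_left)
  let ?X = "\<lambda>n. \<rho> n ^ 6 - (a + b * (t n + t n ^ 4 + t n ^ 5) + c * t n ^ 6 + d * (t n ^ 7 + t n ^ 10)
        + e * t n ^ 8)"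
  let ?Y = "\<lambda>n. \<rho> n ^ 7 + t n ^ 3 * \<rho> n ^ 10 + t n ^ 4 * \<rho> n ^ 11
        - (b' * (1 + t n ^ 3 + t n ^ 4) + c' * t n ^ 5 + d' * (t n ^ 6 + t n ^ 9 + t n ^ 10)
          + e' * (t n ^ 7 + 2 * t n ^ 10))"
  have eqX: "(r * u) ^ 6 - (a * u ^ 6 + b * (u ^ 7 + u ^ 10 + u ^ 11) + c * u ^ 12
      + d * (u ^ 13 + u ^ 16) + e * u ^ 14) = (r ^ 6 - (a + b * (u + u ^ 4 + u ^ 5) + c * u ^ 6
      + d * (u ^ 7 + u ^ 10) + e * u ^ 8)) * u ^ 6" for r u
    by (simp add: algebra_simps power_numeral_reduce)
  have eqY: "(r * u) ^ 7 + (r * u) ^ 10 + (r * u) ^ 11 - (a' * u ^ 6 + b' * (u ^ 7 + u ^ 10 + u ^ 11)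
      + c' * u ^ 12 + d' * (u ^ 13 + u ^ 16 + u ^ 17) + e' * (u ^ 14 + 2 * u ^ 17))
    = (u * (r ^ 7 + u ^ 3 * r ^ 10 + u ^ 4 * r ^ 11 - (b' * (1 + u ^ 3 + u ^ 4) + c' * u ^ 5
        + d' * (u ^ 6 + u ^ 9 + u ^ 10) + e' * (u ^ 7 + 2 * u ^ 10))) - a') * u ^ 6" for r u
    by (simp add: algebra_simps power_numeral_reduce)
  have pw: "u ^ 11 * u ^ 6 = u ^ 17" "u ^ 12 * u ^ 6 = u ^ 18" for u :: complex
    by (simp_all flip: power_add)
  have "(\<lambda>n. ?X n * t n ^ 6) \<in> O(\<lambda>n. t n ^ 11 * t n ^ 6)"
    using X unfolding \<tau> eqX pw .
  then have X': "?X \<in> O(\<lambda>n. t n ^ 11)"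
    by (rule landau_o.big.mult_cancel_right[THEN iffD1, rotated 2]) (use t0 in auto)
  \<comment> \<open>Only t^6 can be divided out of the second coordinate as long as a' may be
    nonzero; the seventh factor t is cancelled after a' = 0 is known.\<close>
  have "(\<lambda>n. (t n * ?Y n - a') * t n ^ 6) \<in> O(\<lambda>n. t n ^ 12 * t n ^ 6)"
    using Y unfolding \<tau> eqY pw .
  then have Y1: "(\<lambda>n. t n * ?Y n - a') \<in> O(\<lambda>n. t n ^ 12)"
    by (rule landau_o.big.mult_cancel_right[THEN iffD1, rotated 2]) (use t0 in auto)
  have "(\<lambda>n. \<rho> n ^ 6) \<longlonglongrightarrow> 0 + (a + b * (0 + 0 ^ 4 + 0 ^ 5) + c * 0 ^ 6 + d * (0 ^ 7 + 0 ^ 10) + e * 0 ^ 8)"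
  proof (rule Lim_transform_eventually)
    show "(\<lambda>n. ?X n + (a + b * (t n + t n ^ 4 + t n ^ 5) + c * t n ^ 6 + d * (t n ^ 7 + t n ^ 10)
        + e * t n ^ 8)) \<longlonglongrightarrow> 0 + (a + b * (0 + 0 ^ 4 + 0 ^ 5) + c * 0 ^ 6 + d * (0 ^ 7 + 0 ^ 10) + e * 0 ^ 8)"
      by (intro tendsto_add bigo_tendsto_0[OF X' tr] tendsto_intros t) simp
  qed simp
  then have a: "(\<lambda>n. \<rho> n ^ 6) \<longlonglongrightarrow> a" by simp
  then obtain K where K: "\<And>n. norm (\<rho> n ^ 6) \<le> K"
    using convergent_imp_bounded[OF a] unfolding bounded_iff by auto
  \<comment> \<open>The summand 1 makes any violating value exceed 1, so that it is at most its own
    sixth power.\<close>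
  have "norm (\<rho> n) \<le> K + 1" for n
  proof (rule ccontr)
    assume "\<not> norm (\<rho> n) \<le> K + 1"
    then have n: "norm (\<rho> n) > K + 1" by simp
    moreover have "K \<ge> 0" using K[of n] norm_ge_zero order_trans by blast
    ultimately have "norm (\<rho> n) ^ 1 \<le> norm (\<rho> n) ^ 6" by (intro power_increasing) auto
    then show False using K[of n] n by (simp add: norm_power)
  qed
  then have "bounded (range \<rho>)" by (auto simp: bounded_iff)
  then obtain l r where r: "strict_mono r" and rl: "(\<rho> \<circ> r) \<longlonglongrightarrow> l"
    using bounded_imp_convergent_subsequence by blast
  have sub: "(\<lambda>n. f (r n)) \<in> O(\<lambda>n. g (r n))" if "f \<in> O(g)" for f g :: "nat \<Rightarrow> complex"
    using landau_o.big.compose[OF that filterlim_subseq[OF r]] .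
  define s where "s n = t (r n)" for n
  define \<sigma> where "\<sigma> n = \<rho> (r n)" for n
  have s: "s \<longlonglongrightarrow> 0" unfolding s_def using LIMSEQ_subseq_LIMSEQ[OF t r] by (simp add: o_def)
  have \<sigma>: "\<sigma> \<longlonglongrightarrow> l" using rl by (simp add: \<sigma>_def[abs_def] o_def)
  note X2 = sub[OF X', folded s_def \<sigma>_def]
  note Y2 = sub[OF Y1, folded s_def \<sigma>_def]
  have s0: "s n \<noteq> 0" for n using t0 by (simp add: s_def)
  have sr: "(\<lambda>n. s n ^ k) \<longlonglongrightarrow> 0" if "k > 0" for k
    using tendsto_power[OF s, of k] that by (simp add: power_0_left)
  let ?Z = "\<lambda>s l. l ^ 7 + s ^ 3 * l ^ 10 + s ^ 4 * l ^ 11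
        - (b' * (1 + s ^ 3 + s ^ 4) + c' * s ^ 5 + d' * (s ^ 6 + s ^ 9 + s ^ 10)
          + e' * (s ^ 7 + 2 * s ^ 10))"
  have "(\<lambda>n. s n * ?Z (s n) (\<sigma> n) - a') \<longlonglongrightarrow> 0 * ?Z 0 l - a'"
    by (intro tendsto_intros s \<sigma>)
  moreover have "(\<lambda>n. s n * ?Z (s n) (\<sigma> n) - a') \<longlonglongrightarrow> 0"
    using Y2 sr by (rule bigo_tendsto_0) simp
  ultimately have a': "a' = 0"
    using LIMSEQ_unique by fastforce
  have "(\<lambda>n. \<sigma> n ^ 6) \<longlonglongrightarrow> a"
    unfolding \<sigma>_def using LIMSEQ_subseq_LIMSEQ[OF a r] by (simp add: o_def)
  then have "l ^ 6 = a"
    using LIMSEQ_unique tendsto_power[OF \<sigma>] by blast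
  \<comment> \<open>With a' = 0 the determinant condition becomes a b' \<noteq> 0, and a =
    l^6.\<close>
  then have l0: "l \<noteq> 0" using det a' by auto
  have "(\<lambda>n. s n * ?Z (s n) (\<sigma> n)) \<in> O(\<lambda>n. s n * s n ^ 11)"
    using Y2 a' by (simp flip: power_Suc)
  then have Y3: "(\<lambda>n. ?Z (s n) (\<sigma> n)) \<in> O(\<lambda>n. s n ^ 11)"
    by (rule landau_o.big.mult_cancel_left[THEN iffD1, rotated 2]) (use s0 in auto)
  show ?thesis
    using branch_rigid_tendsto[OF s s0 \<sigma> l0 X2 Y3] a' by simp
qed

section \<open>Quadratic Taylor polynomials of holomorphic germs\<close>

definition cdiff2 :: "(c2 \<Rightarrow> complex) \<Rightarrow> c2 \<Rightarrow> bool" where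
  "cdiff2 f p \<longleftrightarrow> (\<exists>a b. (f has_derivative (\<lambda>(h, k). a * h + b * k)) (at p))"

lemma holomorphic2_on_iff: "holomorphic2_on f U \<longleftrightarrow> open U \<and> (\<forall>p\<in>U. cdiff2 f p)"
  by (simp add: holomorphic2_on_def cdiff2_def)

lemma cdiff2_const: "cdiff2 (\<lambda>p. c) p"
  unfolding cdiff2_def by (rule exI[of _ 0], rule exI[of _ 0]) (simp add: case_prod_unfold)

lemma cdiff2_fst: "cdiff2 (\<lambda>p. fst p) p"
  unfolding cdiff2_def
  by (rule exI[of _ 1], rule exI[of _ 0])
    (auto simp: case_prod_unfold intro!: derivative_eq_intros)

lemma cdiff2_snd: "cdiff2 (\<lambda>p. snd p) p"
  unfolding cdiff2_def
  by (rule exI[of _ 0], rule exI[of _ 1])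
    (auto simp: case_prod_unfold intro!: derivative_eq_intros)

lemma cdiff2_add: "cdiff2 f p \<Longrightarrow> cdiff2 g p \<Longrightarrow> cdiff2 (\<lambda>p. f p + g p) p"
  unfolding cdiff2_def
proof (elim exE)
  fix a b c d
  assume "(f has_derivative (\<lambda>(h, k). a * h + b * k)) (at p)"
    "(g has_derivative (\<lambda>(h, k). c * h + d * k)) (at p)"
  then show "\<exists>a b. ((\<lambda>p. f p + g p) has_derivative (\<lambda>(h, k). a * h + b * k)) (at p)"
    by (intro exI[of _ "a + c"] exI[of _ "b + d"])
      (auto simp: case_prod_unfold algebra_simps intro!: derivative_eq_intros)
qed

lemma cdiff2_mult: "cdiff2 f p \<Longrightarrow> cdiff2 g p \<Longrightarrow> cdiff2 (\<lambda>p. f p * g p) p"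
  unfolding cdiff2_def
proof (elim exE)
  fix a b c d
  assume "(f has_derivative (\<lambda>(h, k). a * h + b * k)) (at p)"
    "(g has_derivative (\<lambda>(h, k). c * h + d * k)) (at p)"
  then show "\<exists>a b. ((\<lambda>p. f p * g p) has_derivative (\<lambda>(h, k). a * h + b * k)) (at p)"
    by (intro exI[of _ "a * g p + f p * c"] exI[of _ "b * g p + f p * d"])
      (auto simp: case_prod_unfold algebra_simps intro!: derivative_eq_intros)
qed

lemma cdiff2_diff: "cdiff2 f p \<Longrightarrow> cdiff2 g p \<Longrightarrow> cdiff2 (\<lambda>p. f p - g p) p"
  using cdiff2_add[of f p "\<lambda>p. (-1) * g p"] cdiff2_mult[OF cdiff2_const, of g p "-1"] by simp

lemma cdiff2_power: "cdiff2 f p \<Longrightarrow> cdiff2 (\<lambda>p. f p ^ n) p"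
  by (induction n) (auto intro: cdiff2_const cdiff2_mult)

lemmas cdiff2_intros = cdiff2_const cdiff2_fst cdiff2_snd cdiff2_add cdiff2_mult cdiff2_diff
  cdiff2_power

lemma cdiff2_compose:
  assumes "cdiff2 f (F p)" "cdiff2 (\<lambda>p. fst (F p)) p" "cdiff2 (\<lambda>p. snd (F p)) p"
  shows "cdiff2 (\<lambda>p. f (F p)) p"
proof -
  obtain a b where f: "(f has_derivative (\<lambda>(h, k). a * h + b * k)) (at (F p))"
    using assms(1) unfolding cdiff2_def by blast
  obtain c d where 1: "((\<lambda>p. fst (F p)) has_derivative (\<lambda>(h, k). c * h + d * k)) (at p)"
    using assms(2) unfolding cdiff2_def by blast
  obtain c' d' where 2: "((\<lambda>p. snd (F p)) has_derivative (\<lambda>(h, k). c' * h + d' * k)) (at p)"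
    using assms(3) unfolding cdiff2_def by blast
  have "(F has_derivative (\<lambda>q. (c * fst q + d * snd q, c' * fst q + d' * snd q))) (at p)"
    using has_derivative_Pair[OF 1 2] by (simp add: case_prod_unfold)
  from has_derivative_compose[OF this f] show ?thesis
    unfolding cdiff2_def
    by (intro exI[of _ "a * c + b * c'"] exI[of _ "a * d + b * d'"])
      (simp add: case_prod_unfold algebra_simps)
qed

text \<open>The bridge to one-variable complex analysis: it is applied to slices parallel to the
  axes and to the parametrization of the branch.\<close>

lemma cdiff2_curve:
  assumes "cdiff2 f (u z, v z)" "(u has_field_derivative u') (at z)"
    "(v has_field_derivative v') (at z)"
  shows "(\<lambda>z. f (u z, v z)) field_differentiable (at z)"
proof -
  obtain a b where f: "(f has_derivative (\<lambda>(h, k). a * h + b * k)) (at (u z, v z))"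
    using assms(1) unfolding cdiff2_def by blast
  have "((\<lambda>z. (u z, v z)) has_derivative (\<lambda>h. (u' * h, v' * h))) (at z)"
    using has_derivative_Pair[OF assms(2,3)[unfolded has_field_derivative_def]] .
  from has_derivative_compose[OF this f] have
    "((\<lambda>z. f (u z, v z)) has_derivative (\<lambda>h. (a * u' + b * v') * h)) (at z)"
    by (simp add: case_prod_unfold algebra_simps)
  then show ?thesis
    unfolding field_differentiable_def has_field_derivative_def by blast
qed

lemma cdiff2_continuous: "cdiff2 f p \<Longrightarrow> isCont f p"
  unfolding cdiff2_def using has_derivative_continuous by blast

lemma holomorphic2_on_continuous: "holomorphic2_on f U \<Longrightarrow> continuous_on U f"
  unfolding holomorphic2_on_iff
  by (auto intro!: continuous_at_imp_continuous_on cdiff2_continuous)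

text \<open>Cauchy's inequality on circles of radius r/2 bounds the derivative of order n + 1 on the
  disc of radius r by (n+1)! B / (r/2)^(n+1). The Taylor remainder divides this by n!, which leaves
  the factor (n+1) 2^(n+1).\<close>

lemma cauchy_taylor_bound:
  fixes f :: "complex \<Rightarrow> complex" and r B :: real
  assumes "f holomorphic_on ball 0 (2*r)" "r > 0"
    and B: "\<And>z. norm z < 2*r \<Longrightarrow> norm (f z) \<le> B"
    and z: "norm z < r"
  shows "norm (f z - (\<Sum>i\<le>n. (deriv ^^ i) f 0 * z ^ i / fact i))
    \<le> (real (Suc n) * 2 ^ Suc n * B / r ^ Suc n) * norm z ^ Suc n"
proof -
  have S: "open (ball (0::complex) (2*r))" by simp
  have "norm (f z - (\<Sum>i\<le>n. (deriv ^^ i) f 0 * (z - 0) ^ i / fact i))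
      \<le> (fact (Suc n) * B / (r/2) ^ Suc n) * norm (z - 0) ^ Suc n / fact n"
  proof (rule field_Taylor[where S = "ball 0 r" and f = "\<lambda>i. (deriv ^^ i) f", simplified funpow_0])
    fix i x assume x: "x \<in> ball (0::complex) r"
    show "((deriv ^^ i) f has_field_derivative (deriv ^^ Suc i) f x) (at x within ball 0 r)"
    proof -
      have "(deriv ^^ i) f holomorphic_on ball 0 (2*r)"
        by (intro holomorphic_higher_deriv assms S)
      then show ?thesis
        using holomorphic_derivI[OF _ S, of "(deriv ^^ i) f" x] x \<open>r > 0\<close> by simp
    qed
    have sub: "cball x (r/2) \<subseteq> ball 0 (2*r)"
    proof
      fix y assume "y \<in> cball x (r/2)"
      then show "y \<in> ball 0 (2*r)"
        using x \<open>r > 0\<close> norm_triangle_ineq[of x "y - x"] by (auto simp: dist_norm norm_minus_commute)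
    qed
    show "norm ((deriv ^^ Suc n) f x) \<le> fact (Suc n) * B / (r/2) ^ Suc n"
    proof (rule Cauchy_inequality)
      show "f holomorphic_on ball x (r/2)"
        by (rule holomorphic_on_subset[OF assms(1)]) (use sub ball_subset_cball in blast)
      show "continuous_on (cball x (r/2)) f"
        by (rule holomorphic_on_imp_continuous_on, rule holomorphic_on_subset[OF assms(1) sub])
      fix y assume "norm (x - y) = r / 2"
      then have "y \<in> ball 0 (2*r)" using sub by (auto simp: dist_norm)
      then show "norm (f y) \<le> B" using B by simp
    qed (use \<open>r > 0\<close> in simp)
  qed (use z \<open>r > 0\<close> in auto)
  also have "\<dots> = (real (Suc n) * 2 ^ Suc n * B / r ^ Suc n) * norm z ^ Suc n"
    by (simp add: power_divide)
  finally show ?thesis by simp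
qed

text \<open>The quadratic Taylor polynomial as an error bound, so that it also makes sense for a
  time one map whose differentiability is not known. Since \<open>nhds\<close> includes the point 0,
  the bound forces f 0 = 0.\<close>

definition jet2 :: "(c2 \<Rightarrow> complex) \<Rightarrow> complex \<Rightarrow> complex \<Rightarrow> complex \<Rightarrow> complex \<Rightarrow> complex \<Rightarrow> bool" where
  "jet2 f a b c d e \<longleftrightarrow> (\<exists>C. \<forall>\<^sub>F p in nhds 0.
     norm (f p - (a * fst p + b * snd p + c * fst p ^ 2 + d * (fst p * snd p) + e * snd p ^ 2))
       \<le> C * norm p ^ 3)"

text \<open>Used with g x a divided difference in the first variable and h the next Taylor
  coefficient as a function of the second. The linear rate in x makes the convergence uniform in y,
  and uniform limits of holomorphic functions are holomorphic.\<close>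

lemma cauchy_coeff_uniform_limit:
  fixes g :: "complex \<Rightarrow> complex \<Rightarrow> complex" and h :: "complex \<Rightarrow> complex"
  assumes "r > 0" and g: "\<And>x. x \<noteq> 0 \<Longrightarrow> norm x < r \<Longrightarrow> g x holomorphic_on ball 0 r"
    and C: "\<And>x y. x \<noteq> 0 \<Longrightarrow> norm x < r \<Longrightarrow> norm y < r \<Longrightarrow> norm (g x y - h y) \<le> C * norm x"
  shows "h holomorphic_on ball 0 r"
proof (rule holomorphic_uniform_sequence)
  \<comment> \<open>The shift by 2 keeps every point strictly inside the disc, including the one for
    n = 0.\<close>
  define x where "x n = complex_of_real (r / real (n + 2))" for n
  have x: "x n \<noteq> 0" "norm (x n) < r" "norm (x n) = r / real (n + 2)" for n
    using \<open>r > 0\<close> by (auto simp: x_def norm_divide divide_simps simp del: of_real_divide)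
  show "\<And>n. g (x n) holomorphic_on ball 0 r" using g x by blast
  fix y :: complex assume "y \<in> ball 0 r"
  then obtain d where d: "d > 0" "cball y d \<subseteq> ball 0 r"
    using open_contains_cball[of "ball 0 r"] open_ball by blast
  have "uniform_limit (cball y d) (\<lambda>n. g (x n)) h sequentially"
  proof (rule uniform_limitI)
    fix e :: real assume "e > 0"
    have "(\<lambda>n. C * (r / real (n + 2))) \<longlonglongrightarrow> 0" by real_asymp
    then have "\<forall>\<^sub>F n in sequentially. C * (r / real (n + 2)) < e"
      using \<open>e > 0\<close> by (rule order_tendstoD)
    then show "\<forall>\<^sub>F n in sequentially. \<forall>z\<in>cball y d. dist (g (x n) z) (h z) < e"
    proof eventually_elim
      case (elim n)
      show ?case
      proof
        fix z assume "z \<in> cball y d"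
        then have "norm z < r" using d by auto
        then show "dist (g (x n) z) (h z) < e"
          using C[OF x(1,2), of z n] elim x(3)[of n] by (simp add: dist_norm)
      qed
    qed
  qed
  then show "\<exists>d>0. cball y d \<subseteq> ball 0 r \<and> uniform_limit (cball y d) (\<lambda>n. g (x n)) h sequentially"
    using d by blast
qed simp

lemma polydisc_holomorphic2:
  assumes "holomorphic2_on f U" "0 \<in> U"
  obtains r B where "r > 0" "\<And>x y. norm x < r \<Longrightarrow> norm y < r \<Longrightarrow> cdiff2 f (x, y)"
    "\<And>x y. norm x < r \<Longrightarrow> norm y < r \<Longrightarrow> norm (f (x, y)) \<le> B"
proof -
  have "open U" using assms by (simp add: holomorphic2_on_iff)
  then obtain R where R: "R > 0" "cball 0 R \<subseteq> U"
    using open_contains_cball assms(2) by blast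
  have "compact (f ` cball 0 R)"
    by (intro compact_continuous_image continuous_on_subset[OF holomorphic2_on_continuous[OF assms(1)]]
        R compact_cball)
  then obtain B where B: "\<forall>p\<in>cball 0 R. norm (f p) \<le> B"
    using compact_imp_bounded[of "f ` cball 0 R"] unfolding bounded_iff by blast
  have sub: "(x, y) \<in> cball 0 R" if "norm x < R / 2" "norm y < R / 2" for x y :: complex
  proof -
    have "norm (x, y) \<le> R" using norm_Pair_le[of x y] that by linarith
    then show ?thesis by (simp only: mem_cball dist_0_norm)
  qed
  show ?thesis
    using that[of "R/2" B] R sub B assms(1) unfolding holomorphic2_on_iff by (meson half_gt_zero subsetD)
qed

text \<open>Taylor expansion in x up to degree 2, uniformly in y, followed by expansion of the
  coefficient of x^i in y up to degree 2 - i. Each of the four remainders is cubic in the norm of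
  the point.\<close>

lemma holomorphic2_on_imp_jet2:
  assumes "holomorphic2_on f U" "0 \<in> U"
  shows "\<exists>a b c d e. jet2 (\<lambda>p. f p - f 0) a b c d e"
proof -
  obtain R B where R: "R > 0" "\<And>x y. norm x < R \<Longrightarrow> norm y < R \<Longrightarrow> cdiff2 f (x, y)"
    and B: "\<And>x y. norm x < R \<Longrightarrow> norm y < R \<Longrightarrow> norm (f (x, y)) \<le> B"
    using polydisc_holomorphic2[OF assms] by blast
  define r where "r = R / 2"
  have r: "r > 0" "R = 2 * r" using R by (simp_all add: r_def)
  have hx: "(\<lambda>x. f (x, y)) holomorphic_on ball 0 R" if "norm y < R" for y
    unfolding holomorphic_on_def
  proof
    fix x :: complex assume "x \<in> ball 0 R"
    then have "cdiff2 f (x, y)" using that R by simp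
    from cdiff2_curve[of f "\<lambda>x. x" x "\<lambda>_. y", OF this DERIV_ident DERIV_const]
    show "(\<lambda>x. f (x, y)) field_differentiable at x within ball 0 R"
      by (rule field_differentiable_at_within)
  qed
  have hy: "(\<lambda>y. f (x, y)) holomorphic_on ball 0 R" if "norm x < R" for x
    unfolding holomorphic_on_def
  proof
    fix y :: complex assume "y \<in> ball 0 R"
    then have "cdiff2 f (x, y)" using that R by simp
    from cdiff2_curve[of f "\<lambda>_. x" y "\<lambda>y. y", OF this DERIV_const DERIV_ident]
    show "(\<lambda>y. f (x, y)) field_differentiable at y within ball 0 R"
      by (rule field_differentiable_at_within)
  qed
  define F where "F i y = (deriv ^^ i) (\<lambda>x. f (x, y)) 0 / fact i" for i y
  have T: "norm (f (x, y) - (\<Sum>i\<le>n. F i y * x ^ i))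
      \<le> (real (Suc n) * 2 ^ Suc n * B / r ^ Suc n) * norm x ^ Suc n" if "norm y < r" "norm x < r" for x y n
    using cauchy_taylor_bound[of "\<lambda>x. f (x, y)" r B x n] that hx[of y] r B by (auto simp: F_def)
  have F0: "F 0 y = f (0, y)" for y by (simp add: F_def)
  have h0: "F 0 holomorphic_on ball 0 r"
    using hy[of 0] r unfolding F0[abs_def] by (auto intro: holomorphic_on_subset)
  have h1: "F 1 holomorphic_on ball 0 r"
  proof (rule cauchy_coeff_uniform_limit)
    fix x :: complex assume x: "x \<noteq> 0" "norm x < r"
    show "(\<lambda>y. (f (x, y) - F 0 y) / x) holomorphic_on ball 0 r"
      using x r by (auto intro!: holomorphic_intros h0 holomorphic_on_subset[OF hy])
    fix y :: complex assume y: "norm y < r"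
    have "norm ((f (x, y) - F 0 y) / x - F 1 y) = norm (f (x, y) - (\<Sum>i\<le>1. F i y * x ^ i)) / norm x"
      using x by (simp add: field_simps flip: norm_divide)
    also have "\<dots> \<le> ((2 * 2 ^ 2 * B / r ^ 2) * norm x ^ 2) / norm x"
      using T[OF y x(2), of 1] by (intro divide_right_mono) (simp_all add: numeral_2_eq_2)
    also have "\<dots> = (2 * 2 ^ 2 * B / r ^ 2) * norm x"
      using x by (simp add: power2_eq_square)
    finally show "norm ((f (x, y) - F 0 y) / x - F 1 y) \<le> (2 * 2 ^ 2 * B / r ^ 2) * norm x" .
  qed (rule r)
  have h2: "F 2 holomorphic_on ball 0 r"
  proof (rule cauchy_coeff_uniform_limit)
    fix x :: complex assume x: "x \<noteq> 0" "norm x < r"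
    show "(\<lambda>y. (f (x, y) - F 0 y - F 1 y * x) / x ^ 2) holomorphic_on ball 0 r"
      using x r by (auto intro!: holomorphic_intros h0 h1[simplified] holomorphic_on_subset[OF hy])
    fix y :: complex assume y: "norm y < r"
    have "(f (x, y) - F 0 y - F 1 y * x) / x ^ 2 - F 2 y
        = (f (x, y) - (\<Sum>i\<le>2. F i y * x ^ i)) / x ^ 2"
      using x by (simp add: field_simps numeral_2_eq_2)
    then have "norm ((f (x, y) - F 0 y - F 1 y * x) / x ^ 2 - F 2 y)
        = norm (f (x, y) - (\<Sum>i\<le>2. F i y * x ^ i)) / norm x ^ 2"
      by (simp only: norm_divide norm_power)
    also have "\<dots> \<le> ((3 * 2 ^ 3 * B / r ^ 3) * norm x ^ 3) / norm x ^ 2"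
      using T[OF y x(2), of 2] by (intro divide_right_mono) (simp_all add: numeral_3_eq_3)
    also have "\<dots> = (3 * 2 ^ 3 * B / r ^ 3) * norm x"
      using x by (simp add: power2_eq_square power3_eq_cube)
    finally show "norm ((f (x, y) - F 0 y - F 1 y * x) / x ^ 2 - F 2 y) \<le> (3 * 2 ^ 3 * B / r ^ 3) * norm x" .
  qed (rule r)
  \<comment> \<open>The closed disc of radius 2 s lies in the domain of the coefficients
    \<open>F i\<close>, so compactness bounds them there, as \<open>cauchy_taylor_bound\<close>
    requires.\<close>
  define s where "s = r / 4"
  have s: "s > 0" "ball 0 (2 * s) \<subseteq> ball (0::complex) r" "cball (0::complex) (2 * s) \<subseteq> ball 0 r" using r by (auto simp: s_def)
  have "\<exists>A. \<forall>z. norm z < 2 * s \<longrightarrow> norm (h z) \<le> A" if "h holomorphic_on ball 0 r" for h :: "complex \<Rightarrow> complex"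
  proof -
    have "compact (h ` cball 0 (2 * s))"
      by (intro compact_continuous_image compact_cball continuous_on_subset[OF holomorphic_on_imp_continuous_on[OF that] s(3)])
    then show ?thesis
      using compact_imp_bounded[of "h ` cball 0 (2 * s)"] unfolding bounded_iff
      by (metis imageI less_imp_le mem_cball_0)
  qed
  note bd = this
  have tay: "\<exists>A. \<forall>z. norm z < s \<longrightarrow> norm (h z - (\<Sum>i\<le>n. (deriv ^^ i) h 0 / fact i * z ^ i)) \<le> A * norm z ^ Suc n"
    if hol: "h holomorphic_on ball 0 r" for h n
  proof -
    obtain A where "\<forall>z. norm z < 2 * s \<longrightarrow> norm (h z) \<le> A" using bd[OF hol] by blast
    then have "norm (h z - (\<Sum>i\<le>n. (deriv ^^ i) h 0 * z ^ i / fact i))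
        \<le> (real (Suc n) * 2 ^ Suc n * A / s ^ Suc n) * norm z ^ Suc n" if "norm z < s" for z
      by (intro cauchy_taylor_bound holomorphic_on_subset[OF hol s(2)] s(1) that) auto
    then show ?thesis
      by (intro exI[of _ "real (Suc n) * 2 ^ Suc n * A / s ^ Suc n"] allI impI)
        (simp del: power_Suc of_nat_Suc)
  qed
  \<comment> \<open>\<open>G i n\<close> belongs to the monomial x^n y^i: the first index counts
    y.\<close>
  define G where "G i n = (deriv ^^ i) (F n) 0 / fact i" for i n
  obtain A0 where A0: "\<And>y. norm y < s \<Longrightarrow> norm (F 0 y - (\<Sum>i\<le>2. G i 0 * y ^ i)) \<le> A0 * norm y ^ 3"
    using tay[OF h0, of 2] unfolding G_def by (auto simp: numeral_3_eq_3)
  obtain A1 where A1: "\<And>y. norm y < s \<Longrightarrow> norm (F 1 y - (\<Sum>i\<le>1. G i 1 * y ^ i)) \<le> A1 * norm y ^ 2"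
    using tay[OF h1, of 1] unfolding G_def by (auto simp: numeral_2_eq_2)
  obtain A2 where A2: "\<And>y. norm y < s \<Longrightarrow> norm (F 2 y - (\<Sum>i\<le>0. G i 2 * y ^ i)) \<le> A2 * norm y ^ 1"
    using tay[OF h2, of 0] unfolding G_def by auto
  define K where "K = 3 * 2 ^ 3 * B / r ^ 3"
  have G00: "G 0 0 = f 0" by (simp add: G_def F0 zero_prod_def)
  have main: "norm (f p - f 0 - (G 0 1 * fst p + G 1 0 * snd p + G 0 2 * fst p ^ 2
      + G 1 1 * (fst p * snd p) + G 2 0 * snd p ^ 2)) \<le> (\<bar>K\<bar> + \<bar>A0\<bar> + \<bar>A1\<bar> + \<bar>A2\<bar>) * norm p ^ 3"
    if p: "norm p < s" for p
  proof -
    obtain x y where xy: "p = (x, y)" by (cases p)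
    have nx: "norm x \<le> norm p" and ny: "norm y \<le> norm p"
      using norm_fst_le[of x y] norm_snd_le[of y x] by (simp_all add: xy)
    have "s \<le> r" using r by (simp add: s_def)
    have eq: "f p - f 0 - (G 0 1 * fst p + G 1 0 * snd p + G 0 2 * fst p ^ 2
      + G 1 1 * (fst p * snd p) + G 2 0 * snd p ^ 2)
      = (f (x, y) - (\<Sum>i\<le>2. F i y * x ^ i)) + (F 0 y - (\<Sum>i\<le>2. G i 0 * y ^ i))
       + (F 1 y - (\<Sum>i\<le>1. G i 1 * y ^ i)) * x + (F 2 y - (\<Sum>i\<le>0. G i 2 * y ^ i)) * x ^ 2"
      by (simp add: xy numeral_2_eq_2 G00 algebra_simps)
    have "norm (f (x, y) - (\<Sum>i\<le>2. F i y * x ^ i)) \<le> \<bar>K\<bar> * norm p ^ 3"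
    proof -
      have "norm (f (x, y) - (\<Sum>i\<le>2. F i y * x ^ i)) \<le> K * norm x ^ 3"
        using T[of y x 2] nx ny p \<open>s \<le> r\<close> by (simp add: K_def numeral_3_eq_3)
      also have "\<dots> \<le> \<bar>K\<bar> * norm p ^ 3"
        by (intro mult_mono power_mono nx) auto
      finally show ?thesis .
    qed
    moreover have "norm (F 0 y - (\<Sum>i\<le>2. G i 0 * y ^ i)) \<le> \<bar>A0\<bar> * norm p ^ 3"
    proof -
      have "norm (F 0 y - (\<Sum>i\<le>2. G i 0 * y ^ i)) \<le> A0 * norm y ^ 3" using A0 ny p by simp
      also have "\<dots> \<le> \<bar>A0\<bar> * norm p ^ 3"
        by (intro mult_mono power_mono ny) auto
      finally show ?thesis .
    qed
    moreover have "norm ((F 1 y - (\<Sum>i\<le>1. G i 1 * y ^ i)) * x) \<le> \<bar>A1\<bar> * norm p ^ 3"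
    proof -
      have "norm ((F 1 y - (\<Sum>i\<le>1. G i 1 * y ^ i)) * x) \<le> (A1 * norm y ^ 2) * norm x"
        unfolding norm_mult using A1 ny p by (intro mult_right_mono) auto
      also have "\<dots> \<le> (\<bar>A1\<bar> * norm p ^ 2) * norm p"
        by (intro mult_mono power_mono ny nx) auto
      finally show ?thesis by (simp add: power3_eq_cube power2_eq_square mult.assoc)
    qed
    moreover have "norm ((F 2 y - (\<Sum>i\<le>0. G i 2 * y ^ i)) * x ^ 2) \<le> \<bar>A2\<bar> * norm p ^ 3"
    proof -
      have "norm ((F 2 y - (\<Sum>i\<le>0. G i 2 * y ^ i)) * x ^ 2) \<le> (A2 * norm y ^ 1) * norm x ^ 2"
        unfolding norm_mult norm_power using A2 ny p by (intro mult_right_mono) auto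
      also have "\<dots> \<le> (\<bar>A2\<bar> * norm p ^ 1) * norm p ^ 2"
        by (intro mult_mono power_mono ny nx) auto
      finally show ?thesis by (simp add: power3_eq_cube power2_eq_square mult.assoc)
    qed
    ultimately show ?thesis
      unfolding eq by (intro order_trans[OF norm_triangle_le[OF add_mono[OF norm_triangle_le[OF add_mono[OF
        norm_triangle_ineq]]]]]) (auto simp: algebra_simps)
  qed
  have "\<forall>\<^sub>F p in nhds (0::c2). norm p < s"
    using eventually_nhds_metric[of "\<lambda>p::c2. norm p < s" 0] s by (auto simp: dist_norm)
  then have "\<forall>\<^sub>F p in nhds 0. norm (f p - f 0 - (G 0 1 * fst p + G 1 0 * snd p + G 0 2 * fst p ^ 2
      + G 1 1 * (fst p * snd p) + G 2 0 * snd p ^ 2)) \<le> (\<bar>K\<bar> + \<bar>A0\<bar> + \<bar>A1\<bar> + \<bar>A2\<bar>) * norm p ^ 3"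
    by eventually_elim (rule main)
  then show ?thesis unfolding jet2_def by blast
qed

section \<open>Quadratic Taylor polynomials of time one maps\<close>

lemma vector_derivative_bound_01:
  fixes z :: "real \<Rightarrow> complex"
  assumes "\<And>s. s \<in> {0..1} \<Longrightarrow> (z has_vector_derivative z' s) (at s within {0..1})"
    and "\<And>s. s \<in> {0..1} \<Longrightarrow> norm (z' s) \<le> B" and t: "t \<in> {0..1}"
  shows "norm (z t - z 0) \<le> B"
proof -
  have B: "B \<ge> 0" using assms(2)[OF t] norm_ge_zero order_trans by blast
  have "norm (z t - z 0) \<le> B * norm (t - 0)"
  proof (rule differentiable_bound[where S = "{0..1}" and f' = "\<lambda>s h. h *\<^sub>R z' s"])
    show "(z has_derivative (\<lambda>h. h *\<^sub>R z' s)) (at s within {0..1})" if "s \<in> {0..1}" for s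
      using assms(1)[OF that] unfolding has_vector_derivative_def .
    show "onorm (\<lambda>h. h *\<^sub>R z' s) \<le> B" if "s \<in> {0..1}" for s
      using assms(2)[OF that] by (intro onorm_le) (simp add: mult.commute[of B] mult_left_mono)
  qed (use t in auto)
  also have "\<dots> \<le> B" using t B by (simp add: mult_left_le)
  finally show ?thesis .
qed

definition flow_line :: "(c2 \<Rightarrow> c2) \<Rightarrow> (real \<Rightarrow> c2) \<Rightarrow> bool" where
  "flow_line X c \<longleftrightarrow> (\<forall>t\<in>{0..1}. (c has_vector_derivative X (c t)) (at t within {0..1}))"

lemma flow_line_continuous: "flow_line X c \<Longrightarrow> continuous_on {0..1} c"
  unfolding flow_line_def continuous_on_eq_continuous_within
  using has_vector_derivative_continuous by blast

text \<open>The squared norm times exp (-2 K s) is nonincreasing; unlike the norm, it is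
  differentiable where the curve meets 0. Smallness is assumed on the open interval only, so the
  estimate can be used at a first exit time T.\<close>

lemma flow_line_gronwall:
  assumes c: "flow_line X c" and X: "\<And>q. norm q \<le> r \<Longrightarrow> norm (X q) \<le> K * norm q"
    and T: "T \<in> {0..1}" and small: "\<And>s. 0 < s \<Longrightarrow> s < T \<Longrightarrow> norm (c s) \<le> r"
  shows "norm (c T) \<le> exp (K * T) * norm (c 0)"
proof -
  define h where "h s = (c s \<bullet> c s) * exp (- 2 * K * s)" for s
  have "h T \<le> h 0"
  proof (rule DERIV_nonpos_imp_decreasing_open[where f = h and a = 0 and b = T])
    show "0 \<le> T" using T by simp
    fix s assume s: "0 < s" "s < T"
    then have "(c has_vector_derivative X (c s)) (at s within {0..1})"
      using c T unfolding flow_line_def by auto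
    moreover have "at s within {0..1} = at s"
      using s T by (intro at_within_interior) (simp add: interior_atLeastAtMost_real)
    ultimately have "(c has_derivative (\<lambda>h. h *\<^sub>R X (c s))) (at s)"
      by (simp add: has_vector_derivative_def)
    from has_derivative_inner[OF this this]
    have "((\<lambda>s. c s \<bullet> c s) has_real_derivative 2 * (c s \<bullet> X (c s))) (at s)"
      unfolding has_field_derivative_def
      by (rule has_derivative_eq_rhs) (auto simp: inner_commute algebra_simps)
    then have "(h has_real_derivative (2 * (c s \<bullet> X (c s)) - 2 * K * (c s \<bullet> c s)) * exp (- 2 * K * s)) (at s)"
      unfolding h_def by (auto intro!: derivative_eq_intros simp: algebra_simps)
    moreover have "c s \<bullet> X (c s) \<le> K * (c s \<bullet> c s)"
    proof -
      have "c s \<bullet> X (c s) \<le> norm (c s) * norm (X (c s))" by (rule norm_cauchy_schwarz)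
      also have "\<dots> \<le> norm (c s) * (K * norm (c s))"
        by (intro mult_left_mono X small s) simp
      finally show ?thesis by (simp add: power2_norm_eq_inner[symmetric] power2_eq_square algebra_simps)
    qed
    ultimately show "\<exists>y. (h has_real_derivative y) (at s) \<and> y \<le> 0"
      by (auto intro!: exI mult_nonpos_nonneg)
  next
    have "continuous_on {0..T} c"
      using continuous_on_subset[OF flow_line_continuous[OF c]] T by simp
    then show "continuous_on {0..T} h"
      unfolding h_def by (intro continuous_intros)
  qed
  then have "(c T \<bullet> c T) * exp (- 2 * K * T) \<le> c 0 \<bullet> c 0" by (simp add: h_def)
  then have "c T \<bullet> c T \<le> (c 0 \<bullet> c 0) * exp (2 * K * T)"
    by (simp add: exp_minus field_simps)
  also have "exp (2 * K * T) = exp (K * T) ^ 2" by (simp add: exp_double[symmetric] mult.assoc)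
  finally have "norm (c T) ^ 2 \<le> (exp (K * T) * norm (c 0)) ^ 2"
    by (simp add: power2_norm_eq_inner power_mult_distrib mult.commute)
  then show ?thesis by (rule power2_le_imp_le) simp
qed

lemma flow_line_bound:
  assumes c: "flow_line X c" and X: "\<And>q. norm q \<le> r \<Longrightarrow> norm (X q) \<le> K * norm q"
    and K: "K \<ge> 0" and small: "exp K * norm (c 0) < r" and t: "t \<in> {0..1}"
  shows "norm (c t) \<le> exp K * norm (c 0)"
proof -
  have le: "exp (K * s) * norm (c 0) \<le> exp K * norm (c 0)" if "s \<in> {0..1}" for s
    using that K by (intro mult_right_mono) (simp_all add: mult_left_le)
  have lt: "norm (c s) < r" if "s \<in> {0..1}" for s
  proof (rule ccontr)
    assume "\<not> norm (c s) < r"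
    \<comment> \<open>The times at which the curve is outside the open ball. This set is compact, so
      a first exit time T exists; the Gronwall estimate up to T puts the curve back inside at
      T.\<close>
    define S where "S = {0..1} \<inter> (\<lambda>s. norm (c s)) -` {r..}"
    have "closed S" unfolding S_def
      by (intro continuous_closed_preimage continuous_intros flow_line_continuous[OF c])
    moreover have "bounded S"
      by (rule bounded_subset[OF bounded_closed_interval[of 0 1]]) (auto simp: S_def)
    ultimately have "compact S" by (simp add: compact_eq_bounded_closed)
    moreover have "S \<noteq> {}" using \<open>\<not> norm (c s) < r\<close> that by (auto simp: S_def)
    ultimately obtain T where T: "T \<in> S" "\<And>s. s \<in> S \<Longrightarrow> T \<le> s"
      using compact_attains_inf[of S] by blast
    have T01: "T \<in> {0..1}" using T by (simp add: S_def)
    have "norm (c T) \<le> exp (K * T) * norm (c 0)"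
    proof (rule flow_line_gronwall[OF c X T01])
      fix u assume "0 < u" "u < T"
      then have "u \<notin> S" "u \<in> {0..1}" using T(2) T01 by force+
      then show "norm (c u) \<le> r" by (simp add: S_def)
    qed
    also note le[OF T01]
    also note small
    finally show False using T(1) by (simp add: S_def)
  qed
  have "norm (c t) \<le> exp (K * t) * norm (c 0)"
  proof (rule flow_line_gronwall[OF c X t])
    fix s assume "0 < s" "s < t"
    then show "norm (c s) \<le> r" using lt[of s] t by simp
  qed
  also note le[OF t]
  finally show ?thesis .
qed

lemma quadratic_form_bound:
  fixes x y a b c :: complex
  shows "norm (a * x ^ 2 + b * (x * y) + c * y ^ 2) \<le> (norm a + norm b + norm c) * norm (x, y) ^ 2"
proof -
  have nx: "norm x \<le> norm (x, y)" and ny: "norm y \<le> norm (x, y)"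
    by (rule norm_fst_le norm_snd_le)+
  have "norm (a * x ^ 2) \<le> norm a * norm (x, y) ^ 2"
    by (simp add: norm_mult norm_power mult_left_mono power_mono nx)
  moreover have "norm (b * (x * y)) \<le> norm b * norm (x, y) ^ 2"
    unfolding norm_mult power2_eq_square by (intro mult_mono nx ny) auto
  moreover have "norm (c * y ^ 2) \<le> norm c * norm (x, y) ^ 2"
    by (simp add: norm_mult norm_power mult_left_mono power_mono ny)
  moreover have "norm (a * x ^ 2 + b * (x * y) + c * y ^ 2)
      \<le> norm (a * x ^ 2) + norm (b * (x * y)) + norm (c * y ^ 2)"
    by (intro order_trans[OF norm_triangle_ineq] add_mono norm_triangle_ineq order_refl)
  ultimately show ?thesis by (simp add: algebra_simps)
qed

text \<open>With l linear and h quadratic in the initial point, this makes replacing a flow line by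
  the linear flow inside a quadratic form a cubic error.\<close>

lemma quadratic_form_diff_bound:
  fixes x y u v a b c :: complex
  assumes "norm (x - u) \<le> h" "norm (y - v) \<le> h"
    "norm x \<le> l" "norm y \<le> l" "norm u \<le> l" "norm v \<le> l"
  shows "norm ((a * x ^ 2 + b * (x * y) + c * y ^ 2) - (a * u ^ 2 + b * (u * v) + c * v ^ 2))
    \<le> (norm a + norm b + norm c) * (2 * l * h)"
proof -
  have l: "0 \<le> l" and h: "0 \<le> h" using assms norm_ge_zero order_trans by blast+
  have eq: "(a * x ^ 2 + b * (x * y) + c * y ^ 2) - (a * u ^ 2 + b * (u * v) + c * v ^ 2)
      = a * ((x - u) * (x + u)) + b * (x * (y - v) + (x - u) * v) + c * ((y - v) * (y + v))"
    by (simp add: algebra_simps power2_eq_square)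
  have 1: "norm ((x - u) * (x + u)) \<le> 2 * l * h"
  proof -
    have "norm (x - u) * norm (x + u) \<le> h * (2 * l)"
      using norm_triangle_ineq[of x u] assms l h by (intro mult_mono) auto
    then show ?thesis by (simp add: norm_mult mult_ac)
  qed
  have 2: "norm ((y - v) * (y + v)) \<le> 2 * l * h"
  proof -
    have "norm (y - v) * norm (y + v) \<le> h * (2 * l)"
      using norm_triangle_ineq[of y v] assms l h by (intro mult_mono) auto
    then show ?thesis by (simp add: norm_mult mult_ac)
  qed
  have 3: "norm (x * (y - v) + (x - u) * v) \<le> 2 * l * h"
  proof -
    have "norm (x * (y - v)) \<le> l * h" "norm ((x - u) * v) \<le> h * l"
      unfolding norm_mult using assms l h by (intro mult_mono; simp)+
    then show ?thesis using norm_triangle_ineq[of "x * (y - v)" "(x - u) * v"] by (simp add: mult.commute)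
  qed
  have "norm (a * ((x - u) * (x + u)) + b * (x * (y - v) + (x - u) * v) + c * ((y - v) * (y + v)))
      \<le> norm a * (2 * l * h) + norm b * (2 * l * h) + norm c * (2 * l * h)"
    by (intro order_trans[OF norm_triangle_ineq] add_mono order_trans[OF norm_triangle_ineq])
      (simp_all only: norm_mult[of a] norm_mult[of b] norm_mult[of c] mult_left_mono[OF 1] mult_left_mono[OF 2] mult_left_mono[OF 3] norm_ge_zero)
  then show ?thesis unfolding eq by (simp add: algebra_simps)
qed

text \<open>\<open>f\<close> and \<open>e\<close> are the entries of \<open>exp(-s M)\<close> and \<open>exp(s M)\<close>.\<close>

locale fundamental_system =
  fixes m11 m12 m21 m22 :: complex
    and f11 f12 f21 f22 e11 e12 e21 e22 :: "real \<Rightarrow> complex"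
  assumes f_deriv:
    "\<And>s. (f11 has_vector_derivative - (f11 s * m11 + f12 s * m21)) (at s within {0..1})"
    "\<And>s. (f12 has_vector_derivative - (f11 s * m12 + f12 s * m22)) (at s within {0..1})"
    "\<And>s. (f21 has_vector_derivative - (f21 s * m11 + f22 s * m21)) (at s within {0..1})"
    "\<And>s. (f22 has_vector_derivative - (f21 s * m12 + f22 s * m22)) (at s within {0..1})"
    and f_0: "f11 0 = 1" "f12 0 = 0" "f21 0 = 0" "f22 0 = 1"
    and e_cont: "continuous_on {0..1} e11" "continuous_on {0..1} e12"
      "continuous_on {0..1} e21" "continuous_on {0..1} e22"
    and ef: "\<And>s. e11 s * f11 s + e12 s * f21 s = 1" "\<And>s. e11 s * f12 s + e12 s * f22 s = 0"
      "\<And>s. e21 s * f11 s + e22 s * f21 s = 0" "\<And>s. e21 s * f12 s + e22 s * f22 s = 1"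

text \<open>The remainder is controlled on a ball of fixed radius because flow lines are estimated
  at all times in the unit interval. Conditions on X are separate from the fundamental system since
  one field is later studied with two of them: a general one, and a diagonal one once M is known to
  be diagonal.\<close>

locale flow_expansion = fundamental_system +
  fixes X :: "c2 \<Rightarrow> c2" and a1 b1 c1 a2 b2 c2 :: complex and r C :: real
  assumes r: "r > 0"
    and X1: "\<And>q. norm q \<le> r \<Longrightarrow> norm (fst (X q) - (m11 * fst q + m12 * snd q
      + a1 * fst q ^ 2 + b1 * (fst q * snd q) + c1 * snd q ^ 2)) \<le> C * norm q ^ 3"
    and X2: "\<And>q. norm q \<le> r \<Longrightarrow> norm (snd (X q) - (m21 * fst q + m22 * snd q
      + a2 * fst q ^ 2 + b2 * (fst q * snd q) + c2 * snd q ^ 2)) \<le> C * norm q ^ 3"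
begin

lemma C_nonneg: "C \<ge> 0"
proof -
  obtain q :: c2 where "norm q = r" using r vector_choose_size[of r, where 'a = c2] by (meson less_imp_le)
  then have "0 \<le> C * r ^ 3" using X1[of q] norm_ge_zero order_trans by blast
  then show ?thesis using r by (simp add: zero_le_mult_iff)
qed

text \<open>The summand \<open>C * r\<close> absorbs the cubic remainder into a quadratic bound on
  the ball.\<close>

definition Q :: real where
  "Q = norm a1 + norm b1 + norm c1 + norm a2 + norm b2 + norm c2 + C * r"

lemma X_linear:
  assumes "norm q \<le> r"
  shows "norm (fst (X q) - (m11 * fst q + m12 * snd q)) \<le> Q * norm q ^ 2"
    "norm (snd (X q) - (m21 * fst q + m22 * snd q)) \<le> Q * norm q ^ 2"
proof -
  have "C * norm q ^ 3 \<le> C * r * norm q ^ 2"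
    using mult_right_mono[OF mult_left_mono[OF assms C_nonneg], of "norm q ^ 2"]
    by (simp add: power3_eq_cube power2_eq_square mult_ac)
  moreover note X1[OF assms] X2[OF assms]
    quadratic_form_bound[of a1 "fst q" b1 "snd q" c1] quadratic_form_bound[of a2 "fst q" b2 "snd q" c2]
    norm_triangle_ineq[of "fst (X q) - (m11 * fst q + m12 * snd q
      + a1 * fst q ^ 2 + b1 * (fst q * snd q) + c1 * snd q ^ 2)" "a1 * fst q ^ 2 + b1 * (fst q * snd q) + c1 * snd q ^ 2"]
    norm_triangle_ineq[of "snd (X q) - (m21 * fst q + m22 * snd q
      + a2 * fst q ^ 2 + b2 * (fst q * snd q) + c2 * snd q ^ 2)" "a2 * fst q ^ 2 + b2 * (fst q * snd q) + c2 * snd q ^ 2"]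
  moreover have "(norm a1 + norm b1 + norm c1 + C * r) * norm q ^ 2 \<le> Q * norm q ^ 2"
    "(norm a2 + norm b2 + norm c2 + C * r) * norm q ^ 2 \<le> Q * norm q ^ 2"
    by (intro mult_right_mono; simp add: Q_def)+
  ultimately show "norm (fst (X q) - (m11 * fst q + m12 * snd q)) \<le> Q * norm q ^ 2"
    "norm (snd (X q) - (m21 * fst q + m22 * snd q)) \<le> Q * norm q ^ 2"
    by (simp_all add: algebra_simps)
qed

lemma flow_small: "\<exists>D \<rho>. D > 0 \<and> \<rho> > 0 \<and> (\<forall>c. flow_line X c \<longrightarrow> norm (c 0) < \<rho> \<longrightarrow>
    (\<forall>s\<in>{0..1}. norm (c s) \<le> D * norm (c 0) \<and> norm (c s) \<le> r))"
proof -
  define K where "K = norm m11 + norm m12 + norm m21 + norm m22 + 2 * Q * r"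
  have Q: "Q \<ge> 0" using C_nonneg r by (simp add: Q_def)
  have K: "norm (X q) \<le> K * norm q" if q: "norm q \<le> r" for q
  proof -
    have nx: "norm (fst q) \<le> norm q" and ny: "norm (snd q) \<le> norm q"
      using norm_fst_le[of "fst q" "snd q"] norm_snd_le[of "snd q" "fst q"] by simp_all
    have m: "norm (a * fst q + b * snd q) \<le> (norm a + norm b) * norm q" for a b
      using nx ny norm_triangle_ineq[of "a * fst q" "b * snd q"]
        mult_left_mono[OF nx, of "norm a"] mult_left_mono[OF ny, of "norm b"]
      by (simp add: norm_mult algebra_simps)
    have "Q * norm q ^ 2 \<le> Q * r * norm q"
      using mult_right_mono[OF mult_left_mono[OF q Q], of "norm q"]
      by (simp add: power2_eq_square mult_ac)
    moreover note X_linear[OF q] m[of m11 m12] m[of m21 m22]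
      norm_triangle_ineq[of "fst (X q) - (m11 * fst q + m12 * snd q)" "m11 * fst q + m12 * snd q"]
      norm_triangle_ineq[of "snd (X q) - (m21 * fst q + m22 * snd q)" "m21 * fst q + m22 * snd q"]
    moreover have "norm (X q) \<le> norm (fst (X q)) + norm (snd (X q))"
      using norm_Pair_le[of "fst (X q)" "snd (X q)"] by simp
    ultimately show ?thesis unfolding K_def by (simp add: algebra_simps)
  qed
  have K0: "K \<ge> 0" using Q r by (simp add: K_def)
  have "norm (c s) \<le> exp K * norm (c 0) \<and> norm (c s) \<le> r"
    if "flow_line X c" "norm (c 0) < r / exp K" "s \<in> {0..1}" for c s
  proof -
    have lt: "exp K * norm (c 0) < r" using that(2) by (simp add: field_simps)
    from flow_line_bound[OF that(1) K K0 this that(3)] lt show ?thesis by simp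
  qed
  then show ?thesis using r by (intro exI[of _ "exp K"] exI[of _ "r / exp K"]) simp
qed

lemma f_cont: "continuous_on {0..1} f11" "continuous_on {0..1} f12"
  "continuous_on {0..1} f21" "continuous_on {0..1} f22"
  unfolding continuous_on_eq_continuous_within using f_deriv has_vector_derivative_continuous by blast+

lemma entries_bounded: "\<exists>A>0. \<forall>s\<in>{0..1}. norm (f11 s) \<le> A \<and> norm (f12 s) \<le> A \<and> norm (f21 s) \<le> A
   \<and> norm (f22 s) \<le> A \<and> norm (e11 s) \<le> A \<and> norm (e12 s) \<le> A \<and> norm (e21 s) \<le> A \<and> norm (e22 s) \<le> A"
proof -
  define h where "h s = norm (f11 s) + norm (f12 s) + norm (f21 s) + norm (f22 s)
    + norm (e11 s) + norm (e12 s) + norm (e21 s) + norm (e22 s)" for s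
  have "continuous_on {0..1} h"
    unfolding h_def by (intro continuous_intros f_cont e_cont)
  from compact_imp_bounded[OF compact_continuous_image[OF this compact_Icc]]
  obtain A where A: "\<And>s. s \<in> {0..1} \<Longrightarrow> norm (h s) \<le> A" unfolding bounded_iff by (meson imageI)
  have "norm (f11 s) \<le> \<bar>A\<bar> + 1 \<and> norm (f12 s) \<le> \<bar>A\<bar> + 1 \<and> norm (f21 s) \<le> \<bar>A\<bar> + 1
   \<and> norm (f22 s) \<le> \<bar>A\<bar> + 1 \<and> norm (e11 s) \<le> \<bar>A\<bar> + 1 \<and> norm (e12 s) \<le> \<bar>A\<bar> + 1
   \<and> norm (e21 s) \<le> \<bar>A\<bar> + 1 \<and> norm (e22 s) \<le> \<bar>A\<bar> + 1" if "s \<in> {0..1}" for s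
  proof -
    have "h s \<le> \<bar>A\<bar> + 1" using A[OF that] by simp
    moreover note norm_ge_zero[of "f11 s"] norm_ge_zero[of "f12 s"] norm_ge_zero[of "f21 s"]
      norm_ge_zero[of "f22 s"] norm_ge_zero[of "e11 s"] norm_ge_zero[of "e12 s"]
      norm_ge_zero[of "e21 s"] norm_ge_zero[of "e22 s"]
    ultimately show ?thesis unfolding h_def by (intro conjI) linarith+
  qed
  then show ?thesis by (intro exI[of _ "\<bar>A\<bar> + 1"] conjI ballI) auto
qed

text \<open>Variation of constants: pairing the flow line with a row (g1, g2) of exp(-s M) cancels
  the linear part of X.\<close>

lemma row_derivative:
  assumes c: "flow_line X c" and s: "s \<in> {0..1}"
    and g: "(g1 has_vector_derivative - (g1 s * m11 + g2 s * m21)) (at s within {0..1})"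
      "(g2 has_vector_derivative - (g1 s * m12 + g2 s * m22)) (at s within {0..1})"
  shows "((\<lambda>s. g1 s * fst (c s) + g2 s * snd (c s)) has_vector_derivative
    (g1 s * (fst (X (c s)) - (m11 * fst (c s) + m12 * snd (c s)))
    + g2 s * (snd (X (c s)) - (m21 * fst (c s) + m22 * snd (c s))))) (at s within {0..1})"
proof -
  have c': "(c has_vector_derivative X (c s)) (at s within {0..1})"
    using c s by (simp add: flow_line_def)
  have "((\<lambda>s. fst (c s)) has_vector_derivative fst (X (c s))) (at s within {0..1})"
    using bounded_linear.has_vector_derivative[OF bounded_linear_fst c'] .
  moreover have "((\<lambda>s. snd (c s)) has_vector_derivative snd (X (c s))) (at s within {0..1})"
    using bounded_linear.has_vector_derivative[OF bounded_linear_snd c'] .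
  ultimately have "((\<lambda>s. g1 s * fst (c s) + g2 s * snd (c s)) has_vector_derivative
    (g1 s * fst (X (c s)) + - (g1 s * m11 + g2 s * m21) * fst (c s)
    + (g2 s * snd (X (c s)) + - (g1 s * m12 + g2 s * m22) * snd (c s)))) (at s within {0..1})"
    by (intro has_vector_derivative_add has_vector_derivative_mult g)
  then show ?thesis by (rule back_subst) (simp add: algebra_simps)
qed

text \<open>By \<open>row_derivative\<close>, exp(-s M) c(s) moves only by a quadratic amount from
  c(0); multiplication by the bounded matrix exp(s M) returns to c(s).\<close>

lemma flow_linear_approx: "\<exists>H \<rho>. H > 0 \<and> \<rho> > 0 \<and> (\<forall>c. flow_line X c \<longrightarrow> norm (c 0) < \<rho> \<longrightarrow>
    (\<forall>s\<in>{0..1}. norm (fst (c s) - (e11 s * fst (c 0) + e12 s * snd (c 0))) \<le> H * norm (c 0) ^ 2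
      \<and> norm (snd (c s) - (e21 s * fst (c 0) + e22 s * snd (c 0))) \<le> H * norm (c 0) ^ 2))"
proof -
  obtain A where A: "A > 0" "\<forall>s\<in>{0..1}. norm (f11 s) \<le> A \<and> norm (f12 s) \<le> A \<and> norm (f21 s) \<le> A
   \<and> norm (f22 s) \<le> A \<and> norm (e11 s) \<le> A \<and> norm (e12 s) \<le> A \<and> norm (e21 s) \<le> A \<and> norm (e22 s) \<le> A"
    using entries_bounded by blast
  obtain D \<rho> where D: "D > 0" "\<rho> > 0" and small: "\<And>c s. flow_line X c \<Longrightarrow> norm (c 0) < \<rho> \<Longrightarrow> s \<in> {0..1}
      \<Longrightarrow> norm (c s) \<le> D * norm (c 0) \<and> norm (c s) \<le> r"
    using flow_small by blast
  have Q: "Q \<ge> 0" using C_nonneg r by (simp add: Q_def)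
  define B where "B = 2 * A * Q * D ^ 2"
  have row: "norm ((g1 s * fst (c s) + g2 s * snd (c s)) - (g1 0 * fst (c 0) + g2 0 * snd (c 0)))
      \<le> B * norm (c 0) ^ 2"
    if c: "flow_line X c" "norm (c 0) < \<rho>" and s: "s \<in> {0..1}"
      and g: "\<And>s. (g1 has_vector_derivative - (g1 s * m11 + g2 s * m21)) (at s within {0..1})"
      "\<And>s. (g2 has_vector_derivative - (g1 s * m12 + g2 s * m22)) (at s within {0..1})"
      and gA: "\<And>s. s \<in> {0..1} \<Longrightarrow> norm (g1 s) \<le> A" "\<And>s. s \<in> {0..1} \<Longrightarrow> norm (g2 s) \<le> A"
    for c s g1 g2
  proof (rule vector_derivative_bound_01[OF row_derivative[OF c(1) _ g] _ s], assumption)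
    fix s :: real assume s: "s \<in> {0..1}"
    let ?u = "fst (X (c s)) - (m11 * fst (c s) + m12 * snd (c s))"
    let ?v = "snd (X (c s)) - (m21 * fst (c s) + m22 * snd (c s))"
    have le: "norm (c s) ^ 2 \<le> (D * norm (c 0)) ^ 2" and cr: "norm (c s) \<le> r"
      using small[OF c s] by (auto intro: power_mono)
    have "norm ?u \<le> Q * (D * norm (c 0)) ^ 2" "norm ?v \<le> Q * (D * norm (c 0)) ^ 2"
      using X_linear[OF cr] mult_left_mono[OF le Q] by simp_all
    then have "norm (g1 s * ?u) \<le> A * (Q * (D * norm (c 0)) ^ 2)"
      "norm (g2 s * ?v) \<le> A * (Q * (D * norm (c 0)) ^ 2)"
      unfolding norm_mult using A(1) by (intro mult_mono gA s; simp)+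
    then show "norm (g1 s * ?u + g2 s * ?v) \<le> B * norm (c 0) ^ 2"
      using norm_triangle_ineq[of "g1 s * ?u" "g2 s * ?v"]
      by (simp add: B_def power_mult_distrib algebra_simps)
  qed
  have B: "B \<ge> 0" using A Q by (simp add: B_def)
  have main: "norm (fst (c s) - (e11 s * fst (c 0) + e12 s * snd (c 0))) \<le> (2 * A * B + 1) * norm (c 0) ^ 2
      \<and> norm (snd (c s) - (e21 s * fst (c 0) + e22 s * snd (c 0))) \<le> (2 * A * B + 1) * norm (c 0) ^ 2"
    if c: "flow_line X c" "norm (c 0) < \<rho>" and s: "s \<in> {0..1}" for c s
  proof -
    have 1: "norm ((f11 s * fst (c s) + f12 s * snd (c s)) - fst (c 0)) \<le> B * norm (c 0) ^ 2" (is "norm ?u \<le> ?B")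
      using row[OF c s f_deriv(1,2)] A(2) f_0 by simp
    have 2: "norm ((f21 s * fst (c s) + f22 s * snd (c s)) - snd (c 0)) \<le> B * norm (c 0) ^ 2" (is "norm ?v \<le> ?B")
      using row[OF c s f_deriv(3,4)] A(2) f_0 by simp
    have e1: "fst (c s) - (e11 s * fst (c 0) + e12 s * snd (c 0)) = e11 s * ?u + e12 s * ?v"
    proof -
      have "e11 s * ?u + e12 s * ?v = (e11 s * f11 s + e12 s * f21 s) * fst (c s)
          + (e11 s * f12 s + e12 s * f22 s) * snd (c s) - (e11 s * fst (c 0) + e12 s * snd (c 0))"
        by (simp add: algebra_simps)
      then show ?thesis unfolding ef by simp
    qed
    have e2: "snd (c s) - (e21 s * fst (c 0) + e22 s * snd (c 0)) = e21 s * ?u + e22 s * ?v"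
    proof -
      have "e21 s * ?u + e22 s * ?v = (e21 s * f11 s + e22 s * f21 s) * fst (c s)
          + (e21 s * f12 s + e22 s * f22 s) * snd (c s) - (e21 s * fst (c 0) + e22 s * snd (c 0))"
        by (simp add: algebra_simps)
      then show ?thesis unfolding ef by simp
    qed
    have bd: "norm (x * ?u + y * ?v) \<le> (2 * A * B + 1) * norm (c 0) ^ 2" if "norm x \<le> A" "norm y \<le> A" for x y
    proof -
      have "norm (x * ?u) \<le> A * ?B" "norm (y * ?v) \<le> A * ?B"
        unfolding norm_mult using that 1 2 A(1) by (intro mult_mono; simp)+
      then have "norm (x * ?u + y * ?v) \<le> 2 * (A * ?B)"
        using norm_triangle_ineq[of "x * ?u" "y * ?v"] by linarith
      also have "\<dots> \<le> (2 * A * B + 1) * norm (c 0) ^ 2" by (simp add: algebra_simps)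
      finally show ?thesis .
    qed
    show ?thesis unfolding e1 e2 using bd A(2) s by blast
  qed
  show ?thesis
    by (rule exI[of _ "2 * A * B + 1"], rule exI[of _ \<rho>]) (use main D A B in \<open>auto simp: add_nonneg_pos\<close>)
qed

text \<open>\<open>k20\<close>, \<open>k11\<close> and \<open>k02\<close> are the coefficients of
  x^2, x y and y^2 in the quadratic form a x^2 + b x y + c y^2 composed with exp(s M).\<close>

definition k20 :: "complex \<Rightarrow> complex \<Rightarrow> complex \<Rightarrow> real \<Rightarrow> complex" where
  "k20 a b c s = a * e11 s ^ 2 + b * (e11 s * e21 s) + c * e21 s ^ 2"

definition k11 :: "complex \<Rightarrow> complex \<Rightarrow> complex \<Rightarrow> real \<Rightarrow> complex" where
  "k11 a b c s = 2 * a * (e11 s * e12 s) + b * (e11 s * e22 s + e12 s * e21 s) + 2 * c * (e21 s * e22 s)"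

definition k02 :: "complex \<Rightarrow> complex \<Rightarrow> complex \<Rightarrow> real \<Rightarrow> complex" where
  "k02 a b c s = a * e12 s ^ 2 + b * (e12 s * e22 s) + c * e22 s ^ 2"

lemma k_cont: "continuous_on {0..1} (k20 a b c)" "continuous_on {0..1} (k11 a b c)"
  "continuous_on {0..1} (k02 a b c)"
  unfolding k20_def k11_def k02_def by (intro continuous_intros e_cont)+

lemma quadratic_along_linear_flow:
  "a * (e11 s * x + e12 s * y) ^ 2 + b * ((e11 s * x + e12 s * y) * (e21 s * x + e22 s * y))
    + c * (e21 s * x + e22 s * y) ^ 2 = k20 a b c s * x ^ 2 + k11 a b c s * (x * y) + k02 a b c s * y ^ 2"
  by (simp add: k20_def k11_def k02_def algebra_simps power2_eq_square)

text \<open>Duhamel's formula at second order: the quadratic part of exp(-M) c(1) is the integral of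
  exp(-s M) applied to the quadratic part of X along the linear flow.\<close>

lemma flow_row_jet:
  assumes g: "\<And>s. (g1 has_vector_derivative - (g1 s * m11 + g2 s * m21)) (at s within {0..1})"
      "\<And>s. (g2 has_vector_derivative - (g1 s * m12 + g2 s * m22)) (at s within {0..1})"
    and gA: "\<And>s. s \<in> {0..1} \<Longrightarrow> norm (g1 s) \<le> A" "\<And>s. s \<in> {0..1} \<Longrightarrow> norm (g2 s) \<le> A"
    and Ae: "\<And>s. s \<in> {0..1} \<Longrightarrow> norm (e11 s) \<le> A \<and> norm (e12 s) \<le> A \<and> norm (e21 s) \<le> A \<and> norm (e22 s) \<le> A"
  shows "\<exists>B \<rho>. \<rho> > 0 \<and> (\<forall>c. flow_line X c \<longrightarrow> norm (c 0) < \<rho> \<longrightarrow>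
    norm (g1 1 * fst (c 1) + g2 1 * snd (c 1) - (g1 0 * fst (c 0) + g2 0 * snd (c 0)
      + integral {0..1} (\<lambda>s. g1 s * k20 a1 b1 c1 s + g2 s * k20 a2 b2 c2 s) * fst (c 0) ^ 2
      + integral {0..1} (\<lambda>s. g1 s * k11 a1 b1 c1 s + g2 s * k11 a2 b2 c2 s) * (fst (c 0) * snd (c 0))
      + integral {0..1} (\<lambda>s. g1 s * k02 a1 b1 c1 s + g2 s * k02 a2 b2 c2 s) * snd (c 0) ^ 2))
    \<le> B * norm (c 0) ^ 3)"
proof -
  have A: "A \<ge> 0" using order_trans[OF norm_ge_zero gA(1)[of 0]] by simp
  obtain D \<rho>1 where D: "D > 0" "\<rho>1 > 0" and small: "\<And>c s. flow_line X c \<Longrightarrow> norm (c 0) < \<rho>1 \<Longrightarrow> s \<in> {0..1}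
      \<Longrightarrow> norm (c s) \<le> D * norm (c 0) \<and> norm (c s) \<le> r"
    using flow_small by blast
  obtain H \<rho>2 where H: "H > 0" "\<rho>2 > 0" and lin: "\<And>c s. flow_line X c \<Longrightarrow> norm (c 0) < \<rho>2 \<Longrightarrow> s \<in> {0..1} \<Longrightarrow>
      norm (fst (c s) - (e11 s * fst (c 0) + e12 s * snd (c 0))) \<le> H * norm (c 0) ^ 2
      \<and> norm (snd (c s) - (e21 s * fst (c 0) + e22 s * snd (c 0))) \<le> H * norm (c 0) ^ 2"
    using flow_linear_approx by blast
  define G20 where "G20 s = g1 s * k20 a1 b1 c1 s + g2 s * k20 a2 b2 c2 s" for s
  define G11 where "G11 s = g1 s * k11 a1 b1 c1 s + g2 s * k11 a2 b2 c2 s" for s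
  define G02 where "G02 s = g1 s * k02 a1 b1 c1 s + g2 s * k02 a2 b2 c2 s" for s
  have gc: "continuous_on {0..1} g1" "continuous_on {0..1} g2"
    unfolding continuous_on_eq_continuous_within using g has_vector_derivative_continuous by blast+
  have Gc: "continuous_on {0..1} G20" "continuous_on {0..1} G11" "continuous_on {0..1} G02"
    unfolding G20_def G11_def G02_def by (intro continuous_intros gc k_cont)+
  \<comment> \<open>A common bound for the coordinates of the flow line (through \<open>D\<close>)
    and of the linear flow (through \<open>2 * A\<close>).\<close>
  define L where "L = D + 2 * A"
  define N where "N = norm a1 + norm b1 + norm c1 + norm a2 + norm b2 + norm c2"
  define B where "B = 2 * A * (C * D ^ 3 + N * (2 * L * H))"
  have main: "norm (g1 1 * fst (c 1) + g2 1 * snd (c 1) - (g1 0 * fst (c 0) + g2 0 * snd (c 0)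
      + integral {0..1} G20 * fst (c 0) ^ 2 + integral {0..1} G11 * (fst (c 0) * snd (c 0))
      + integral {0..1} G02 * snd (c 0) ^ 2)) \<le> B * norm (c 0) ^ 3"
    if c: "flow_line X c" "norm (c 0) < min \<rho>1 \<rho>2" for c
  proof -
    define x y where "x = fst (c 0)" and "y = snd (c 0)"
    have nx: "norm x \<le> norm (c 0)" and ny: "norm y \<le> norm (c 0)"
      using norm_fst_le[of x y] norm_snd_le[of y x] by (simp_all add: x_def y_def)
    \<comment> \<open>Subtracting the running integrals of the expected quadratic terms leaves a
      function whose derivative is already cubic in the initial point.\<close>
    define \<psi> where "\<psi> s = g1 s * fst (c s) + g2 s * snd (c s) - (integral {0..s} G20 * x ^ 2
      + integral {0..s} G11 * (x * y) + integral {0..s} G02 * y ^ 2)" for s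
    have "norm (\<psi> 1 - \<psi> 0) \<le> B * norm (c 0) ^ 3"
    proof (rule vector_derivative_bound_01)
      fix s :: real assume s: "s \<in> {0..1}"
      show "(\<psi> has_vector_derivative (g1 s * (fst (X (c s)) - (m11 * fst (c s) + m12 * snd (c s)))
          + g2 s * (snd (X (c s)) - (m21 * fst (c s) + m22 * snd (c s))))
          - (G20 s * x ^ 2 + G11 s * (x * y) + G02 s * y ^ 2)) (at s within {0..1})"
        unfolding \<psi>_def
        by (intro has_vector_derivative_diff has_vector_derivative_add row_derivative[OF c(1) s g]
            has_vector_derivative_mult_left integral_has_vector_derivative Gc s)
      let ?u = "e11 s * x + e12 s * y" and ?v = "e21 s * x + e22 s * y"
      let ?R1 = "fst (X (c s)) - (m11 * fst (c s) + m12 * snd (c s)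
        + a1 * fst (c s) ^ 2 + b1 * (fst (c s) * snd (c s)) + c1 * snd (c s) ^ 2)"
      let ?R2 = "snd (X (c s)) - (m21 * fst (c s) + m22 * snd (c s)
        + a2 * fst (c s) ^ 2 + b2 * (fst (c s) * snd (c s)) + c2 * snd (c s) ^ 2)"
      let ?S = "\<lambda>a b d. (a * fst (c s) ^ 2 + b * (fst (c s) * snd (c s)) + d * snd (c s) ^ 2)
        - (a * ?u ^ 2 + b * (?u * ?v) + d * ?v ^ 2)"
      have cs: "norm (c s) \<le> D * norm (c 0)" "norm (c s) \<le> r" using small[OF c(1) _ s] c(2) by auto
      have c3: "C * norm (c s) ^ 3 \<le> C * D ^ 3 * norm (c 0) ^ 3"
        using power_mono[OF cs(1), of 3] C_nonneg by (simp add: power_mult_distrib mult_left_mono mult.assoc)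
      have lincs: "norm (fst (c s) - ?u) \<le> H * norm (c 0) ^ 2" "norm (snd (c s) - ?v) \<le> H * norm (c 0) ^ 2"
        using lin[OF c(1) _ s] c(2) by (auto simp: x_def y_def)
      have cl: "norm (fst (c s)) \<le> L * norm (c 0)" "norm (snd (c s)) \<le> L * norm (c 0)"
      proof -
        have "norm (c s) \<le> L * norm (c 0)"
          using cs(1) A by (simp add: L_def distrib_right add_increasing2)
        then show "norm (fst (c s)) \<le> L * norm (c 0)" "norm (snd (c s)) \<le> L * norm (c 0)"
          using norm_fst_le[of "fst (c s)" "snd (c s)"] norm_snd_le[of "snd (c s)" "fst (c s)"] by simp_all
      qed
      have ul: "norm (p * x + q * y) \<le> L * norm (c 0)" if "norm p \<le> A" "norm q \<le> A" for p q
      proof -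
        have "norm (p * x) \<le> A * norm (c 0)" "norm (q * y) \<le> A * norm (c 0)"
          unfolding norm_mult using that nx ny A by (intro mult_mono; simp)+
        then have "norm (p * x + q * y) \<le> 2 * A * norm (c 0)"
          using norm_triangle_ineq[of "p * x" "q * y"] by linarith
        also have "\<dots> \<le> L * norm (c 0)" using D by (intro mult_right_mono) (auto simp: L_def)
        finally show ?thesis .
      qed
      have S: "norm (?S a b d) \<le> N * (2 * L * H) * norm (c 0) ^ 3" if "norm a + norm b + norm d \<le> N" for a b d
      proof -
        have "norm (?S a b d) \<le> (norm a + norm b + norm d) * (2 * (L * norm (c 0)) * (H * norm (c 0) ^ 2))"
          by (rule quadratic_form_diff_bound[OF lincs cl]; rule ul; use Ae s in blast)
        also have "\<dots> \<le> N * (2 * (L * norm (c 0)) * (H * norm (c 0) ^ 2))"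
          using that A D H by (intro mult_right_mono) (auto simp: L_def)
        finally show ?thesis by (simp add: power3_eq_cube power2_eq_square mult_ac)
      qed
      \<comment> \<open>\<open>?R1\<close> and \<open>?R2\<close> are the cubic remainders of X;
        \<open>?S\<close> is the change of a quadratic form between the flow line and the linear
        flow.\<close>
      have eq: "(g1 s * (fst (X (c s)) - (m11 * fst (c s) + m12 * snd (c s)))
          + g2 s * (snd (X (c s)) - (m21 * fst (c s) + m22 * snd (c s))))
          - (G20 s * x ^ 2 + G11 s * (x * y) + G02 s * y ^ 2)
        = g1 s * (?R1 + ?S a1 b1 c1) + g2 s * (?R2 + ?S a2 b2 c2)"
        unfolding quadratic_along_linear_flow G20_def G11_def G02_def by (simp add: algebra_simps)
      have "norm (?R1 + ?S a1 b1 c1) \<le> (C * D ^ 3 + N * (2 * L * H)) * norm (c 0) ^ 3"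
      proof -
        have "norm (?S a1 b1 c1) \<le> N * (2 * L * H) * norm (c 0) ^ 3" by (rule S) (simp add: N_def)
        then show ?thesis
          using norm_triangle_ineq[of ?R1 "?S a1 b1 c1"] X1[OF cs(2)] c3 unfolding distrib_right by linarith
      qed
      moreover have "norm (?R2 + ?S a2 b2 c2) \<le> (C * D ^ 3 + N * (2 * L * H)) * norm (c 0) ^ 3"
      proof -
        have "norm (?S a2 b2 c2) \<le> N * (2 * L * H) * norm (c 0) ^ 3" by (rule S) (simp add: N_def)
        then show ?thesis
          using norm_triangle_ineq[of ?R2 "?S a2 b2 c2"] X2[OF cs(2)] c3 unfolding distrib_right by linarith
      qed
      ultimately have "norm (g1 s * (?R1 + ?S a1 b1 c1)) \<le> A * ((C * D ^ 3 + N * (2 * L * H)) * norm (c 0) ^ 3)"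
        "norm (g2 s * (?R2 + ?S a2 b2 c2)) \<le> A * ((C * D ^ 3 + N * (2 * L * H)) * norm (c 0) ^ 3)"
        unfolding norm_mult using A by (intro mult_mono gA s; simp)+
      then have "norm (g1 s * (?R1 + ?S a1 b1 c1) + g2 s * (?R2 + ?S a2 b2 c2))
          \<le> 2 * (A * ((C * D ^ 3 + N * (2 * L * H)) * norm (c 0) ^ 3))"
        using norm_triangle_ineq[of "g1 s * (?R1 + ?S a1 b1 c1)" "g2 s * (?R2 + ?S a2 b2 c2)"] by linarith
      also have "\<dots> = B * norm (c 0) ^ 3" by (simp add: B_def)
      finally show "norm ((g1 s * (fst (X (c s)) - (m11 * fst (c s) + m12 * snd (c s)))
          + g2 s * (snd (X (c s)) - (m21 * fst (c s) + m22 * snd (c s))))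
          - (G20 s * x ^ 2 + G11 s * (x * y) + G02 s * y ^ 2)) \<le> B * norm (c 0) ^ 3"
        unfolding eq .
    qed simp
    also have "\<psi> 1 - \<psi> 0 = g1 1 * fst (c 1) + g2 1 * snd (c 1) - (g1 0 * fst (c 0) + g2 0 * snd (c 0)
      + integral {0..1} G20 * fst (c 0) ^ 2 + integral {0..1} G11 * (fst (c 0) * snd (c 0))
      + integral {0..1} G02 * snd (c 0) ^ 2)"
      by (simp add: \<psi>_def x_def y_def algebra_simps)
    finally show ?thesis .
  qed
  show ?thesis
    by (rule exI[of _ B], rule exI[of _ "min \<rho>1 \<rho>2"])
      (use main D H in \<open>auto simp: G20_def[abs_def] G11_def[abs_def] G02_def[abs_def]\<close>)
qed

end

section \<open>Arithmetic and uniqueness of quadratic jets\<close>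

lemma jet2_lincomb:
  assumes "jet2 f a b c d e" "jet2 g a' b' c' d' e'"
  shows "jet2 (\<lambda>p. u * f p + v * g p) (u * a + v * a') (u * b + v * b') (u * c + v * c')
    (u * d + v * d') (u * e + v * e')"
proof -
  let ?q = "\<lambda>a b c d e p. a * fst p + b * snd p + c * fst p ^ 2 + d * (fst p * snd p) + e * snd p ^ 2"
  obtain C where C: "\<forall>\<^sub>F p in nhds 0. norm (f p - ?q a b c d e p) \<le> C * norm p ^ 3"
    using assms(1) unfolding jet2_def by blast
  obtain C' where C': "\<forall>\<^sub>F p in nhds 0. norm (g p - ?q a' b' c' d' e' p) \<le> C' * norm p ^ 3"
    using assms(2) unfolding jet2_def by blast
  from C C' have "\<forall>\<^sub>F p in nhds 0. norm (u * f p + v * g p - ?q (u * a + v * a') (u * b + v * b')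
      (u * c + v * c') (u * d + v * d') (u * e + v * e') p) \<le> (norm u * C + norm v * C') * norm p ^ 3"
  proof eventually_elim
    case (elim p)
    have eq: "u * f p + v * g p - ?q (u * a + v * a') (u * b + v * b')
      (u * c + v * c') (u * d + v * d') (u * e + v * e') p
      = u * (f p - ?q a b c d e p) + v * (g p - ?q a' b' c' d' e' p)"
      by (simp add: algebra_simps)
    have "norm (u * (f p - ?q a b c d e p)) \<le> norm u * (C * norm p ^ 3)"
      "norm (v * (g p - ?q a' b' c' d' e' p)) \<le> norm v * (C' * norm p ^ 3)"
      unfolding norm_mult using elim by (intro mult_left_mono; simp)+
    then show ?case
      unfolding eq using norm_triangle_ineq[of "u * (f p - ?q a b c d e p)" "v * (g p - ?q a' b' c' d' e' p)"]
      unfolding distrib_right mult.assoc by linarith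
  qed
  then show ?thesis unfolding jet2_def by blast
qed

lemma norm_fst_le_norm: "norm (fst p) \<le> norm p" and norm_snd_le_norm: "norm (snd p) \<le> norm p"
  for p :: "'a::real_normed_vector \<times> 'b::real_normed_vector"
  using norm_fst_le[of "fst p" "snd p"] norm_snd_le[of "snd p" "fst p"] by simp_all

lemma eventually_norm_less_nhds_0:
  fixes r :: real
  assumes "r > 0"
  shows "\<forall>\<^sub>F p in nhds (0 :: 'a::real_normed_vector). norm p < r"
  unfolding eventually_nhds_metric by (rule exI[of _ r]) (use assms in \<open>simp add: dist_norm\<close>)

lemma jet2_linear_bound:
  assumes "jet2 f a b c d e"
  shows "\<exists>C\<ge>0. \<forall>\<^sub>F p in nhds 0. norm (f p - (a * fst p + b * snd p)) \<le> C * norm p ^ 2"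
proof -
  obtain C where C: "\<forall>\<^sub>F p in nhds 0. norm (f p - (a * fst p + b * snd p + c * fst p ^ 2
      + d * (fst p * snd p) + e * snd p ^ 2)) \<le> C * norm p ^ 3"
    using assms unfolding jet2_def by blast
  have "\<forall>\<^sub>F p in nhds (0::c2). norm p < 1" by (rule eventually_norm_less_nhds_0) simp
  with C have "\<forall>\<^sub>F p in nhds 0. norm (f p - (a * fst p + b * snd p))
      \<le> (\<bar>C\<bar> + norm c + norm d + norm e) * norm p ^ 2"
  proof eventually_elim
    case (elim p)
    have "C * norm p ^ 3 \<le> \<bar>C\<bar> * norm p ^ 2"
      using elim(2) by (intro mult_mono power_decreasing) auto
    moreover have "norm (c * fst p ^ 2 + d * (fst p * snd p) + e * snd p ^ 2)
        \<le> (norm c + norm d + norm e) * norm p ^ 2"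
      using quadratic_form_bound[of c "fst p" d "snd p" e] by simp
    moreover have "f p - (a * fst p + b * snd p) = (f p - (a * fst p + b * snd p + c * fst p ^ 2
      + d * (fst p * snd p) + e * snd p ^ 2)) + (c * fst p ^ 2 + d * (fst p * snd p) + e * snd p ^ 2)"
      by simp
    then have "norm (f p - (a * fst p + b * snd p)) \<le> norm (f p - (a * fst p + b * snd p + c * fst p ^ 2
      + d * (fst p * snd p) + e * snd p ^ 2)) + norm (c * fst p ^ 2 + d * (fst p * snd p) + e * snd p ^ 2)"
      by (metis norm_triangle_ineq)
    ultimately show ?case using elim(1) unfolding distrib_right by linarith
  qed
  then show ?thesis by (intro exI[of _ "\<bar>C\<bar> + norm c + norm d + norm e"]) simp
qed

text \<open>With l the linear part of f, f^2 - l^2 = (f - l)(f + l) is a quadratic error times a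
  linear bound, so only l contributes.\<close>

lemma jet2_square:
  assumes "jet2 f a b c d e"
  shows "jet2 (\<lambda>p. f p ^ 2) 0 0 (a ^ 2) (2 * a * b) (b ^ 2)"
proof -
  obtain C where C: "C \<ge> 0" "\<forall>\<^sub>F p in nhds 0. norm (f p - (a * fst p + b * snd p)) \<le> C * norm p ^ 2"
    using jet2_linear_bound[OF assms] by blast
  have "\<forall>\<^sub>F p in nhds (0::c2). norm p < 1" by (rule eventually_norm_less_nhds_0) simp
  with C(2) have "\<forall>\<^sub>F p in nhds 0. norm (f p ^ 2 - (0 * fst p + 0 * snd p + a ^ 2 * fst p ^ 2
      + 2 * a * b * (fst p * snd p) + b ^ 2 * snd p ^ 2)) \<le> (C * (C + 2 * (norm a + norm b))) * norm p ^ 3"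
  proof eventually_elim
    case (elim p)
    let ?l = "a * fst p + b * snd p"
    have l: "norm ?l \<le> (norm a + norm b) * norm p"
      using norm_triangle_ineq[of "a * fst p" "b * snd p"] mult_left_mono[OF norm_fst_le_norm[of p], of "norm a"]
        mult_left_mono[OF norm_snd_le_norm[of p], of "norm b"] by (simp add: norm_mult algebra_simps)
    have "C * norm p ^ 2 \<le> C * norm p"
      using elim(2) C(1) by (intro mult_left_mono) (simp_all add: power2_eq_square mult_left_le)
    then have "norm (f p - ?l) \<le> C * norm p" using elim(1) by simp
    have "f p + ?l = (f p - ?l) + 2 * ?l" by simp
    then have "norm (f p + ?l) \<le> norm (f p - ?l) + norm (2 * ?l)" by (metis norm_triangle_ineq)
    then have "norm (f p + ?l) \<le> norm (f p - ?l) + 2 * norm ?l" by (simp only: norm_mult norm_numeral)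
    moreover have "z \<le> x' + 2 * w'" if "z \<le> x + 2 * w" "x \<le> x'" "w \<le> w'" for x x' w w' z :: real
      using that by linarith
    ultimately have "norm (f p + ?l) \<le> C * norm p + 2 * ((norm a + norm b) * norm p)"
      using l \<open>norm (f p - ?l) \<le> C * norm p\<close> by blast
    then have "norm (f p + ?l) \<le> (C + 2 * (norm a + norm b)) * norm p"
      unfolding distrib_right mult.assoc .
    then have "norm (f p - ?l) * norm (f p + ?l) \<le> (C * norm p ^ 2) * ((C + 2 * (norm a + norm b)) * norm p)"
      using elim(1) C(1) by (intro mult_mono) auto
    moreover have "f p ^ 2 - (0 * fst p + 0 * snd p + a ^ 2 * fst p ^ 2
      + 2 * a * b * (fst p * snd p) + b ^ 2 * snd p ^ 2) = (f p - ?l) * (f p + ?l)"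
      by (simp add: algebra_simps power2_eq_square)
    ultimately show ?case by (simp add: norm_mult power2_eq_square power3_eq_cube mult_ac)
  qed
  then show ?thesis unfolding jet2_def by blast
qed

text \<open>Restriction to the two coordinate axes reduces to polynomials in one variable; the axes
  see every coefficient except the mixed one.\<close>

lemma jet2_unique:
  assumes "jet2 f a b c d e" "jet2 f a' b' c' d' e'"
  shows "a = a'" "b = b'" "c = c'" "e = e'"
proof -
  have "jet2 (\<lambda>p. 0) (a - a') (b - b') (c - c') (d - d') (e - e')"
    using jet2_lincomb[OF assms, of 1 "-1"] by simp
  then obtain C where C: "\<forall>\<^sub>F p in nhds 0. norm (0 - ((a - a') * fst p + (b - b') * snd p
      + (c - c') * fst p ^ 2 + (d - d') * (fst p * snd p) + (e - e') * snd p ^ 2)) \<le> C * norm p ^ 3"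
    unfolding jet2_def by blast
  have tx: "((\<lambda>t::complex. (t, 0::complex)) \<longlongrightarrow> 0) (at 0)" and ty: "((\<lambda>t::complex. (0::complex, t)) \<longlongrightarrow> 0) (at 0)"
    unfolding zero_prod_def by (intro tendsto_intros)+
  have "\<forall>i<3. coeff [:0, a - a', c - c':] i = 0"
  proof (rule poly_bigo_imp_coeff_zero)
    show "(\<lambda>t. poly [:0, a - a', c - c':] t) \<in> O[at 0](\<lambda>t. t ^ 3)"
    proof (rule landau_o.bigI)
      show "\<forall>\<^sub>F t in at 0. norm (poly [:0, a - a', c - c':] t) \<le> (\<bar>C\<bar> + 1) * norm (t ^ 3)"
        using eventually_compose_filterlim[OF C tx]
      proof eventually_elim
        case (elim t)
        have "norm (poly [:0, a - a', c - c':] t) \<le> C * norm t ^ 3"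
          using elim by (subst norm_minus_cancel[symmetric]) (simp add: algebra_simps power2_eq_square norm_Pair)
        also have "\<dots> \<le> (\<bar>C\<bar> + 1) * norm (t ^ 3)"
          unfolding norm_power by (intro mult_right_mono) auto
        finally show ?case .
      qed
    qed simp
  qed (auto simp: eventually_at_filter)
  note co = this
  show "a = a'" "c = c'"
    using co[rule_format, of 1] co[rule_format, of 2] by (simp_all add: numeral_2_eq_2)
  have "\<forall>i<3. coeff [:0, b - b', e - e':] i = 0"
  proof (rule poly_bigo_imp_coeff_zero)
    show "(\<lambda>t. poly [:0, b - b', e - e':] t) \<in> O[at 0](\<lambda>t. t ^ 3)"
    proof (rule landau_o.bigI)
      show "\<forall>\<^sub>F t in at 0. norm (poly [:0, b - b', e - e':] t) \<le> (\<bar>C\<bar> + 1) * norm (t ^ 3)"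
        using eventually_compose_filterlim[OF C ty]
      proof eventually_elim
        case (elim t)
        have "norm (poly [:0, b - b', e - e':] t) \<le> C * norm t ^ 3"
          using elim by (subst norm_minus_cancel[symmetric]) (simp add: algebra_simps power2_eq_square norm_Pair)
        also have "\<dots> \<le> (\<bar>C\<bar> + 1) * norm (t ^ 3)"
          unfolding norm_power by (intro mult_right_mono) auto
        finally show ?case .
      qed
    qed simp
  qed (auto simp: eventually_at_filter)
  note co = this
  show "b = b'" "e = e'"
    using co[rule_format, of 1] co[rule_format, of 2] by (simp_all add: numeral_2_eq_2)
qed

section \<open>Explicit exponentials of two by two matrices\<close>

lemma exp_vector_derivative:
  "((\<lambda>s. exp (c * complex_of_real s)) has_vector_derivative c * exp (c * of_real s)) (at s within {0..1})"
proof -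
  have "((\<lambda>z. exp (c * z)) has_field_derivative c * exp (c * of_real s)) (at (of_real s))"
    by (auto intro!: derivative_eq_intros)
  from has_vector_derivative_real_field[OF this] show ?thesis
    by (rule has_vector_derivative_at_within)
qed

text \<open>C is cosh(k s) and S is sinh(k s) / k with k^2 = \<delta>, continued to 1 and s when
  \<delta> = 0. If N^2 = \<delta> I, then exp(s N) = C I + S N, which covers the nilpotent case
  uniformly.\<close>

lemma cosh_sinh_like:
  fixes \<delta> :: complex
  obtains C S :: "real \<Rightarrow> complex" where "\<And>s. (C has_vector_derivative \<delta> * S s) (at s within {0..1})"
    "\<And>s. (S has_vector_derivative C s) (at s within {0..1})" "C 0 = 1" "S 0 = 0"
    "\<And>s. C s * C s - \<delta> * (S s * S s) = 1"
proof (cases "\<delta> = 0")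
  case True
  show ?thesis
    by (rule that[of "\<lambda>_. 1" "\<lambda>s. of_real s"])
      (auto simp: True intro!: derivative_eq_intros has_vector_derivative_of_real)
next
  case False
  define k where "k = csqrt \<delta>"
  have k: "k \<noteq> 0" "k * k = \<delta>" using False by (auto simp: k_def simp flip: power2_eq_square)
  show ?thesis
  proof (rule that[of "\<lambda>s. (exp (k * of_real s) + exp (- k * of_real s)) / 2"
        "\<lambda>s. (exp (k * of_real s) - exp (- k * of_real s)) / (2 * k)"])
    show "((\<lambda>s. (exp (k * of_real s) + exp (- k * of_real s)) / 2) has_vector_derivative
        \<delta> * ((exp (k * of_real s) - exp (- k * of_real s)) / (2 * k))) (at s within {0..1})" for s
      by (rule has_vector_derivative_eq_rhs[OF
            has_vector_derivative_divide[OF has_vector_derivative_add[OF exp_vector_derivative[of k s] exp_vector_derivative[of "-k" s]]]])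
        (use k(1) in \<open>simp add: field_simps flip: k(2)\<close>)
    show "((\<lambda>s. (exp (k * of_real s) - exp (- k * of_real s)) / (2 * k)) has_vector_derivative
        (exp (k * of_real s) + exp (- k * of_real s)) / 2) (at s within {0..1})" for s
      by (rule has_vector_derivative_eq_rhs[OF
            has_vector_derivative_divide[OF has_vector_derivative_diff[OF exp_vector_derivative[of k s] exp_vector_derivative[of "-k" s]]]])
        (use k(1) in \<open>simp add: field_simps\<close>)
    fix s :: real
    have "exp (k * of_real s) * exp (- k * of_real s) = 1" by (simp flip: exp_add)
    then show "(exp (k * of_real s) + exp (- k * of_real s)) / 2 * ((exp (k * of_real s) + exp (- k * of_real s)) / 2)
      - \<delta> * ((exp (k * of_real s) - exp (- k * of_real s)) / (2 * k) * ((exp (k * of_real s) - exp (- k * of_real s)) / (2 * k))) = 1"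
      using k(1) by (simp add: field_simps flip: k(2))
  qed simp_all
qed

text \<open>The two extra equations are the off-diagonal entries of M exp(M) = exp(M) M. They allow
  M to be recovered as diagonal from a diagonal exp(M) with distinct entries.\<close>

lemma fundamental_system_exists:
  fixes m11 m12 m21 m22 :: complex
  shows "\<exists>f11 f12 f21 f22 e11 e12 e21 e22.
    fundamental_system m11 m12 m21 m22 f11 f12 f21 f22 e11 e12 e21 e22
    \<and> m11 * e12 1 + m12 * e22 1 = e11 1 * m12 + e12 1 * m22
    \<and> m21 * e11 1 + m22 * e21 1 = e21 1 * m11 + e22 1 * m21"
proof -
  \<comment> \<open>\<tau> is half the trace, and the trace-free part N = M - \<tau> I has diagonal
    entries n, -n and square \<delta> I.\<close>
  define \<tau> n \<delta> where "\<tau> = (m11 + m22) / 2" and "n = (m11 - m22) / 2" and "\<delta> = n * n + m12 * m21"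
  have m: "m11 = \<tau> + n" "m22 = \<tau> - n" by (simp_all add: \<tau>_def n_def field_simps)
  obtain C S where C': "\<And>s. (C has_vector_derivative \<delta> * S s) (at s within {0..1})"
    and S': "\<And>s. (S has_vector_derivative C s) (at s within {0..1})" and 0: "C 0 = 1" "S 0 = 0"
    and det: "\<And>s. C s * C s - \<delta> * (S s * S s) = 1"
    using cosh_sinh_like[of \<delta>] by metis
  define P where "P c s = exp (c * complex_of_real s)" for c s
  have P': "(P c has_vector_derivative c * P c s) (at s within {0..1})" for c s
    unfolding P_def[abs_def] by (rule exp_vector_derivative)
  have PP: "P \<tau> s * P (-\<tau>) s = 1" for s by (simp add: P_def flip: exp_add)
  have P0: "P c 0 = 1" for c by (simp add: P_def)
  have cont: "continuous_on {0..1} C" "continuous_on {0..1} S" "continuous_on {0..1} (P c)" for c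
    unfolding continuous_on_eq_continuous_within
    using C' S' P' has_vector_derivative_continuous by blast+
  have lin: "((\<lambda>s. P (-\<tau>) s * (x * C s + y * S s)) has_vector_derivative
     (P (-\<tau>) s * (x * (\<delta> * S s) + y * C s) + (-\<tau> * P (-\<tau>) s) * (x * C s + y * S s))) (at s within {0..1})" for x y s
    by (intro has_vector_derivative_mult P' has_vector_derivative_add has_vector_derivative_mult_right C' S')
  \<comment> \<open>The factors 1 and 0 give all four entries the shape differentiated in
    \<open>lin\<close>.\<close>
  let ?f11 = "\<lambda>s. P (-\<tau>) s * (1 * C s + (-n) * S s)" and ?f12 = "\<lambda>s. P (-\<tau>) s * (0 * C s + (-m12) * S s)"
    and ?f21 = "\<lambda>s. P (-\<tau>) s * (0 * C s + (-m21) * S s)" and ?f22 = "\<lambda>s. P (-\<tau>) s * (1 * C s + n * S s)"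
  let ?e11 = "\<lambda>s. P \<tau> s * (C s + n * S s)" and ?e12 = "\<lambda>s. P \<tau> s * (m12 * S s)"
    and ?e21 = "\<lambda>s. P \<tau> s * (m21 * S s)" and ?e22 = "\<lambda>s. P \<tau> s * (C s - n * S s)"
  have "fundamental_system m11 m12 m21 m22 ?f11 ?f12 ?f21 ?f22 ?e11 ?e12 ?e21 ?e22"
  proof
    fix s :: real
    show "(?f11 has_vector_derivative - (?f11 s * m11 + ?f12 s * m21)) (at s within {0..1})"
      "(?f12 has_vector_derivative - (?f11 s * m12 + ?f12 s * m22)) (at s within {0..1})"
      "(?f21 has_vector_derivative - (?f21 s * m11 + ?f22 s * m21)) (at s within {0..1})"
      "(?f22 has_vector_derivative - (?f21 s * m12 + ?f22 s * m22)) (at s within {0..1})"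
      by (rule has_vector_derivative_eq_rhs[OF lin]; simp add: m \<delta>_def algebra_simps)+
    have e: "(P \<tau> s * u) * (P (-\<tau>) s * v) = u * v" for u v
      using PP[of s] by (metis (no_types, lifting) mult.assoc mult.left_commute mult_1)
    have d: "C s * C s = 1 + (n * n + m12 * m21) * (S s * S s)" using det[of s] by (simp add: \<delta>_def algebra_simps)
    show "?e11 s * ?f11 s + ?e12 s * ?f21 s = 1" "?e11 s * ?f12 s + ?e12 s * ?f22 s = 0"
      "?e21 s * ?f11 s + ?e22 s * ?f21 s = 0" "?e21 s * ?f12 s + ?e22 s * ?f22 s = 1"
      unfolding e by (simp_all add: algebra_simps d)
  qed (simp_all add: P0 0 | intro continuous_intros cont)+
  then show ?thesis
    by (intro exI conjI) (assumption | simp add: m algebra_simps)+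
qed

context flow_expansion
begin

text \<open>\<open>flow_row_jet\<close> yields the jets of the two rows of exp(-M) \<Phi>;
  multiplication by exp(M) gives those of \<Phi>.\<close>

lemma time_one_jet2:
  assumes "\<forall>\<^sub>F p in nhds 0. \<exists>c. flow_line X c \<and> c 0 = p \<and> c 1 = \<Phi> p"
  defines "G k \<equiv> \<lambda>g1 g2. integral {0..1} (\<lambda>s::real. g1 s * k a1 b1 c1 s + g2 s * k a2 b2 c2 s)"
  shows "jet2 (\<lambda>p. fst (\<Phi> p)) (e11 1) (e12 1) (e11 1 * G k20 f11 f12 + e12 1 * G k20 f21 f22)
      (e11 1 * G k11 f11 f12 + e12 1 * G k11 f21 f22) (e11 1 * G k02 f11 f12 + e12 1 * G k02 f21 f22)"
    "jet2 (\<lambda>p. snd (\<Phi> p)) (e21 1) (e22 1) (e21 1 * G k20 f11 f12 + e22 1 * G k20 f21 f22)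
      (e21 1 * G k11 f11 f12 + e22 1 * G k11 f21 f22) (e21 1 * G k02 f11 f12 + e22 1 * G k02 f21 f22)"
proof -
  obtain A where A: "A > 0" "\<forall>s\<in>{0..1}. norm (f11 s) \<le> A \<and> norm (f12 s) \<le> A \<and> norm (f21 s) \<le> A
   \<and> norm (f22 s) \<le> A \<and> norm (e11 s) \<le> A \<and> norm (e12 s) \<le> A \<and> norm (e21 s) \<le> A \<and> norm (e22 s) \<le> A"
    using entries_bounded by blast
  have row: "jet2 (\<lambda>p. g1 1 * fst (\<Phi> p) + g2 1 * snd (\<Phi> p)) (g1 0) (g2 0) (G k20 g1 g2) (G k11 g1 g2) (G k02 g1 g2)"
    if g: "\<And>s. (g1 has_vector_derivative - (g1 s * m11 + g2 s * m21)) (at s within {0..1})"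
      "\<And>s. (g2 has_vector_derivative - (g1 s * m12 + g2 s * m22)) (at s within {0..1})"
      "\<And>s. s \<in> {0..1} \<Longrightarrow> norm (g1 s) \<le> A" "\<And>s. s \<in> {0..1} \<Longrightarrow> norm (g2 s) \<le> A" for g1 g2
  proof -
    obtain B \<rho> where B: "\<rho> > 0" "\<And>c. flow_line X c \<Longrightarrow> norm (c 0) < \<rho> \<Longrightarrow>
      norm (g1 1 * fst (c 1) + g2 1 * snd (c 1) - (g1 0 * fst (c 0) + g2 0 * snd (c 0)
      + G k20 g1 g2 * fst (c 0) ^ 2 + G k11 g1 g2 * (fst (c 0) * snd (c 0))
      + G k02 g1 g2 * snd (c 0) ^ 2)) \<le> B * norm (c 0) ^ 3"
      using flow_row_jet[OF g] A(2) unfolding G_def by blast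
    show ?thesis
      unfolding jet2_def
    proof (rule exI[of _ B], use assms(1) eventually_norm_less_nhds_0[OF B(1)] in eventually_elim)
      case (elim p)
      then obtain c where "flow_line X c" "c 0 = p" "c 1 = \<Phi> p" by blast
      then show ?case using B(2)[of c] elim(2) by simp
    qed
  qed
  have 1: "jet2 (\<lambda>p. f11 1 * fst (\<Phi> p) + f12 1 * snd (\<Phi> p)) 1 0 (G k20 f11 f12) (G k11 f11 f12) (G k02 f11 f12)"
    using row[OF f_deriv(1,2)] A(2) by (simp add: f_0)
  have 2: "jet2 (\<lambda>p. f21 1 * fst (\<Phi> p) + f22 1 * snd (\<Phi> p)) 0 1 (G k20 f21 f22) (G k11 f21 f22) (G k02 f21 f22)"
    using row[OF f_deriv(3,4)] A(2) by (simp add: f_0)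
  have eq: "x * (f11 1 * u + f12 1 * v) + y * (f21 1 * u + f22 1 * v)
      = (x * f11 1 + y * f21 1) * u + (x * f12 1 + y * f22 1) * v" for x y u v
    by (simp add: algebra_simps)
  show "jet2 (\<lambda>p. fst (\<Phi> p)) (e11 1) (e12 1) (e11 1 * G k20 f11 f12 + e12 1 * G k20 f21 f22)
      (e11 1 * G k11 f11 f12 + e12 1 * G k11 f21 f22) (e11 1 * G k02 f11 f12 + e12 1 * G k02 f21 f22)"
    using jet2_lincomb[OF 1 2, of "e11 1" "e12 1"] unfolding eq ef by simp
  show "jet2 (\<lambda>p. snd (\<Phi> p)) (e21 1) (e22 1) (e21 1 * G k20 f11 f12 + e22 1 * G k20 f21 f22)
      (e21 1 * G k11 f11 f12 + e22 1 * G k11 f21 f22) (e21 1 * G k02 f11 f12 + e22 1 * G k02 f21 f22)"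
    using jet2_lincomb[OF 1 2, of "e21 1" "e22 1"] unfolding eq ef by simp
qed

end

section \<open>Resonances\<close>

text \<open>The conclusion uses \<open>flow_expansion_axioms\<close>, the conditions on X alone, so
  that the fundamental system can be chosen afterwards.\<close>

lemma vector_field_expansion:
  assumes "holomorphic_map2_on X U" "0 \<in> U" "X 0 = 0"
  obtains m11 m12 m21 m22 a1 b1 c1 a2 b2 c2 r C where
    "flow_expansion_axioms m11 m12 m21 m22 X a1 b1 c1 a2 b2 c2 r C"
proof -
  obtain m11 m12 a1 b1 c1 where "jet2 (\<lambda>p. fst (X p) - fst (X 0)) m11 m12 a1 b1 c1"
    using holomorphic2_on_imp_jet2[OF _ assms(2), of "\<lambda>p. fst (X p)"] assms(1)
    unfolding holomorphic_map2_on_def by blast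
  then obtain C1 where 1: "\<forall>\<^sub>F p in nhds 0. norm (fst (X p) - (m11 * fst p + m12 * snd p
      + a1 * fst p ^ 2 + b1 * (fst p * snd p) + c1 * snd p ^ 2)) \<le> C1 * norm p ^ 3"
    unfolding jet2_def by (auto simp: assms(3))
  obtain m21 m22 a2 b2 c2 where "jet2 (\<lambda>p. snd (X p) - snd (X 0)) m21 m22 a2 b2 c2"
    using holomorphic2_on_imp_jet2[OF _ assms(2), of "\<lambda>p. snd (X p)"] assms(1)
    unfolding holomorphic_map2_on_def by blast
  then obtain C2 where 2: "\<forall>\<^sub>F p in nhds 0. norm (snd (X p) - (m21 * fst p + m22 * snd p
      + a2 * fst p ^ 2 + b2 * (fst p * snd p) + c2 * snd p ^ 2)) \<le> C2 * norm p ^ 3"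
    unfolding jet2_def by (auto simp: assms(3))
  obtain d where d: "d > 0" "\<And>p. norm p < d \<Longrightarrow> norm (fst (X p) - (m11 * fst p + m12 * snd p
      + a1 * fst p ^ 2 + b1 * (fst p * snd p) + c1 * snd p ^ 2)) \<le> C1 * norm p ^ 3
     \<and> norm (snd (X p) - (m21 * fst p + m22 * snd p
      + a2 * fst p ^ 2 + b2 * (fst p * snd p) + c2 * snd p ^ 2)) \<le> C2 * norm p ^ 3"
    using eventually_conj[OF 1 2] unfolding eventually_nhds_metric dist_norm diff_0_right by blast
  have mx: "C1 * norm p ^ 3 \<le> max C1 C2 * norm p ^ 3" "C2 * norm p ^ 3 \<le> max C1 C2 * norm p ^ 3" for p :: c2
    by (intro mult_right_mono; simp)+
  show ?thesis
  proof (rule that[of m11 m12 m21 m22 a1 b1 c1 a2 b2 c2 "d / 2" "max C1 C2"], unfold_locales)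
    show "d / 2 > 0" using d by simp
    fix q :: c2 assume "norm q \<le> d / 2"
    then have "norm q < d" using d(1) by simp
    from d(2)[OF this] mx[of q]
    show "norm (fst (X q) - (m11 * fst q + m12 * snd q
        + a1 * fst q ^ 2 + b1 * (fst q * snd q) + c1 * snd q ^ 2)) \<le> max C1 C2 * norm q ^ 3"
      "norm (snd (X q) - (m21 * fst q + m22 * snd q
        + a2 * fst q ^ 2 + b2 * (fst q * snd q) + c2 * snd q ^ 2)) \<le> max C1 C2 * norm q ^ 3"
      by linarith+
  qed
qed

lemma geodesic_expansion:
  assumes "singular_vector_field X" "time_one_flow X \<Phi>"
  obtains m11 m12 m21 m22 a1 b1 c1 a2 b2 c2 r C where
    "flow_expansion_axioms m11 m12 m21 m22 X a1 b1 c1 a2 b2 c2 r C"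
    "\<forall>\<^sub>F p in nhds 0. \<exists>c. flow_line X c \<and> c 0 = p \<and> c 1 = \<Phi> p"
proof -
  have "X 0 = 0" using assms(1) by (simp add: singular_vector_field_def)
  obtain U where U: "holomorphic_map2_on X U" and ev: "\<forall>\<^sub>F p in nhds 0. \<exists>c :: real \<Rightarrow> c2.
           c 0 = p \<and> c 1 = \<Phi> p \<and>
           (\<forall>t\<in>{0..1}. c t \<in> U \<and> (c has_vector_derivative X (c t)) (at t within {0..1}))"
    using assms(2) unfolding time_one_flow_def by blast
  \<comment> \<open>The flow line through p = 0 lies in U at time 0; this is how the domain chosen
    in \<open>time_one_flow\<close> is seen to contain the origin.\<close>
  have "\<exists>c :: real \<Rightarrow> c2. c 0 = 0 \<and> c 1 = \<Phi> 0 \<and>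
           (\<forall>t\<in>{0..1}. c t \<in> U \<and> (c has_vector_derivative X (c t)) (at t within {0..1}))"
    by (rule eventually_nhds_x_imp_x[OF ev])
  then have "0 \<in> U" by (metis atLeastAtMost_iff order_refl zero_le_one)
  from vector_field_expansion[OF U this \<open>X 0 = 0\<close>] obtain m11 m12 m21 m22 a1 b1 c1 a2 b2 c2 r C where
    "flow_expansion_axioms m11 m12 m21 m22 X a1 b1 c1 a2 b2 c2 r C" .
  moreover have "\<forall>\<^sub>F p in nhds 0. \<exists>c. flow_line X c \<and> c 0 = p \<and> c 1 = \<Phi> p"
    using ev by eventually_elim (auto simp: flow_line_def)
  ultimately show ?thesis by (rule that)
qed

lemma geodesic_jet2:
  assumes "singular_vector_field X" "time_one_flow X \<Phi>"
  obtains a b c d e a' b' c' d' e' where "jet2 (\<lambda>p. fst (\<Phi> p)) a b c d e"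
    "jet2 (\<lambda>p. snd (\<Phi> p)) a' b' c' d' e'" "a * b' \<noteq> a' * b"
proof -
  obtain m11 m12 m21 m22 a1 b1 c1 a2 b2 c2 r C where
    X: "flow_expansion_axioms m11 m12 m21 m22 X a1 b1 c1 a2 b2 c2 r C"
    and ev: "\<forall>\<^sub>F p in nhds 0. \<exists>c. flow_line X c \<and> c 0 = p \<and> c 1 = \<Phi> p"
    using geodesic_expansion[OF assms] .
  obtain f11 f12 f21 f22 e11 e12 e21 e22 where
    fs: "fundamental_system m11 m12 m21 m22 f11 f12 f21 f22 e11 e12 e21 e22"
    using fundamental_system_exists by blast
  interpret flow_expansion m11 m12 m21 m22 f11 f12 f21 f22 e11 e12 e21 e22 X a1 b1 c1 a2 b2 c2 r C
    by (rule flow_expansion.intro[OF fs X])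
  have "(e11 1 * e22 1 - e21 1 * e12 1) * (f11 1 * f22 1 - f12 1 * f21 1) = 1"
  proof -
    have "(e11 1 * e22 1 - e21 1 * e12 1) * (f11 1 * f22 1 - f12 1 * f21 1)
      = (e11 1 * f11 1 + e12 1 * f21 1) * (e21 1 * f12 1 + e22 1 * f22 1)
        - (e11 1 * f12 1 + e12 1 * f22 1) * (e21 1 * f11 1 + e22 1 * f21 1)"
      by (simp add: algebra_simps)
    then show ?thesis unfolding ef by simp
  qed
  then have "e11 1 * e22 1 \<noteq> e21 1 * e12 1" by auto
  with time_one_jet2[OF ev] show ?thesis by (rule that)
qed

lemma fundamental_system_diagonal:
  "fundamental_system \<alpha> 0 0 \<beta> (\<lambda>s. exp (- \<alpha> * of_real s)) (\<lambda>_. 0) (\<lambda>_. 0) (\<lambda>s. exp (- \<beta> * of_real s))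
    (\<lambda>s. exp (\<alpha> * of_real s)) (\<lambda>_. 0) (\<lambda>_. 0) (\<lambda>s. exp (\<beta> * of_real s))"
proof
  fix s :: real
  show "((\<lambda>s. exp (- \<alpha> * complex_of_real s)) has_vector_derivative
      - (exp (- \<alpha> * of_real s) * \<alpha> + 0 * 0)) (at s within {0..1})"
    "((\<lambda>s. exp (- \<beta> * complex_of_real s)) has_vector_derivative
      - (0 * 0 + exp (- \<beta> * of_real s) * \<beta>)) (at s within {0..1})"
    by (rule has_vector_derivative_eq_rhs[OF exp_vector_derivative]; simp)+
qed (auto intro!: continuous_intros simp flip: exp_add)

text \<open>The antiderivative (k / c) exp(c s) takes equal values at both ends, the integral being
  over whole periods.\<close>

lemma integral_exp_zero:
  fixes c :: complex
  assumes "c \<noteq> 0" "exp c = 1"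
  shows "integral {0..1} (\<lambda>s. k * exp (c * of_real s)) = 0"
proof -
  have "((\<lambda>s. k * exp (c * of_real s)) has_integral
      (k / c * exp (c * of_real 1) - k / c * exp (c * of_real 0))) {0..1}"
  proof (rule fundamental_theorem_of_calculus)
    fix s :: real
    show "((\<lambda>s. k / c * exp (c * of_real s)) has_vector_derivative k * exp (c * of_real s)) (at s within {0..1})"
      by (rule has_vector_derivative_eq_rhs[OF has_vector_derivative_mult_right[OF exp_vector_derivative]])
        (use assms in simp)
  qed simp
  from integral_unique[OF this] show ?thesis using assms by simp
qed

text \<open>The monomial \<open>y\<^sup>2 \<partial>\<^sub>x\<close> in the time one map forces \<open>2\<beta> = \<alpha>\<close> for the eigenvalues of the
  vector field, and \<open>x\<^sup>2 \<partial>\<^sub>y\<close> forces \<open>2\<alpha> = \<beta>\<close>.\<close>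

lemma no_vector_field_with_resonant_jet2:
  assumes X: "singular_vector_field X" "time_one_flow X \<Phi>"
    and w: "\<omega> ^ 3 = 1" "\<omega> \<noteq> 1"
    and 1: "jet2 (\<lambda>p. fst (\<Phi> p)) \<omega> 0 c d 1"
    and 2: "jet2 (\<lambda>p. snd (\<Phi> p)) 0 (\<omega>\<^sup>2) (\<omega>\<^sup>2) d' e'"
  shows False
proof -
  have w0: "\<omega> \<noteq> 0" using w by auto
  have ww: "\<omega>\<^sup>2 \<noteq> \<omega>" using w w0 by (simp add: power2_eq_square)
  obtain m11 m12 m21 m22 a1 b1 c1 a2 b2 c2 r C where
    X: "flow_expansion_axioms m11 m12 m21 m22 X a1 b1 c1 a2 b2 c2 r C"
    and ev: "\<forall>\<^sub>F p in nhds 0. \<exists>c. flow_line X c \<and> c 0 = p \<and> c 1 = \<Phi> p"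
    using geodesic_expansion[OF X] .
  \<comment> \<open>M commutes with exp(M), whose entries are \<omega> and \<omega>^2 on the
    diagonal and 0 elsewhere. Since these two values differ, the off-diagonal entries of M
    vanish.\<close>
  have diag: "m12 = 0" "m21 = 0"
  proof -
    obtain f11 f12 f21 f22 e11 e12 e21 e22 where
      fs: "fundamental_system m11 m12 m21 m22 f11 f12 f21 f22 e11 e12 e21 e22"
      and comm: "m11 * e12 1 + m12 * e22 1 = e11 1 * m12 + e12 1 * m22"
        "m21 * e11 1 + m22 * e21 1 = e21 1 * m11 + e22 1 * m21"
      using fundamental_system_exists by blast
    interpret flow_expansion m11 m12 m21 m22 f11 f12 f21 f22 e11 e12 e21 e22 X a1 b1 c1 a2 b2 c2 r C
      by (rule flow_expansion.intro[OF fs X])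
    have "e11 1 = \<omega>" "e12 1 = 0" "e21 1 = 0" "e22 1 = \<omega>\<^sup>2"
      using jet2_unique(1,2)[OF time_one_jet2(1)[OF ev] 1] jet2_unique(1,2)[OF time_one_jet2(2)[OF ev] 2]
      by simp_all
    then show "m12 = 0" "m21 = 0" using comm ww by (auto simp: mult.commute)
  qed
  \<comment> \<open>With M diagonal, the explicit fundamental system turns each integrand into a
    single exponential.\<close>
  interpret flow_expansion m11 0 0 m22 "\<lambda>s. exp (- m11 * of_real s)" "\<lambda>_. 0" "\<lambda>_. 0"
    "\<lambda>s. exp (- m22 * of_real s)" "\<lambda>s. exp (m11 * of_real s)" "\<lambda>_. 0" "\<lambda>_. 0"
    "\<lambda>s. exp (m22 * of_real s)" X a1 b1 c1 a2 b2 c2 r C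
    by (rule flow_expansion.intro[OF fundamental_system_diagonal X[unfolded diag]])
  note J1 = jet2_unique[OF time_one_jet2(1)[OF ev] 1] and J2 = jet2_unique[OF time_one_jet2(2)[OF ev] 2]
  have e: "exp m11 = \<omega>" "exp m22 = \<omega>\<^sup>2" using J1(1) J2(2) by simp_all
  have "integral {0..1} (\<lambda>s. exp (- m11 * of_real s) * k02 a1 b1 c1 s) \<noteq> 0" using J1(4) by auto
  moreover have "exp (- m11 * of_real s) * k02 a1 b1 c1 s = c1 * exp ((2 * m22 - m11) * of_real s)" for s
    by (simp add: k02_def power2_eq_square ring_distribs exp_diff exp_minus field_simps flip: exp_add mult_2)
  ultimately have "integral {0..1} (\<lambda>s. c1 * exp ((2 * m22 - m11) * complex_of_real s)) \<noteq> 0" by simp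
  \<comment> \<open>The value is \<omega>^4 / \<omega> = \<omega>^3; in the second component it is
    \<omega>^2 / \<omega>^2.\<close>
  moreover have "exp (2 * m22 - m11) = 1"
    using w w0 by (simp add: exp_diff exp_double e flip: power_mult) (simp add: eval_nat_numeral)
  ultimately have r1: "2 * m22 - m11 = 0" using integral_exp_zero by blast
  have "integral {0..1} (\<lambda>s. exp (- m22 * of_real s) * k20 a2 b2 c2 s) \<noteq> 0" using J2(3) w0 by auto
  moreover have "exp (- m22 * of_real s) * k20 a2 b2 c2 s = a2 * exp ((2 * m11 - m22) * of_real s)" for s
    by (simp add: k20_def power2_eq_square ring_distribs exp_diff exp_minus field_simps flip: exp_add mult_2)
  ultimately have "integral {0..1} (\<lambda>s. a2 * exp ((2 * m11 - m22) * complex_of_real s)) \<noteq> 0" by simp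
  moreover have "exp (2 * m11 - m22) = 1"
    using w w0 by (simp add: exp_diff exp_double e)
  ultimately have r2: "2 * m11 - m22 = 0" using integral_exp_zero by blast
  have "m11 = 0" using r1 r2 by algebra
  then show False using e w by simp
qed

section \<open>An irreducible equation of the branch\<close>

definition branch_param :: "complex \<Rightarrow> c2" where
  "branch_param t = (t ^ 6, t ^ 7 + t ^ 10 + t ^ 11)"

text \<open>Multiplying y - y(t) by y - y(-t), where y(t) = t^7 + t^10 + t^11, separates the even
  part t^10 from the odd part. With u = t^2 and u^3 = x one has t^10 = x u^2, t^14 = x^2 u, t^18 =
  x^3, t^20 = x^3 u and t^22 = x^3 u^2; collecting gives the coefficients of 1, u and u^2.\<close>

definition branch_a :: "c2 \<Rightarrow> complex" where "branch_a p = snd p ^ 2 - 2 * fst p ^ 3"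
definition branch_b :: "c2 \<Rightarrow> complex" where "branch_b p = fst p ^ 3 - fst p ^ 2"
definition branch_c :: "c2 \<Rightarrow> complex" where "branch_c p = - 2 * (fst p * snd p) - fst p ^ 3"

text \<open>The norm of \<open>(y - t\<^sup>1\<^sup>0)\<^sup>2 - (t\<^sup>7 + t\<^sup>1\<^sup>1)\<^sup>2 = a + b u + c u\<^sup>2\<close>, where \<open>u = t\<^sup>2\<close>
  is a cube root of \<open>x\<close>.\<close>

definition branch_eq :: "c2 \<Rightarrow> complex" where
  "branch_eq p = branch_a p ^ 3 + branch_b p ^ 3 * fst p + branch_c p ^ 3 * fst p ^ 2
    - 3 * (branch_a p * branch_b p * branch_c p * fst p)"

lemma branch_quadratic:
  "branch_a (t ^ 6, y) + branch_b (t ^ 6, y) * t ^ 2 + branch_c (t ^ 6, y) * (t ^ 2) ^ 2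
    = (y - t ^ 10) ^ 2 - (t ^ 7 + t ^ 11) ^ 2"
  by (simp add: branch_a_def branch_b_def branch_c_def algebra_simps power_numeral_reduce)

text \<open>The norm is a product over the three cube roots of x. A vanishing factor picks a root v,
  a square root t of v turns that factor into a difference of squares, and its two factors belong to
  t and -t. The equivalence is global, so no neighbourhood has to be tracked.\<close>

lemma branch_eq_zero_iff: "branch_eq p = 0 \<longleftrightarrow> (\<exists>t. p = branch_param t)"
proof
  assume z: "branch_eq p = 0"
  obtain x y where p: "p = (x, y)" by (cases p)
  obtain u where u: "x = u ^ 3" using exists_complex_root[of 3 x] by auto
  define w where "w = Complex (-1/2) (sqrt 3 / 2)"
  have w: "w * w + w + 1 = 0" by (simp add: w_def complex_eq_iff)
  let ?a = "branch_a p" and ?b = "branch_b p" and ?c = "branch_c p"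
  have "?a ^ 3 + ?b ^ 3 * u ^ 3 + ?c ^ 3 * (u ^ 3) ^ 2 - 3 * (?a * ?b * ?c * u ^ 3)
      = (?a + ?b * u + ?c * u ^ 2) * (?a + ?b * (w * u) + ?c * (w * u) ^ 2) * (?a + ?b * (w * w * u) + ?c * (w * w * u) ^ 2)"
    using w by algebra
  then have "(?a + ?b * u + ?c * u ^ 2) * (?a + ?b * (w * u) + ?c * (w * u) ^ 2) * (?a + ?b * (w * w * u) + ?c * (w * w * u) ^ 2) = 0"
    using z by (simp add: branch_eq_def p u)
  moreover have "(w * u) ^ 3 = x" "(w * w * u) ^ 3 = x" using w u by algebra+
  ultimately obtain v where v: "v ^ 3 = x" "?a + ?b * v + ?c * v ^ 2 = 0" using u by auto
  obtain t where t: "v = t ^ 2" using exists_complex_root[of 2 v] by auto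
  have x: "x = t ^ 6" using v(1) t by (simp flip: power_mult)
  have "(y - t ^ 10) ^ 2 - (t ^ 7 + t ^ 11) ^ 2 = 0"
    using v(2) unfolding p x t branch_quadratic .
  then have "(y - (t ^ 7 + t ^ 10 + t ^ 11)) * (y - ((-t) ^ 7 + (-t) ^ 10 + (-t) ^ 11)) = 0"
    by (simp add: algebra_simps power2_eq_square)
  then have "p = branch_param t \<or> p = branch_param (- t)" by (simp add: branch_param_def p x)
  then show "\<exists>t. p = branch_param t" by blast
next
  assume "\<exists>t. p = branch_param t"
  then obtain t where t: "p = branch_param t" ..
  have z: "branch_a p + branch_b p * t ^ 2 + branch_c p * (t ^ 2) ^ 2 = 0"
    unfolding t branch_param_def branch_quadratic by (simp add: algebra_simps)
  have x: "fst p = (t ^ 2) ^ 3" by (simp add: t branch_param_def flip: power_mult)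
  show "branch_eq p = 0" unfolding branch_eq_def x using z by algebra
qed

lemma cdiff2_branch_eq: "cdiff2 branch_eq p"
  unfolding branch_eq_def[abs_def] branch_a_def branch_b_def branch_c_def by (intro cdiff2_intros)

lemma branch_eq_partial_y:
  "((\<lambda>y. branch_eq (x, y)) has_field_derivative
    (6 * (branch_a (x, y) ^ 2 * y) - 6 * (x ^ 3 * branch_c (x, y) ^ 2)
     - 3 * (x * branch_b (x, y) * (2 * y * branch_c (x, y) - 2 * x * branch_a (x, y))))) (at y)"
proof -
  have a: "((\<lambda>y. branch_a (x, y)) has_field_derivative 2 * y) (at y)"
    unfolding branch_a_def by (auto intro!: derivative_eq_intros)
  have c: "((\<lambda>y. branch_c (x, y)) has_field_derivative - 2 * x) (at y)"
    unfolding branch_c_def by (auto intro!: derivative_eq_intros)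
  define \<beta> where "\<beta> = x ^ 3 - x ^ 2"
  have b: "branch_b (x, z) = \<beta>" for z by (simp add: branch_b_def \<beta>_def)
  have "((\<lambda>z. branch_a (x, z) ^ 3 + \<beta> ^ 3 * x + branch_c (x, z) ^ 3 * x ^ 2
      - 3 * (branch_a (x, z) * \<beta> * branch_c (x, z) * x)) has_field_derivative
    3 * (branch_a (x, y) ^ 2 * (2 * y)) + 0 + 3 * (branch_c (x, y) ^ 2 * (- 2 * x)) * x ^ 2
      - 3 * ((2 * y * \<beta> * branch_c (x, y) + branch_a (x, y) * \<beta> * (- 2 * x)) * x)) (at y)"
    by (rule derivative_eq_intros a c refl)+ simp
  then show ?thesis
    unfolding branch_eq_def fst_conv b
    by (rule DERIV_cong) (simp add: algebra_simps power2_eq_square power3_eq_cube)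
qed

text \<open>Along the branch the partial derivative is t^35 q(t) with q(0) = 6. The order is 5 * 7:
  each of the other five conjugates y(\<zeta> t), \<zeta>^6 = 1, differs from y(t) at order
  7.\<close>

lemma branch_eq_partial_y_nonzero:
  "\<forall>\<^sub>F t in at 0. \<not> ((\<lambda>y. branch_eq (fst (branch_param t), y)) has_field_derivative 0) (at (snd (branch_param t)))"
proof -
  define Y where "Y t = 1 + t ^ 3 + t ^ 4" for t :: complex
  define A where "A t = Y t ^ 2 - 2 * t ^ 4" for t
  define B where "B t = 2 * Y t + t ^ 5" for t
  define q where "q t = 6 * (A t ^ 2 * Y t) - 6 * (t ^ 9 * B t ^ 2)
    - 3 * (t ^ 3 * (t ^ 6 - 1) * (- 2 * (Y t * B t) - 2 * A t))" for t
  have "isCont q 0" unfolding q_def A_def B_def Y_def by (intro continuous_intros)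
  moreover have "q 0 \<noteq> 0" by (simp add: q_def A_def B_def Y_def)
  ultimately have "\<forall>\<^sub>F t in at 0. q t \<noteq> 0"
    using tendsto_imp_eventually_ne isCont_def by blast
  moreover have "\<forall>\<^sub>F t in at 0. t \<noteq> (0 :: complex)" by (simp add: eventually_at_filter)
  ultimately show ?thesis
  proof eventually_elim
    case (elim t)
    have y: "snd (branch_param t) = t ^ 7 * Y t" and x: "fst (branch_param t) = t ^ 6"
      by (simp_all add: branch_param_def Y_def algebra_simps flip: power_add)
    have a: "branch_a (t ^ 6, t ^ 7 * Y t) = t ^ 14 * A t" and c: "branch_c (t ^ 6, t ^ 7 * Y t) = - (t ^ 13 * B t)"
      and b: "branch_b (t ^ 6, t ^ 7 * Y t) = t ^ 12 * (t ^ 6 - 1)"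
      by (simp_all add: branch_a_def branch_b_def branch_c_def A_def B_def algebra_simps power_numeral_reduce)
    have d: "6 * ((t ^ 14 * A) ^ 2 * (t ^ 7 * Y)) - 6 * ((t ^ 6) ^ 3 * (- (t ^ 13 * B)) ^ 2)
      - 3 * (t ^ 6 * (t ^ 12 * (t ^ 6 - 1)) * (2 * (t ^ 7 * Y) * (- (t ^ 13 * B))
      - 2 * t ^ 6 * (t ^ 14 * A))) = t ^ 35 * (6 * (A ^ 2 * Y) - 6 * (t ^ 9 * B ^ 2)
      - 3 * (t ^ 3 * (t ^ 6 - 1) * (- 2 * (Y * B) - 2 * A)))" for A B Y
      by (simp add: algebra_simps power_mult_distrib power_numeral_reduce)
    show ?case
    proof
      assume "((\<lambda>y. branch_eq (fst (branch_param t), y)) has_field_derivative 0) (at (snd (branch_param t)))"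
      from DERIV_unique[OF branch_eq_partial_y this[unfolded x y]] have "t ^ 35 * q t = 0"
        unfolding a b c d q_def .
      then show False using elim by simp
    qed
  qed
qed

text \<open>If 0 were an isolated zero, then for small x \<noteq> 0 the function 1 / h(x, y) would
  be holomorphic in y on a fixed disc and bounded on its boundary by 2 / m, where m is the minimum
  of |h(0, y)| there. The maximum principle carries the bound to y = 0, so |h(x, 0)| \<ge> m / 2,
  against h(0, 0) = 0.\<close>

lemma holomorphic2_nonisolated_zero:
  assumes h: "holomorphic2_on h U" "0 \<in> U" "h 0 = 0" and e: "e > 0"
  shows "\<exists>p. p \<noteq> 0 \<and> norm p < e \<and> h p = 0"
proof (rule ccontr)
  assume "\<not> ?thesis"
  then have nz: "h p \<noteq> 0" if "p \<noteq> 0" "norm p < e" for p using that by blast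
  obtain r B where r: "r > 0" "\<And>x y. norm x < r \<Longrightarrow> norm y < r \<Longrightarrow> cdiff2 h (x, y)"
    using polydisc_holomorphic2[OF h(1,2)] by metis
  define \<rho> where "\<rho> = min (r / 2) (e / 4)"
  have \<rho>: "\<rho> > 0" "\<rho> < r" "2 * \<rho> < e" using r e by (auto simp: \<rho>_def min_def)
  have nz': "h (x, y) \<noteq> 0" if "norm x \<le> \<rho>" "norm y \<le> \<rho>" "x \<noteq> 0 \<or> y \<noteq> 0" for x y
  proof (rule nz)
    show "(x, y) \<noteq> 0" using that(3) by (auto simp: zero_prod_def)
    show "norm (x, y) < e" using norm_Pair_le[of x y] that(1,2) \<rho> by linarith
  qed
  let ?K = "cball (0::complex) \<rho> \<times> cball (0::complex) \<rho>"
  have cont: "continuous_on ?K h"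
    using r(2) \<rho>(2) by (auto intro!: continuous_at_imp_continuous_on cdiff2_continuous)
  have "compact (sphere (0::complex) \<rho>)" "sphere (0::complex) \<rho> \<noteq> {}"
    using \<rho> by (simp_all add: sphere_eq_empty)
  moreover have "continuous_on (sphere 0 \<rho>) (\<lambda>y. norm (h (0, y)))"
    using \<rho> by (intro continuous_on_norm continuous_on_compose2[OF cont] continuous_intros) auto
  ultimately obtain y0 where y0: "y0 \<in> sphere 0 \<rho>" "\<And>y. y \<in> sphere 0 \<rho> \<Longrightarrow> norm (h (0, y0)) \<le> norm (h (0, y))"
    using continuous_attains_inf[of "sphere 0 \<rho>" "\<lambda>y. norm (h (0, y))"] by blast
  define m where "m = norm (h (0, y0))"
  have m: "m > 0" using nz'[of 0 y0] y0(1) \<rho> by (auto simp: m_def)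
  have "compact ?K" by (intro compact_Times compact_cball)
  then have "uniformly_continuous_on ?K h" using cont by (rule compact_uniformly_continuous[rotated])
  \<comment> \<open>Uniform continuity moves the lower bound on the circle from x = 0 to small x, at
    the price of half of m.\<close>
  then obtain d where d: "d > 0" "\<And>p q. p \<in> ?K \<Longrightarrow> q \<in> ?K \<Longrightarrow> dist q p < d \<Longrightarrow> dist (h q) (h p) < m / 2"
    unfolding uniformly_continuous_on_def using m by (meson half_gt_zero)
  have big: "norm (h (x, 0)) \<ge> m / 2" if x: "x \<noteq> 0" "norm x < d" "norm x \<le> \<rho>" for x
  proof -
    have low: "norm (h (x, y)) \<ge> m / 2" if y: "norm y = \<rho>" for y
    proof -
      have "dist (x, y) (0, y) < d" using x(2) by (simp add: dist_Pair_Pair dist_norm)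
      then have "dist (h (x, y)) (h (0, y)) < m / 2"
        using d(2)[of "(0, y)" "(x, y)"] x y \<rho> by simp
      moreover have "norm (h (0, y)) \<ge> m" using y0(2)[of y] y by (simp add: m_def)
      ultimately show ?thesis
        using norm_triangle_ineq2[of "h (0, y)" "h (x, y)"] by (simp add: dist_norm norm_minus_commute)
    qed
    have hol: "(\<lambda>y. 1 / h (x, y)) holomorphic_on cball 0 \<rho>"
    proof -
      have "(\<lambda>y. h (x, y)) holomorphic_on cball 0 \<rho>"
        unfolding holomorphic_on_def
      proof
        fix y :: complex assume "y \<in> cball 0 \<rho>"
        then have "cdiff2 h (x, y)" using x \<rho> by (intro r(2)) auto
        from cdiff2_curve[of h "\<lambda>_. x" y "\<lambda>y. y", OF this DERIV_const DERIV_ident]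
        show "(\<lambda>y. h (x, y)) field_differentiable at y within cball 0 \<rho>"
          by (rule field_differentiable_at_within)
      qed
      then show ?thesis using nz' x by (intro holomorphic_intros) auto
    qed
    have "norm (1 / h (x, 0)) \<le> 2 / m"
    proof (rule maximum_modulus_frontier[of "\<lambda>y. 1 / h (x, y)" "cball 0 \<rho>"])
      show "(\<lambda>y. 1 / h (x, y)) holomorphic_on interior (cball 0 \<rho>)"
        using holomorphic_on_subset[OF hol interior_subset] .
      show "continuous_on (closure (cball 0 \<rho>)) (\<lambda>y. 1 / h (x, y))"
        using holomorphic_on_imp_continuous_on[OF hol] by simp
      show "norm (1 / h (x, z)) \<le> 2 / m" if "z \<in> frontier (cball 0 \<rho>)" for z
      proof -
        have z: "norm z = \<rho>" using that \<rho> by (simp add: frontier_cball)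
        have "h (x, z) \<noteq> 0" using nz'[of x z] x z by simp
        then show ?thesis using low[OF z] m by (simp add: norm_divide field_simps)
      qed
    qed (use \<rho> in auto)
    moreover have "h (x, 0) \<noteq> 0" using nz'[of x 0] x \<rho> by simp
    ultimately show ?thesis using m by (simp add: norm_divide field_simps)
  qed
  have "((\<lambda>x. norm (h (x, 0))) \<longlongrightarrow> norm (h (0, 0))) (at 0)"
  proof (intro tendsto_norm)
    have "isCont (\<lambda>x. h (x, 0)) 0"
      using cdiff2_continuous[OF r(2)[of 0 0]] r(1)
      by (intro continuous_at_compose[of 0 "\<lambda>x. (x, 0)" h, unfolded o_def] continuous_intros) simp_all
    then show "((\<lambda>x. h (x, 0)) \<longlongrightarrow> h (0, 0)) (at 0)" by (simp add: isCont_def)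
  qed
  then have "((\<lambda>x. norm (h (x, 0))) \<longlongrightarrow> 0) (at 0)" using h(3) by (simp add: zero_prod_def)
  then have "\<forall>\<^sub>F x in at 0. norm (h (x, 0)) < m / 2" using m by (intro order_tendstoD) auto
  moreover have "\<forall>\<^sub>F x in at (0::complex). norm x < min d \<rho>"
    using eventually_norm_less_nhds_0[of "min d \<rho>"] d \<rho> by (auto simp: eventually_at_filter elim: eventually_mono)
  moreover have "\<forall>\<^sub>F x in at (0::complex). x \<noteq> 0" by (simp add: eventually_at_filter)
  ultimately have "\<forall>\<^sub>F x in at (0::complex). False"
  proof eventually_elim
    case (elim x)
    then show ?case using big[of x] by simp
  qed
  then show False by simp
qed

lemma branch_param_tendsto: "(branch_param \<longlongrightarrow> 0) (at 0)" "(branch_param \<longlongrightarrow> 0) (nhds 0)"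
proof -
  have "((\<lambda>t. (t ^ 6, t ^ 7 + t ^ 10 + t ^ 11)) \<longlongrightarrow> (0 ^ 6, 0 ^ 7 + 0 ^ 10 + 0 ^ 11)) (nhds (0::complex))"
    by (intro tendsto_intros filterlim_ident)
  then show n: "(branch_param \<longlongrightarrow> 0) (nhds 0)"
    by (simp add: branch_param_def[abs_def] zero_prod_def)
  show "(branch_param \<longlongrightarrow> 0) (at 0)"
    by (rule tendsto_mono[OF at_within_le_nhds n])
qed

text \<open>The identity theorem, applied to g composed with the parametrization.\<close>

lemma holomorphic_germ_along_branch:
  assumes g: "holomorphic_germ g" and z: "\<And>e. e > 0 \<Longrightarrow> \<exists>t. t \<noteq> 0 \<and> norm t < e \<and> g (branch_param t) = 0"
  shows "\<forall>\<^sub>F t in nhds 0. g (branch_param t) = 0"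
proof -
  obtain U where U: "0 \<in> U" "holomorphic2_on g U" using g by (auto simp: holomorphic_germ_def)
  then have "\<forall>\<^sub>F p in nhds 0. p \<in> U" by (auto simp: holomorphic2_on_def intro: eventually_nhds_in_open)
  then have "\<forall>\<^sub>F t in nhds 0. branch_param t \<in> U"
    using branch_param_tendsto(2) by (rule eventually_compose_filterlim)
  then obtain r where r: "r > 0" "\<And>t. norm t < r \<Longrightarrow> branch_param t \<in> U"
    unfolding eventually_nhds_metric by (auto simp: dist_norm)
  have hol: "(\<lambda>t. g (branch_param t)) holomorphic_on ball 0 r"
    unfolding holomorphic_on_def
  proof
    fix t :: complex assume "t \<in> ball 0 r"
    then have "cdiff2 g (t ^ 6, t ^ 7 + t ^ 10 + t ^ 11)"
      using r(2)[of t] U(2) by (auto simp: holomorphic2_on_iff branch_param_def)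
    moreover have "((\<lambda>t. t ^ 6) has_field_derivative 6 * t ^ 5) (at t)"
      "((\<lambda>t. t ^ 7 + t ^ 10 + t ^ 11) has_field_derivative 7 * t ^ 6 + 10 * t ^ 9 + 11 * t ^ 10) (at t)"
      by (auto intro!: derivative_eq_intros)
    ultimately have "(\<lambda>t. g (t ^ 6, t ^ 7 + t ^ 10 + t ^ 11)) field_differentiable at t"
      by (rule cdiff2_curve)
    then show "(\<lambda>t. g (branch_param t)) field_differentiable at t within ball 0 r"
      unfolding branch_param_def by (rule field_differentiable_at_within)
  qed
  have lim: "0 islimpt {t \<in> ball 0 r. g (branch_param t) = 0}"
    unfolding islimpt_approachable
  proof (intro allI impI)
    fix e :: real assume "e > 0"
    then obtain t where "t \<noteq> 0" "norm t < min e r" "g (branch_param t) = 0"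
      using z[of "min e r"] r(1) by auto
    then show "\<exists>t\<in>{t \<in> ball 0 r. g (branch_param t) = 0}. t \<noteq> 0 \<and> dist t 0 < e"
      by (intro bexI[of _ t]) auto
  qed
  have "g (branch_param t) = 0" if "norm t < r" for t
    by (rule analytic_continuation[OF hol open_ball connected_ball _ _ lim]) (use that r(1) in auto)
  with eventually_norm_less_nhds_0[OF r(1), where 'a = complex] show ?thesis
    by (auto elim: eventually_mono)
qed

lemma irreducible_branch_eq: "irreducible_germ branch_eq"
  unfolding irreducible_germ_def
proof (intro conjI allI impI)
  show "holomorphic_germ branch_eq"
    unfolding holomorphic_germ_def holomorphic2_on_iff by (rule exI[of _ UNIV]) (simp add: cdiff2_branch_eq)
  show "branch_eq 0 = 0"
    by (simp add: branch_eq_def branch_a_def)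
  show "\<not> (\<forall>\<^sub>F p in nhds 0. branch_eq p = 0)"
  proof
    \<comment> \<open>On the axis x = 0 the equation reduces to y^6.\<close>
    assume "\<forall>\<^sub>F p in nhds 0. branch_eq p = 0"
    moreover have "((\<lambda>y::complex. (0::complex, y)) \<longlongrightarrow> 0) (at 0)"
      unfolding zero_prod_def by (intro tendsto_intros)
    ultimately have "\<forall>\<^sub>F y in at 0. branch_eq (0, y) = 0" by (rule eventually_compose_filterlim)
    moreover have "\<forall>\<^sub>F y in at (0::complex). y \<noteq> 0" by (simp add: eventually_at_filter)
    ultimately have "\<forall>\<^sub>F y in at (0::complex). False"
      by eventually_elim (simp add: branch_eq_def branch_a_def)
    then show False by simp
  qed
next
  fix g h :: "c2 \<Rightarrow> complex"
  assume gh: "holomorphic_germ g \<and> holomorphic_germ h \<and> (\<forall>\<^sub>F p in nhds 0. branch_eq p = g p * h p)"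
  then have fgh: "\<forall>\<^sub>F p in nhds 0. branch_eq p = g p * h p" by blast
  obtain d where d: "d > 0" "\<And>p. norm p < d \<Longrightarrow> branch_eq p = g p * h p"
    using fgh unfolding eventually_nhds_metric dist_norm diff_0_right by blast
  have along: "\<forall>\<^sub>F t in nhds 0. k (branch_param t) = 0"
    if k: "holomorphic_germ k" "k 0 = 0" "\<And>p. norm p < d \<Longrightarrow> k p = 0 \<Longrightarrow> branch_eq p = 0" for k
  proof (rule holomorphic_germ_along_branch[OF k(1)])
    fix e :: real assume e: "e > 0"
    obtain U where U: "holomorphic2_on k U" "0 \<in> U" using k(1) by (auto simp: holomorphic_germ_def)
    \<comment> \<open>The first coordinate of the branch is t^6, so a point of norm below e^6 has a
      parameter of norm below e.\<close>
    obtain p where p: "p \<noteq> 0" "norm p < min d (e ^ 6)" "k p = 0"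
      using holomorphic2_nonisolated_zero[OF U k(2), of "min d (e ^ 6)"] e d(1) by auto
    then obtain t where t: "p = branch_param t" using k(3)[of p] branch_eq_zero_iff by auto
    have "norm t ^ 6 < e ^ 6"
      using norm_fst_le_norm[of p] p(2) by (simp add: t branch_param_def norm_power)
    then have "norm t < e" by (rule power_less_imp_less_base) (use e in simp)
    moreover have "t \<noteq> 0" using p(1) by (auto simp: t branch_param_def zero_prod_def)
    ultimately show "\<exists>t. t \<noteq> 0 \<and> norm t < e \<and> k (branch_param t) = 0" using p(3) t by blast
  qed
  show "g 0 \<noteq> 0 \<or> h 0 \<noteq> 0"
  proof (rule ccontr)
    assume "\<not> ?thesis"
    then have "\<forall>\<^sub>F t in nhds 0. g (branch_param t) = 0" "\<forall>\<^sub>F t in nhds 0. h (branch_param t) = 0"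
      using gh d(2) by (auto intro!: along)
    moreover obtain U V where UV: "0 \<in> U" "holomorphic2_on g U" "0 \<in> V" "holomorphic2_on h V"
      using gh by (auto simp: holomorphic_germ_def)
    have "\<forall>\<^sub>F p in nhds 0. p \<in> U \<inter> V \<inter> ball 0 d"
      using UV d(1) by (intro eventually_nhds_in_open) (auto simp: holomorphic2_on_def)
    then have "\<forall>\<^sub>F t in nhds 0. branch_param t \<in> U \<inter> V \<inter> ball 0 d"
      using branch_param_tendsto(2) by (rule eventually_compose_filterlim)
    ultimately have "\<forall>\<^sub>F t in nhds 0. g (branch_param t) = 0 \<and> h (branch_param t) = 0
        \<and> branch_param t \<in> U \<inter> V \<inter> ball 0 d"
      by eventually_elim blast
    then have "\<forall>\<^sub>F t in at 0. g (branch_param t) = 0 \<and> h (branch_param t) = 0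
        \<and> branch_param t \<in> U \<inter> V \<inter> ball 0 d"
      unfolding eventually_at_filter by (rule eventually_mono) simp
    with branch_eq_partial_y_nonzero have "\<forall>\<^sub>F t in at (0::complex). False"
    proof eventually_elim
      case (elim t)
      obtain x y where p: "branch_param t = (x, y)" by (cases "branch_param t")
      have xy: "(x, y) \<in> U" "(x, y) \<in> V" "norm (x, y) < d" "g (x, y) = 0" "h (x, y) = 0"
        using elim(2) by (simp_all add: p)
      have "(\<lambda>y. k (x, y)) field_differentiable at y" if "holomorphic2_on k W" "(x, y) \<in> W" for k W
        using cdiff2_curve[of k "\<lambda>_. x" y "\<lambda>y. y", OF _ DERIV_const DERIV_ident] that
        by (auto simp: holomorphic2_on_iff)
      then obtain g' h' where gh': "((\<lambda>y. g (x, y)) has_field_derivative g') (at y)"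
        "((\<lambda>y. h (x, y)) has_field_derivative h') (at y)"
        using UV xy unfolding field_differentiable_def by metis
      from DERIV_mult[OF this] have d0: "((\<lambda>y. g (x, y) * h (x, y)) has_field_derivative 0) (at y)"
        using xy by simp
      have ev: "\<forall>\<^sub>F z in nhds y. g (x, z) * h (x, z) = branch_eq (x, z)"
      proof -
        have "\<forall>\<^sub>F q in nhds (x, y). q \<in> ball 0 d"
          using xy by (intro eventually_nhds_in_open) auto
        moreover have "((\<lambda>z. (x, z)) \<longlongrightarrow> (x, y)) (nhds y)" by (intro tendsto_intros filterlim_ident)
        ultimately have "\<forall>\<^sub>F z in nhds y. (x, z) \<in> ball 0 d" by (rule eventually_compose_filterlim)
        then show ?thesis by eventually_elim (simp add: d(2))
      qed
      have "((\<lambda>y. branch_eq (x, y)) has_field_derivative 0) (at y)"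
        by (rule DERIV_cong_ev[OF refl ev refl, THEN iffD1, OF d0])
      then show False using elim(1) by (simp add: p)
    qed
    then show False by simp
  qed
qed

section \<open>The analytic class\<close>

text \<open>Global inverses on the whole plane, so that compositions need no shrinking of domains;
  the polynomial automorphisms used here are of this kind.\<close>

definition mutually_inverse_holomorphic :: "(c2 \<Rightarrow> c2) \<Rightarrow> (c2 \<Rightarrow> c2) \<Rightarrow> bool" where
  "mutually_inverse_holomorphic \<phi> \<psi> \<longleftrightarrow> \<phi> 0 = 0 \<and> (\<forall>p. \<psi> (\<phi> p) = p) \<and> (\<forall>p. \<phi> (\<psi> p) = p) \<and>
    (\<forall>p. cdiff2 (\<lambda>p. fst (\<phi> p)) p \<and> cdiff2 (\<lambda>p. snd (\<phi> p)) p) \<and>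
    (\<forall>p. cdiff2 (\<lambda>p. fst (\<psi> p)) p \<and> cdiff2 (\<lambda>p. snd (\<psi> p)) p)"

lemma mutually_inverse_holomorphic_sym:
  assumes "mutually_inverse_holomorphic \<phi> \<psi>"
  shows "mutually_inverse_holomorphic \<psi> \<phi>"
proof -
  have "\<psi> 0 = 0" using assms unfolding mutually_inverse_holomorphic_def by metis
  then show ?thesis using assms unfolding mutually_inverse_holomorphic_def by blast
qed

lemma mutually_inverse_holomorphic_continuous:
  assumes "mutually_inverse_holomorphic \<phi> \<psi>"
  shows "continuous_on UNIV \<phi>" "(\<phi> \<longlongrightarrow> 0) (nhds 0)"
proof -
  have c: "isCont (\<lambda>q. (fst (\<phi> q), snd (\<phi> q))) p" for p
    using assms unfolding mutually_inverse_holomorphic_def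
    by (intro continuous_Pair cdiff2_continuous) blast+
  then show cont: "continuous_on UNIV \<phi>" by (simp add: continuous_at_imp_continuous_on)
  have "(\<phi> \<longlongrightarrow> \<phi> 0) (at 0)" using c[of 0] by (simp add: isCont_def)
  then have "(\<phi> \<longlongrightarrow> \<phi> 0) (nhds 0)" by (simp add: tendsto_at_iff_tendsto_nhds)
  then show "(\<phi> \<longlongrightarrow> 0) (nhds 0)" using assms by (simp add: mutually_inverse_holomorphic_def)
qed

lemma holomorphic_germ_compose:
  assumes "mutually_inverse_holomorphic \<phi> \<psi>" "holomorphic_germ f"
  shows "holomorphic_germ (\<lambda>p. f (\<phi> p))"
proof -
  obtain U where U: "0 \<in> U" "open U" "\<And>p. p \<in> U \<Longrightarrow> cdiff2 f p"
    using assms(2) by (auto simp: holomorphic_germ_def holomorphic2_on_iff)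
  have "open (\<phi> -` U)"
    using open_vimage[OF U(2)] mutually_inverse_holomorphic_continuous(1)[OF assms(1)] by blast
  moreover have "0 \<in> \<phi> -` U" using assms(1) U(1) by (simp add: mutually_inverse_holomorphic_def)
  moreover have "cdiff2 (\<lambda>p. f (\<phi> p)) p" if "p \<in> \<phi> -` U" for p
    using assms(1) U(3)[of "\<phi> p"] that cdiff2_compose[of f \<phi> p]
    unfolding mutually_inverse_holomorphic_def by blast
  ultimately show ?thesis unfolding holomorphic_germ_def holomorphic2_on_iff by blast
qed

lemma irreducible_germ_compose:
  assumes \<phi>: "mutually_inverse_holomorphic \<phi> \<psi>" and f: "irreducible_germ f"
  shows "irreducible_germ (\<lambda>p. f (\<psi> p))"
  unfolding irreducible_germ_def
proof (intro conjI allI impI)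
  note \<psi> = mutually_inverse_holomorphic_sym[OF \<phi>]
  have inv: "\<psi> (\<phi> p) = p" "\<phi> 0 = 0" "\<psi> 0 = 0" for p
    using \<phi> \<psi> unfolding mutually_inverse_holomorphic_def by blast+
  show "holomorphic_germ (\<lambda>p. f (\<psi> p))"
    using holomorphic_germ_compose[OF \<psi>] f by (simp add: irreducible_germ_def)
  show "f (\<psi> 0) = 0" using f by (simp add: inv irreducible_germ_def)
  show "\<not> (\<forall>\<^sub>F p in nhds 0. f (\<psi> p) = 0)"
  proof
    assume "\<forall>\<^sub>F p in nhds 0. f (\<psi> p) = 0"
    from eventually_compose_filterlim[OF this mutually_inverse_holomorphic_continuous(2)[OF \<phi>]]
    show False using f by (simp add: inv irreducible_germ_def)
  qed
  fix g h assume gh: "holomorphic_germ g \<and> holomorphic_germ h \<and> (\<forall>\<^sub>F p in nhds 0. f (\<psi> p) = g p * h p)"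
  then have "\<forall>\<^sub>F p in nhds 0. f (\<psi> p) = g p * h p" by blast
  from eventually_compose_filterlim[OF this mutually_inverse_holomorphic_continuous(2)[OF \<phi>]]
  have "\<forall>\<^sub>F p in nhds 0. f p = g (\<phi> p) * h (\<phi> p)" by (simp add: inv)
  then have "g (\<phi> 0) \<noteq> 0 \<or> h (\<phi> 0) \<noteq> 0"
    using f gh holomorphic_germ_compose[OF \<phi>] unfolding irreducible_germ_def by blast
  then show "g 0 \<noteq> 0 \<or> h 0 \<noteq> 0" by (simp add: inv)
qed

lemma analytic_class_image:
  assumes \<phi>: "mutually_inverse_holomorphic \<phi> \<psi>"
    and \<Gamma>: "same_germ \<Gamma> {p. f p = 0}" and f: "irreducible_germ f"
  shows "\<phi> ` \<Gamma> \<in> analytic_class \<Gamma>"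
proof -
  note \<psi> = mutually_inverse_holomorphic_sym[OF \<phi>]
  have inv: "\<psi> (\<phi> p) = p" "\<phi> (\<psi> p) = p" "\<phi> 0 = 0" "\<psi> 0 = 0" for p
    using \<phi> \<psi> unfolding mutually_inverse_holomorphic_def by blast+
  have mem: "p \<in> \<phi> ` A \<longleftrightarrow> \<psi> p \<in> A" for p A
    using image_eqI[of p \<phi> "\<psi> p" A] inv(1,2) by auto
  have \<psi>lim: "(\<psi> \<longlongrightarrow> 0) (nhds 0)" by (rule mutually_inverse_holomorphic_continuous(2)[OF \<psi>])
  have "\<forall>\<^sub>F p in nhds 0. p \<in> \<Gamma> \<longleftrightarrow> f p = 0" using \<Gamma> by (simp add: same_germ_def)
  from eventually_compose_filterlim[OF this \<psi>lim]
  have "same_germ (\<phi> ` \<Gamma>) {p. f (\<psi> p) = 0}" by (simp add: same_germ_def mem)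
  then have "plane_branch (\<phi> ` \<Gamma>)"
    unfolding plane_branch_def using irreducible_germ_compose[OF \<phi> f] by blast
  moreover have "biholomorphic_germ \<phi>"
    unfolding biholomorphic_germ_def
  proof (intro conjI exI[of _ UNIV] exI[of _ \<psi>])
    show "range \<phi> = UNIV" using inv(2) by (metis surjI)
  qed (use \<phi> in \<open>auto simp: mutually_inverse_holomorphic_def holomorphic_map2_on_def holomorphic2_on_iff\<close>)
  moreover have "germ_image \<phi> \<Gamma> (\<phi> ` \<Gamma>)"
    unfolding germ_image_def
  proof (intro exI[of _ UNIV] conjI allI impI)
    fix W :: "c2 set" assume W: "open W \<and> 0 \<in> W \<and> W \<subseteq> UNIV"
    then have "\<forall>\<^sub>F p in nhds 0. p \<in> W" by (auto intro: eventually_nhds_in_open)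
    from eventually_compose_filterlim[OF this \<psi>lim]
    show "same_germ (\<phi> ` (\<Gamma> \<inter> W)) (\<phi> ` \<Gamma>)"
      unfolding same_germ_def mem by (auto elim: eventually_mono)
  qed auto
  ultimately show ?thesis by (auto simp: analytic_class_def analytically_conjugated_def)
qed

text \<open>The zero set of the equation is the image of all parameters; |x| = |t|^6 confines the
  parameters of points near the origin to the given disc.\<close>

lemma branch_same_germ:
  assumes "parametrized_by \<Gamma> branch_param"
  shows "same_germ \<Gamma> {p. branch_eq p = 0}"
proof -
  obtain r where r: "r > 0" "same_germ \<Gamma> (branch_param ` ball 0 r)"
    using assms unfolding parametrized_by_def by blast
  have "\<forall>\<^sub>F p in nhds (0::c2). norm p < r ^ 6" using r(1) by (intro eventually_norm_less_nhds_0) simp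
  with r(2)[unfolded same_germ_def] have "\<forall>\<^sub>F p in nhds 0. p \<in> \<Gamma> \<longleftrightarrow> branch_eq p = 0"
  proof eventually_elim
    case (elim p)
    have "p \<in> branch_param ` ball 0 r" if p: "p = branch_param t" for t
    proof -
      have "norm t ^ 6 < r ^ 6"
        using norm_fst_le_norm[of p] elim(2) by (simp add: p branch_param_def norm_power)
      then have "norm t < r" by (rule power_less_imp_less_base) (use r(1) in simp)
      then show ?thesis using p by auto
    qed
    then show ?case using elim(1) branch_eq_zero_iff by auto
  qed
  then show ?thesis by (simp add: same_germ_def)
qed

section \<open>Maps that preserve the branch\<close>

lemma jet2_along_branch:
  assumes "jet2 g a b c d e" and t: "t \<longlonglongrightarrow> 0"
  shows "(\<lambda>n. g (branch_param (t n)) - (a * t n ^ 6 + b * (t n ^ 7 + t n ^ 10 + t n ^ 11) + c * t n ^ 12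
    + d * (t n ^ 13 + t n ^ 16 + t n ^ 17) + e * (t n ^ 14 + 2 * t n ^ 17))) \<in> O(\<lambda>n. t n ^ 18)"
proof -
  obtain C where C: "\<forall>\<^sub>F p in nhds 0. norm (g p - (a * fst p + b * snd p + c * fst p ^ 2
      + d * (fst p * snd p) + e * snd p ^ 2)) \<le> C * norm p ^ 3"
    using assms(1) unfolding jet2_def by blast
  have lim: "((\<lambda>n. branch_param (t n)) \<longlongrightarrow> 0) sequentially"
    by (rule filterlim_compose[OF branch_param_tendsto(2) t])
  have small: "\<forall>\<^sub>F n in sequentially. norm (t n) < 1"
    using order_tendstoD(2)[OF tendsto_norm[OF t], of 1] by simp
  \<comment> \<open>One unit for each of the four monomials; hence the cubic remainder has order 18,
    with the factor 64 = 4^3.\<close>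
  have pn: "norm (branch_param u) \<le> 4 * norm u ^ 6" if u: "norm u < 1" for u
  proof -
    have "norm (u ^ k) \<le> norm u ^ 6" if "k \<ge> 6" for k
      unfolding norm_power using that u by (intro power_decreasing) auto
    then have k: "norm (u ^ 6) \<le> norm u ^ 6" "norm (u ^ 7) \<le> norm u ^ 6" "norm (u ^ 10) \<le> norm u ^ 6" "norm (u ^ 11) \<le> norm u ^ 6"
      by simp_all
    have "norm (u ^ 7 + u ^ 10 + u ^ 11) \<le> norm (u ^ 7) + norm (u ^ 10) + norm (u ^ 11)"
      by (intro order_trans[OF norm_triangle_ineq] add_mono norm_triangle_ineq order_refl)
    then show ?thesis
      using norm_Pair_le[of "u ^ 6" "u ^ 7 + u ^ 10 + u ^ 11"] k unfolding branch_param_def by linarith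
  qed
  have "(\<lambda>n. g (branch_param (t n)) - (a * fst (branch_param (t n)) + b * snd (branch_param (t n))
      + c * fst (branch_param (t n)) ^ 2 + d * (fst (branch_param (t n)) * snd (branch_param (t n)))
      + e * snd (branch_param (t n)) ^ 2)) \<in> O(\<lambda>n. t n ^ 18)"
  proof (rule landau_o.bigI)
    show "\<forall>\<^sub>F n in sequentially. norm (g (branch_param (t n)) - (a * fst (branch_param (t n)) + b * snd (branch_param (t n))
      + c * fst (branch_param (t n)) ^ 2 + d * (fst (branch_param (t n)) * snd (branch_param (t n)))
      + e * snd (branch_param (t n)) ^ 2)) \<le> ((\<bar>C\<bar> + 1) * 64) * norm (t n ^ 18)"
      using small eventually_compose_filterlim[OF C lim]
    proof eventually_elim
      case (elim n)
      have "C * norm (branch_param (t n)) ^ 3 \<le> (\<bar>C\<bar> + 1) * (4 * norm (t n) ^ 6) ^ 3"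
        using pn[OF elim(1)] by (intro mult_mono power_mono) auto
      also have "\<dots> = ((\<bar>C\<bar> + 1) * 64) * norm (t n ^ 18)"
        by (simp add: power_mult_distrib norm_power flip: power_mult)
      finally show ?case using elim(2) by linarith
    qed
  qed simp
  \<comment> \<open>The tail of y^2 beyond t^14 + 2 t^17, which is moved into the error
    term.\<close>
  moreover have "(\<lambda>n. e * (2 + t n ^ 2 + 2 * t n ^ 3 + t n ^ 4) * t n ^ 18) \<in> O(\<lambda>n. t n ^ 18)"
    by (intro bigo_bounded_mult[OF tendsto_imp_bigo_1[where l = "e * (2 + 0 ^ 2 + 2 * 0 ^ 3 + 0 ^ 4)"]]
        landau_o.big_refl tendsto_intros t)
  ultimately have res: "(\<lambda>n. g (branch_param (t n)) - (a * fst (branch_param (t n)) + b * snd (branch_param (t n))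
      + c * fst (branch_param (t n)) ^ 2 + d * (fst (branch_param (t n)) * snd (branch_param (t n)))
      + e * snd (branch_param (t n)) ^ 2) + e * (2 + t n ^ 2 + 2 * t n ^ 3 + t n ^ 4) * t n ^ 18)
      \<in> O(\<lambda>n. t n ^ 18)" by (rule sum_in_bigo(1))
  have eq: "z - (a * fst (branch_param u) + b * snd (branch_param u)
      + c * fst (branch_param u) ^ 2 + d * (fst (branch_param u) * snd (branch_param u))
      + e * snd (branch_param u) ^ 2) + e * (2 + u ^ 2 + 2 * u ^ 3 + u ^ 4) * u ^ 18
    = z - (a * u ^ 6 + b * (u ^ 7 + u ^ 10 + u ^ 11) + c * u ^ 12
    + d * (u ^ 13 + u ^ 16 + u ^ 17) + e * (u ^ 14 + 2 * u ^ 17))" for z u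
    unfolding branch_param_def fst_conv snd_conv
    by (simp add: algebra_simps power_numeral_reduce)
  show ?thesis using res unfolding eq .
qed

lemma branch_stabilizer_jet2:
  assumes 1: "jet2 (\<lambda>p. fst (G p)) a b c d e" and 2: "jet2 (\<lambda>p. snd (G p)) a' b' c' d' e'"
    and det: "a * b' \<noteq> a' * b"
    and G: "\<forall>\<^sub>F t in at 0. \<exists>\<tau>. G (branch_param t) = branch_param \<tau>"
  shows "a = 1 \<and> b = 0 \<and> c = 0 \<and> d = 0 \<and> e = 0
    \<and> a' = 0 \<and> b' = 1 \<and> c' = 0 \<and> d' = 0 \<and> e' = 0"
proof -
  obtain r where r: "r > 0" "\<And>t. t \<noteq> 0 \<Longrightarrow> norm t < r \<Longrightarrow> \<exists>\<tau>. G (branch_param t) = branch_param \<tau>"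
    using G unfolding eventually_at by (auto simp: dist_norm)
  define t where "t n = complex_of_real (r / real (n + 2))" for n
  have t0: "t n \<noteq> 0" and tr: "norm (t n) < r" for n
    using r(1) by (auto simp: t_def norm_divide divide_simps simp del: of_real_divide)
  have "(\<lambda>n. r / real (n + 2)) \<longlonglongrightarrow> 0" by real_asymp
  then have "(\<lambda>n. complex_of_real (r / real (n + 2))) \<longlonglongrightarrow> of_real 0" by (rule tendsto_of_real)
  then have t: "t \<longlonglongrightarrow> 0" unfolding t_def[abs_def] of_real_0 .
  obtain \<tau> where \<tau>: "\<And>n. G (branch_param (t n)) = branch_param (\<tau> n)"
    using r(2)[OF t0 tr] by metis
  have \<tau>': "fst (G (branch_param (t n))) = \<tau> n ^ 6"
    "snd (G (branch_param (t n))) = \<tau> n ^ 7 + \<tau> n ^ 10 + \<tau> n ^ 11" for n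
    unfolding \<tau> by (simp_all add: branch_param_def)
  have X: "(\<lambda>n. \<tau> n ^ 6 - (a * t n ^ 6 + b * (t n ^ 7 + t n ^ 10 + t n ^ 11) + c * t n ^ 12
    + d * (t n ^ 13 + t n ^ 16 + t n ^ 17) + e * (t n ^ 14 + 2 * t n ^ 17))) \<in> O(\<lambda>n. t n ^ 18)"
    using jet2_along_branch[OF 1 t] unfolding \<tau>' .
  have Y: "(\<lambda>n. \<tau> n ^ 7 + \<tau> n ^ 10 + \<tau> n ^ 11 - (a' * t n ^ 6 + b' * (t n ^ 7 + t n ^ 10 + t n ^ 11) + c' * t n ^ 12
    + d' * (t n ^ 13 + t n ^ 16 + t n ^ 17) + e' * (t n ^ 14 + 2 * t n ^ 17))) \<in> O(\<lambda>n. t n ^ 18)"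
    using jet2_along_branch[OF 2 t] unfolding \<tau>' .
  \<comment> \<open>The first coordinate will be divided by t^6 instead of t^7, so its terms in t^17
    reach order 11 and are moved into the error.\<close>
  have "(\<lambda>n. \<tau> n ^ 6 - (a * t n ^ 6 + b * (t n ^ 7 + t n ^ 10 + t n ^ 11) + c * t n ^ 12
    + d * (t n ^ 13 + t n ^ 16 + t n ^ 17) + e * (t n ^ 14 + 2 * t n ^ 17)) + (d + 2 * e) * t n ^ 17)
      \<in> O(\<lambda>n. t n ^ 17)"
  proof (rule sum_in_bigo(1))
    show "(\<lambda>n. (d + 2 * e) * t n ^ 17) \<in> O(\<lambda>n. t n ^ 17)" by simp
  qed (rule landau_o.big_trans[OF X bigo_power_le[OF t]], simp)
  then have X': "(\<lambda>n. \<tau> n ^ 6 - (a * t n ^ 6 + b * (t n ^ 7 + t n ^ 10 + t n ^ 11) + c * t n ^ 12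
        + d * (t n ^ 13 + t n ^ 16) + e * t n ^ 14)) \<in> O(\<lambda>n. t n ^ 17)"
  proof (rule back_subst[of "\<lambda>f. f \<in> O(\<lambda>n. t n ^ 17)"])
    have "x - (a * u ^ 6 + b * (u ^ 7 + u ^ 10 + u ^ 11) + c * u ^ 12
    + d * (u ^ 13 + u ^ 16 + u ^ 17) + e * (u ^ 14 + 2 * u ^ 17)) + (d + 2 * e) * u ^ 17
    = x - (a * u ^ 6 + b * (u ^ 7 + u ^ 10 + u ^ 11) + c * u ^ 12
        + d * (u ^ 13 + u ^ 16) + e * u ^ 14)" for x u
      by (simp add: algebra_simps)
    then show "(\<lambda>n. \<tau> n ^ 6 - (a * t n ^ 6 + b * (t n ^ 7 + t n ^ 10 + t n ^ 11) + c * t n ^ 12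
    + d * (t n ^ 13 + t n ^ 16 + t n ^ 17) + e * (t n ^ 14 + 2 * t n ^ 17)) + (d + 2 * e) * t n ^ 17)
      = (\<lambda>n. \<tau> n ^ 6 - (a * t n ^ 6 + b * (t n ^ 7 + t n ^ 10 + t n ^ 11) + c * t n ^ 12
        + d * (t n ^ 13 + t n ^ 16) + e * t n ^ 14))" by (rule ext)
  qed
  show ?thesis by (rule branch_rigid_seq[OF t t0 X' Y det])
qed

lemma jet2_tendsto_0:
  assumes "jet2 f a b c d e"
  shows "(f \<longlongrightarrow> 0) (nhds 0)"
proof -
  obtain C where C: "C \<ge> 0" "\<forall>\<^sub>F p in nhds 0. norm (f p - (a * fst p + b * snd p)) \<le> C * norm p ^ 2"
    using jet2_linear_bound[OF assms] by blast
  have l1: "((\<lambda>p::c2. C * norm p ^ 2) \<longlongrightarrow> C * norm (0::c2) ^ 2) (nhds 0)"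
    by (intro tendsto_intros filterlim_ident)
  have "((\<lambda>p. f p - (a * fst p + b * snd p)) \<longlongrightarrow> 0) (nhds 0)"
    by (rule Lim_null_comparison[OF C(2)]) (use l1 in simp)
  moreover have "((\<lambda>p::c2. a * fst p + b * snd p) \<longlongrightarrow> a * fst (0::c2) + b * snd (0::c2)) (nhds 0)"
    by (intro tendsto_intros filterlim_ident)
  ultimately have "((\<lambda>p. f p - (a * fst p + b * snd p) + (a * fst p + b * snd p))
      \<longlongrightarrow> 0 + (a * fst (0::c2) + b * snd (0::c2))) (nhds 0)"
    by (rule tendsto_add)
  then show ?thesis by simp
qed

text \<open>The shears \<open>x \<mapsto> x + y\<^sup>2\<close> and \<open>y \<mapsto> y + x\<^sup>2\<close> after \<open>diag(\<omega>, \<omega>\<^sup>2)\<close>; when \<open>\<omega>\<^sup>3 = 1\<close> both quadratic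
  monomials are resonant.\<close>

definition resonant_map :: "complex \<Rightarrow> c2 \<Rightarrow> c2" where
  "resonant_map \<omega> p = (\<omega> * fst p + snd p ^ 2, \<omega> ^ 2 * snd p + (\<omega> * fst p + snd p ^ 2) ^ 2)"

definition resonant_map_inv :: "complex \<Rightarrow> c2 \<Rightarrow> c2" where
  "resonant_map_inv \<omega> p = (\<omega> ^ 2 * (fst p - (\<omega> * (snd p - fst p ^ 2)) ^ 2), \<omega> * (snd p - fst p ^ 2))"

lemma resonant_map_inverse:
  assumes "\<omega> ^ 3 = 1"
  shows "mutually_inverse_holomorphic (resonant_map \<omega>) (resonant_map_inv \<omega>)"
proof -
  have w: "\<omega> * (\<omega> * (\<omega> * z)) = z" for z using assms by (simp add: power3_eq_cube flip: mult.assoc)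
  have "resonant_map_inv \<omega> (resonant_map \<omega> p) = p" for p
    by (cases p) (simp add: resonant_map_def resonant_map_inv_def power2_eq_square w mult.assoc)
  moreover have "resonant_map \<omega> (resonant_map_inv \<omega> p) = p" for p
    by (cases p) (simp add: resonant_map_def resonant_map_inv_def power2_eq_square w mult.assoc)
  moreover have "cdiff2 (\<lambda>p. fst (resonant_map \<omega> p)) p" "cdiff2 (\<lambda>p. snd (resonant_map \<omega> p)) p"
    "cdiff2 (\<lambda>p. fst (resonant_map_inv \<omega> p)) p" "cdiff2 (\<lambda>p. snd (resonant_map_inv \<omega> p)) p" for p
    unfolding resonant_map_def resonant_map_inv_def fst_conv snd_conv by (intro cdiff2_intros)+
  ultimately show ?thesis
    by (simp add: mutually_inverse_holomorphic_def) (simp add: resonant_map_def zero_prod_def)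
qed

text \<open>Points of the branch near 0 go under \<Phi> into the image of \<Gamma> under \<phi>, and
  \<psi> brings them back to \<Gamma>. The limit of \<Phi> keeps all these points where the germ
  representatives agree.\<close>

lemma connected_imp_param_image:
  assumes \<Gamma>: "same_germ \<Gamma> {p. branch_eq p = 0}" and \<phi>: "mutually_inverse_holomorphic \<phi> \<psi>"
    and im: "germ_image \<Phi> \<Gamma> (\<phi> ` \<Gamma>)" and lim: "(\<Phi> \<longlongrightarrow> 0) (nhds 0)"
  shows "\<forall>\<^sub>F t in at 0. \<exists>\<tau>. \<psi> (\<Phi> (branch_param t)) = branch_param \<tau>"
proof -
  have inv: "\<psi> (\<phi> p) = p" "\<phi> (\<psi> p) = p" for p
    using \<phi> unfolding mutually_inverse_holomorphic_def by blast+
  obtain U where U: "open U" "0 \<in> U" "same_germ (\<Phi> ` (\<Gamma> \<inter> U)) (\<phi> ` \<Gamma>)"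
    using im unfolding germ_image_def by blast
  have lim': "((\<lambda>t. \<Phi> (branch_param t)) \<longlongrightarrow> 0) (at 0)"
    by (rule filterlim_compose[OF lim branch_param_tendsto(1)])
  have lim'': "((\<lambda>t. \<psi> (\<Phi> (branch_param t))) \<longlongrightarrow> 0) (at 0)"
    by (rule filterlim_compose[OF
          mutually_inverse_holomorphic_continuous(2)[OF mutually_inverse_holomorphic_sym[OF \<phi>]] lim'])
  have \<Gamma>': "\<forall>\<^sub>F p in nhds 0. p \<in> \<Gamma> \<longleftrightarrow> branch_eq p = 0" using \<Gamma> by (simp add: same_germ_def)
  have Uev: "\<forall>\<^sub>F p in nhds 0. p \<in> U" using U by (intro eventually_nhds_in_open)
  show ?thesis
    using eventually_compose_filterlim[OF U(3)[unfolded same_germ_def] lim']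
      eventually_compose_filterlim[OF \<Gamma>' branch_param_tendsto(1)]
      eventually_compose_filterlim[OF \<Gamma>' lim'']
      eventually_compose_filterlim[OF Uev branch_param_tendsto(1)]
  proof eventually_elim
    case (elim t)
    have "branch_param t \<in> \<Gamma> \<inter> U" using elim(2,4) branch_eq_zero_iff by blast
    then have "\<Phi> (branch_param t) \<in> \<phi> ` \<Gamma>" using elim(1) by blast
    then have "\<psi> (\<Phi> (branch_param t)) \<in> \<Gamma>" using inv(1) by auto
    then show ?case using elim(3) branch_eq_zero_iff by blast
  qed
qed

theorem proposition1:
  fixes \<Gamma> :: "c2 set"
  assumes "parametrized_by \<Gamma> (\<lambda>t. (t ^ 6, t ^ 7 + t ^ 10 + t ^ 11))"
  shows "\<not> complete_class (analytic_class \<Gamma>)"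
proof
  assume complete: "complete_class (analytic_class \<Gamma>)"
  have \<Gamma>: "same_germ \<Gamma> {p. branch_eq p = 0}"
    using assms by (intro branch_same_germ) (simp add: branch_param_def[abs_def])
  define \<omega> where "\<omega> = Complex (-1/2) (sqrt 3 / 2)"
  have "\<omega> * \<omega> + \<omega> + 1 = 0" by (simp add: \<omega>_def complex_eq_iff)
  then have w: "\<omega> ^ 3 = 1" by algebra
  have w1: "\<omega> \<noteq> 1" by (simp add: \<omega>_def complex_eq_iff)
  have w0: "\<omega> \<noteq> 0" using w by auto
  let ?\<phi> = "resonant_map \<omega>" and ?\<psi> = "resonant_map_inv \<omega>"
  note \<phi> = resonant_map_inverse[OF w]
  have "mutually_inverse_holomorphic (\<lambda>p. p) (\<lambda>p. p)"
    by (simp add: mutually_inverse_holomorphic_def cdiff2_fst cdiff2_snd)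
  from analytic_class_image[OF this \<Gamma> irreducible_branch_eq] have "\<Gamma> \<in> analytic_class \<Gamma>" by simp
  moreover have "?\<phi> ` \<Gamma> \<in> analytic_class \<Gamma>"
    by (rule analytic_class_image[OF \<phi> \<Gamma> irreducible_branch_eq])
  ultimately have "connected_by_geodesic \<Gamma> (?\<phi> ` \<Gamma>)" using complete by (simp add: complete_class_def)
  then obtain X \<Phi> where X: "singular_vector_field X" "time_one_flow X \<Phi>"
    and im: "germ_image \<Phi> \<Gamma> (?\<phi> ` \<Gamma>)" by (auto simp: connected_by_geodesic_def)
  obtain a b c d e a' b' c' d' e' where J1: "jet2 (\<lambda>p. fst (\<Phi> p)) a b c d e"
    and J2: "jet2 (\<lambda>p. snd (\<Phi> p)) a' b' c' d' e'" and det: "a * b' \<noteq> a' * b"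
    using geodesic_jet2[OF X] .
  have "(\<Phi> \<longlongrightarrow> 0) (nhds 0)"
    using tendsto_Pair[OF jet2_tendsto_0[OF J1] jet2_tendsto_0[OF J2]] by (simp add: zero_prod_def)
  from connected_imp_param_image[OF \<Gamma> \<phi> im this]
  have stab: "\<forall>\<^sub>F t in at 0. \<exists>\<tau>. ?\<psi> (\<Phi> (branch_param t)) = branch_param \<tau>" .
  have G2: "jet2 (\<lambda>p. snd (?\<psi> (\<Phi> p))) (\<omega> * a') (\<omega> * b') (\<omega> * (c' - a ^ 2)) (\<omega> * (d' - 2 * a * b)) (\<omega> * (e' - b ^ 2))"
    using jet2_lincomb[OF J2 jet2_square[OF J1], of \<omega> "- \<omega>"] by (simp add: resonant_map_inv_def algebra_simps)
  \<comment> \<open>The first component of the inverse is \<omega>^2 (x - v^2) with v its second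
    component, which is why the jet of the latter comes first and is squared here.\<close>
  have G1: "jet2 (\<lambda>p. fst (?\<psi> (\<Phi> p))) (\<omega> ^ 2 * a) (\<omega> ^ 2 * b) (\<omega> ^ 2 * (c - (\<omega> * a') ^ 2))
      (\<omega> ^ 2 * (d - 2 * (\<omega> * a') * (\<omega> * b'))) (\<omega> ^ 2 * (e - (\<omega> * b') ^ 2))"
    using jet2_lincomb[OF J1 jet2_square[OF G2], of "\<omega> ^ 2" "- (\<omega> ^ 2)"]
    by (simp add: resonant_map_inv_def right_diff_distrib)
  have "\<omega> ^ 2 * a * (\<omega> * b') \<noteq> \<omega> * a' * (\<omega> ^ 2 * b)" using det w0 by simp
  note id = branch_stabilizer_jet2[OF G1 G2 this stab]
  \<comment> \<open>Equating the jet of the composition with the identity returns the coefficients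
    of \<open>resonant_map\<close>; in particular e = (\<omega> b')^2 = 1 and c' = a^2 = \<omega>^2
    are the two resonant ones.\<close>
  have coeffs: "a = \<omega>" "b = 0" "e = 1" "a' = 0" "b' = \<omega>\<^sup>2" "c' = \<omega>\<^sup>2"
  proof -
    have "\<omega> ^ 2 * a = 1" "\<omega> * b' = 1" using id by simp_all
    then show a: "a = \<omega>" and b': "b' = \<omega>\<^sup>2" using w by algebra+
    show "b = 0" "a' = 0" using id w0 by simp_all
    show "e = 1" "c' = \<omega>\<^sup>2" using id w0 a b' by (simp_all add: w flip: power_Suc2)
  qed
  show False
    using no_vector_field_with_resonant_jet2[OF X w w1] J1 J2 unfolding coeffs by blast
qed

end
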